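(* Fix $0<p<1$ and let $\mu$ be an invariant random measure on $\mathbb{R}$ of unit intensity. (i) If $\limsup_{n\to\infty}\sqrt{\operatorname{Var}(\mu([0,n)))}\cdot n^{p-1}=0$, then $\mathfrak{c}_\infty(q)<\infty$ for all $0<q<p$. (ii) Assume that $\mu$ has a regular variance and satisfies a CLT. If $\limsup_{n\to\infty}\sqrt{\operatorname{Var}(\mu([0,n)))}\cdot n^{p-1}>0$, then $\mathfrak{c}_\infty(p)=\infty$.
   Context: Setting. $(\Omega,\mathcal{F},\mathbb{P})$ is a probability space with a measurable flow $\theta_t:\Omega\to\Omega$, $t\in\mathbb{R}$: the map $(\omega,t)\mapsto\theta_t\omega$ is measurable with respect to $\mathcal{F}\otimes\mathcal{B}(\mathbb{R})$ and $\mathcal{F}$, $\theta_0=\mathrm{Id}$, and $\theta_t\circ\theta_s=\theta_{t+s}$ for all $s,t\in\mathbb{R}$. The probability measure $\mathbb{P}$ is stationary, i.e. $\mathbb{P}\circ\theta_t=\mathbb{P}$ for all $t\in\mathbb{R}$. $\lambda$ denotes Lebesgue measure on $\mathbb{R}$, and $S_*\rho=\rho\circ S^{-1}$ denotes the push-forward of a measure $\rho$ by a map $S$. A random measure on $\mathbb{R}$ is a measurable map $\mu$ from $\Omega$ to the set of $\sigma$-finite measures on $\mathbb{R}$; one writes $\mu(\omega,A)$ or $\mu_\omega(A)$ for the mass of the Borel set $A$. It is invariant if $\mu(\theta_t\omega,A-t)=\mu(\omega,A)$ for all Borel $A\subseteq\mathbb{R}$, $t\in\mathbb{R}$, $\omega\in\Omega$.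 It has unit intensity if $\mathbb{E}[\mu([0,1))]=1$. Transport cost. An invariant transport map (allocation rule) is a measurable map $S:\Omega\times\mathbb{R}\to\mathbb{R}$ with $S(\theta_t\omega,s-t)=S(\omega,s)-t$ for all $s,t\in\mathbb{R}$, $\omega\in\Omega$. One writes $S_*\lambda=\mu$ if $\mathbb{P}$-a.s. the push-forward of $\lambda$ under $S(\omega,\cdot)$ is $\mu_\omega$, and $S(0)$ for the random variable $\omega\mapsto S(\omega,0)$. For $p>0$, $$\mathfrak{c}_\infty(p)=\inf_{S:\ S_*\lambda=\mu}\mathbb{E}\big[|S(0)|^p\big]\in[0,\infty],$$ the infimum being over invariant transport maps $S$ with $S_*\lambda=\mu$ (with $\inf\emptyset=\infty$). CLT. The random measure $\mu$ satisfies a CLT if the sequence $\big((\mu([0,n))-\mathbb{E}[\mu([0,n))])/\sqrt{\operatorname{Var}(\mu([0,n)))}\big)_{n\in\mathbb{N}}$ converges weakly to a standard normal distribution. Regular variance. Let $f(t):=\operatorname{Var}(\mu([0,t)))$ for $t\ge 0$. The random measure $\mu$ has a regular variance if for every sequence $(a_n)_{n\in\mathbb{N}}$ of nonnegative real numbers, $\lim_{n\to\infty}a_n/n=0$ implies $\lim_{n\to\infty}f(a_n)/f(n)=0$. *)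

theory Defs
  imports "HOL-Probability.Probability"
begin

locale stationary_flow = prob_space M
  for M :: "'a measure" and \<theta> :: "real \<Rightarrow> 'a \<Rightarrow> 'a" +
  assumes flow_measurable: "(\<lambda>(\<omega>, t). \<theta> t \<omega>) \<in> measurable (M \<Otimes>\<^sub>M borel) M"
    and flow_zero: "\<And>\<omega>. \<omega> \<in> space M \<Longrightarrow> \<theta> 0 \<omega> = \<omega>"
    and flow_add: "\<And>s t \<omega>. \<omega> \<in> space M \<Longrightarrow> \<theta> t (\<theta> s \<omega>) = \<theta> (t + s) \<omega>"
    and stationary: "\<And>t. distr M M (\<theta> t) = M"

text \<open>The set of \<open>\<sigma>\<close>-finite Borel measures carries the \<open>\<sigma>\<close>-algebra generated by the evaluations
  at Borel sets.\<close>

definition random_measure :: "'a measure \<Rightarrow> ('a \<Rightarrow> real measure) \<Rightarrow> bool" where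
  "random_measure M \<mu> \<longleftrightarrow>
     (\<forall>\<omega>\<in>space M. sets (\<mu> \<omega>) = sets borel \<and> sigma_finite_measure (\<mu> \<omega>)) \<and>
     (\<forall>A\<in>sets borel. (\<lambda>\<omega>. emeasure (\<mu> \<omega>) A) \<in> borel_measurable M)"

definition invariant_measure ::
  "'a measure \<Rightarrow> (real \<Rightarrow> 'a \<Rightarrow> 'a) \<Rightarrow> ('a \<Rightarrow> real measure) \<Rightarrow> bool" where
  "invariant_measure M \<theta> \<mu> \<longleftrightarrow>
     (\<forall>\<omega>\<in>space M. \<forall>t. \<forall>A\<in>sets borel.
        emeasure (\<mu> (\<theta> t \<omega>)) ((\<lambda>x. x - t) ` A) = emeasure (\<mu> \<omega>) A)"

definition unit_intensity :: "'a measure \<Rightarrow> ('a \<Rightarrow> real measure) \<Rightarrow> bool" where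
  "unit_intensity M \<mu> \<longleftrightarrow> (\<integral>\<^sup>+\<omega>. emeasure (\<mu> \<omega>) {0..<1} \<partial>M) = 1"

definition invariant_transport_map ::
  "'a measure \<Rightarrow> (real \<Rightarrow> 'a \<Rightarrow> 'a) \<Rightarrow> ('a \<Rightarrow> real \<Rightarrow> real) \<Rightarrow> bool" where
  "invariant_transport_map M \<theta> S \<longleftrightarrow>
     (\<lambda>(\<omega>, s). S \<omega> s) \<in> borel_measurable (M \<Otimes>\<^sub>M borel) \<and>
     (\<forall>\<omega>\<in>space M. \<forall>s t. S (\<theta> t \<omega>) (s - t) = S \<omega> s - t)"

definition transports_lebesgue_to ::
  "'a measure \<Rightarrow> ('a \<Rightarrow> real \<Rightarrow> real) \<Rightarrow> ('a \<Rightarrow> real measure) \<Rightarrow> bool" where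
  "transports_lebesgue_to M S \<mu> \<longleftrightarrow> (AE \<omega> in M. distr lborel borel (S \<omega>) = \<mu> \<omega>)"

definition transport_cost ::
  "'a measure \<Rightarrow> (real \<Rightarrow> 'a \<Rightarrow> 'a) \<Rightarrow> ('a \<Rightarrow> real measure) \<Rightarrow> real \<Rightarrow> ennreal" where
  "transport_cost M \<theta> \<mu> p =
     (INF S\<in>{S. invariant_transport_map M \<theta> S \<and> transports_lebesgue_to M S \<mu>}.
        \<integral>\<^sup>+\<omega>. ennreal (\<bar>S \<omega> 0\<bar> powr p) \<partial>M)"

text \<open>For an invariant random measure of unit intensity the mass of \<open>[0,t)\<close> has expectation \<open>t\<close>,
  so it is almost surely finite and the real-valued \<open>measure\<close> and the Bochner integral lose
  nothing. Its variance may be infinite and is therefore taken in \<open>[0,\<infinity>]\<close>.\<close>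

definition mass_mean :: "'a measure \<Rightarrow> ('a \<Rightarrow> real measure) \<Rightarrow> real \<Rightarrow> real" where
  "mass_mean M \<mu> t = (\<integral>\<omega>. measure (\<mu> \<omega>) {0..<t} \<partial>M)"

definition mass_variance :: "'a measure \<Rightarrow> ('a \<Rightarrow> real measure) \<Rightarrow> real \<Rightarrow> ennreal" where
  "mass_variance M \<mu> t =
     (\<integral>\<^sup>+\<omega>. ennreal ((measure (\<mu> \<omega>) {0..<t} - mass_mean M \<mu> t)\<^sup>2) \<partial>M)"

definition mass_std_dev :: "'a measure \<Rightarrow> ('a \<Rightarrow> real measure) \<Rightarrow> real \<Rightarrow> ennreal" where
  "mass_std_dev M \<mu> t =
     (if mass_variance M \<mu> t = \<infinity> then \<infinity> else ennreal (sqrt (enn2real (mass_variance M \<mu> t))))"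

text \<open>If the variance of the mass of \<open>[0,n)\<close> is \<open>0\<close> or \<open>\<infinity>\<close>, the normalised variable below is
  identically \<open>0\<close> (as \<open>enn2real \<infinity> = 0\<close> and \<open>x / 0 = 0\<close>). A CLT thus forces the variance to be
  positive and finite for all large \<open>n\<close>.\<close>

definition satisfies_CLT :: "'a measure \<Rightarrow> ('a \<Rightarrow> real measure) \<Rightarrow> bool" where
  "satisfies_CLT M \<mu> \<longleftrightarrow>
     weak_conv_m
       (\<lambda>n::nat. distr M borel
          (\<lambda>\<omega>. (measure (\<mu> \<omega>) {0..<real n} - mass_mean M \<mu> (real n))
                 / enn2real (mass_std_dev M \<mu> (real n))))
       std_normal_distribution"

definition regular_variance :: "'a measure \<Rightarrow> ('a \<Rightarrow> real measure) \<Rightarrow> bool" where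
  "regular_variance M \<mu> \<longleftrightarrow>
     (\<forall>a::nat \<Rightarrow> real. (\<forall>n. 0 \<le> a n) \<longrightarrow> (\<lambda>n. a n / real n) \<longlonglongrightarrow> 0 \<longrightarrow>
        (\<lambda>n. mass_variance M \<mu> (a n) / mass_variance M \<mu> (real n)) \<longlonglongrightarrow> 0)"

end

theory Submission
  imports Defs
begin

text \<open>
  Write \<open>\<lambda>\<close> for Lebesgue measure and call \<open>|B| - \<mu>(B)\<close> the excess of an interval \<open>B\<close>.

  \<^emph>\<open>Infinite cost.\<close> If \<open>S\<close> transports \<open>\<lambda>\<close> to \<open>\<mu>\<close>, then the excess of \<open>[0,n)\<close> is the mass that \<open>S\<close> carries
  out of \<open>[0,n)\<close> minus the mass that it carries in. As \<open>S(x) - x\<close> has the law of \<open>S(0)\<close> for every \<open>x\<close>,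
  Fubini's theorem evaluates both expected flows to \<open>E[min(|S(0)|, n)]\<close>
  (\<open>expected_flux\<close>, \<open>expected_discrepancy_le\<close>). When \<open>E[|S(0)|\<^sup>p]\<close> is finite this is \<open>o(n\<^bsup>1-p\<^esup>)\<close> by
  dominated convergence. Under a CLT the first absolute moment of the fluctuations is at least a constant
  times their standard deviation, which is therefore \<open>o(n\<^bsup>1-p\<^esup>)\<close> as well
  (\<open>limsup_std_dev_eq_0_of_finite_cost\<close>).

  \<^emph>\<open>Finite cost, the coupling.\<close> Fix a grid of nested dyadic intervals. At level \<open>j\<close> match, inside every
  block of length \<open>2^j\<close>, as much of the still unmatched Lebesgue mass with the still unmatched \<open>\<mu>\<close>-mass as
  possible, by a multiple of the product measure. Afterwards a block has leftovers of one kind only, in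
  an amount equal to the positive or negative part of its excess. This has expectation \<open>O(2^(j(1-p)))\<close>, so
  that a point stays unmatched after level \<open>j\<close> with probability \<open>O(2^(-jp))\<close>; those matched at the next
  level move by at most \<open>2^(j+1)\<close>, and \<open>\<Sum>\<^sub>j 2^(jq) 2^(-jp)\<close> converges. The grid is not invariant, but the
  average over its offset is. This produces, without any additional randomness, an invariant
  coupling with a density \<open>K\<close> with respect to \<open>\<lambda> \<otimes> \<mu>\<close> (\<open>level_kernel_row\<close>, \<open>expected_unmatched_Suc\<close>,
  \<open>expected_match_cost_finite\<close>).

  \<^emph>\<open>Finite cost, the map.\<close> Suppose that the line is cut, in an invariant way, into countably many classes
  of bounded diameter. Replacing the coupling on each class by the quantile map onto
  its image under the coupling keeps the images and increases the expected cost by a bounded amount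
  (\<open>nn_integral_class_map\<close>). Such classes exist unless \<open>\<mu>\<close> is a multiple of \<open>\<lambda>\<close>: some window mass
  \<open>\<mu>(t,t+r]\<close> then takes values below \<open>c\<close> and above \<open>d\<close> for rationals \<open>c < d\<close>, and the points at which such values
  are next attained, together with their integer translates, label the classes (\<open>label_countable\<close>,
  \<open>unlabelled_mu\<close>). If \<open>\<mu>\<close> is a multiple of \<open>\<lambda>\<close>, the map is the identity. In both cases the image of
  \<open>\<lambda>\<close> is at most \<open>\<mu>\<close>, and equality follows because the two have the same intensity
  (\<open>transport_image_le\<close>, \<open>transport_pushes_lebesgue_to_mu\<close>).
\<close>

section \<open>Stationary flows\<close>

lemma measurable_uncurried:
  assumes "(\<lambda>(x, y). g x y) \<in> A \<Otimes>\<^sub>M B \<rightarrow>\<^sub>M C" "f \<in> N \<rightarrow>\<^sub>M A" "h \<in> N \<rightarrow>\<^sub>M B"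
  shows "(\<lambda>w. g (f w) (h w)) \<in> N \<rightarrow>\<^sub>M C"
  using measurable_compose[OF measurable_Pair[OF assms(2,3)] assms(1)] by simp

context stationary_flow
begin

lemma flow_measurable_pair [measurable (raw)]:
  assumes [measurable]: "f \<in> N \<rightarrow>\<^sub>M M" "g \<in> borel_measurable N"
  shows "(\<lambda>x. \<theta> (g x) (f x)) \<in> N \<rightarrow>\<^sub>M M"
  by (rule measurable_uncurried[OF flow_measurable assms])

lemma flow_in_space: "\<omega> \<in> space M \<Longrightarrow> \<theta> t \<omega> \<in> space M"
  using measurable_space[OF flow_measurable_pair[of "\<lambda>x. x" M "\<lambda>_. t"], of \<omega>] by simp

lemma nn_integral_flow:
  assumes [measurable]: "f \<in> borel_measurable M"
  shows "(\<integral>\<^sup>+\<omega>. f (\<theta> t \<omega>) \<partial>M) = (\<integral>\<^sup>+\<omega>. f \<omega> \<partial>M)"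
proof -
  have "(\<integral>\<^sup>+\<omega>. f \<omega> \<partial>M) = (\<integral>\<^sup>+\<omega>. f \<omega> \<partial>(distr M M (\<theta> t)))"
    by (simp add: stationary)
  also have "\<dots> = (\<integral>\<^sup>+\<omega>. f (\<theta> t \<omega>) \<partial>M)"
    by (rule nn_integral_distr) simp_all
  finally show ?thesis ..
qed

section \<open>Invariant transport maps\<close>

definition "displacement_cost S p = (\<integral>\<^sup>+\<omega>. ennreal (\<bar>S \<omega> 0\<bar> powr p) \<partial>M)"

lemma transport_map_shift:
  assumes "invariant_transport_map M \<theta> S" "\<omega> \<in> space M"
  shows "S \<omega> x = x + S (\<theta> x \<omega>) 0"
  using assms unfolding invariant_transport_map_def by (metis add.commute diff_add_cancel diff_self)

lemma transport_map_measurable: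
  assumes "invariant_transport_map M \<theta> S"
  shows "(\<lambda>(\<omega>, s). S \<omega> s) \<in> borel_measurable (M \<Otimes>\<^sub>M borel)"
  using assms by (simp add: invariant_transport_map_def)

lemma transport_map_measurable_pair:
  assumes "invariant_transport_map M \<theta> S"
    and "f \<in> N \<rightarrow>\<^sub>M M" "g \<in> borel_measurable N"
  shows "(\<lambda>x. S (f x) (g x)) \<in> borel_measurable N"
  by (rule measurable_uncurried[OF transport_map_measurable]) fact+

text \<open>Stationarity for a fixed starting point \<open>x\<close>, integrated over \<open>x\<close>: every mass transport
  computation for invariant maps below is an instance.\<close>

lemma expectation_along_map:
  fixes g :: "real \<Rightarrow> real \<Rightarrow> ennreal"
  assumes S: "invariant_transport_map M \<theta> S"
    and g[measurable]: "(\<lambda>(x, y). g x y) \<in> borel_measurable (borel \<Otimes>\<^sub>M borel)"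
  shows "(\<integral>\<^sup>+\<omega>. \<integral>\<^sup>+x. g x (S \<omega> x) \<partial>lborel \<partial>M) = (\<integral>\<^sup>+\<omega>. \<integral>\<^sup>+x. g x (x + S \<omega> 0) \<partial>lborel \<partial>M)"
proof -
  interpret P: pair_sigma_finite lborel M ..
  note [measurable] = transport_map_measurable_pair[OF S]
  have [measurable]: "(\<lambda>u. g (fst u) (S (snd u) (fst u))) \<in> borel_measurable (lborel \<Otimes>\<^sub>M M)"
    by measurable
  have "(\<integral>\<^sup>+\<omega>. \<integral>\<^sup>+x. g x (S \<omega> x) \<partial>lborel \<partial>M) = (\<integral>\<^sup>+x. \<integral>\<^sup>+\<omega>. g x (S \<omega> x) \<partial>M \<partial>lborel)"
    by (rule P.Fubini') (simp add: split_beta')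
  also have "\<dots> = (\<integral>\<^sup>+x. \<integral>\<^sup>+\<omega>. g x (x + S (\<theta> x \<omega>) 0) \<partial>M \<partial>lborel)"
    by (intro nn_integral_cong) (simp add: transport_map_shift[OF S, symmetric])
  also have "\<dots> = (\<integral>\<^sup>+x. \<integral>\<^sup>+\<omega>. g x (x + S \<omega> 0) \<partial>M \<partial>lborel)"
    by (intro nn_integral_cong nn_integral_flow[where f="\<lambda>\<omega>. g x (x + S \<omega> 0)" for x]) measurable
  also have "\<dots> = (\<integral>\<^sup>+\<omega>. \<integral>\<^sup>+x. g x (x + S \<omega> 0) \<partial>lborel \<partial>M)"
    by (rule P.Fubini'[symmetric]) (simp add: split_beta')
  finally show ?thesis .
qed

end

text \<open>Translation of an interval by \<open>d\<close> moves equally much mass out of it and into it, and no more than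
  the interval holds.\<close>

lemma emeasure_exit_interval:
  fixes d n :: real assumes "0 \<le> n"
  shows "emeasure lborel {x. x \<in> {0..<n} \<and> x + d \<in> - {0..<n}} = ennreal (min \<bar>d\<bar> n)"
proof -
  have "{x. x \<in> {0..<n} \<and> x + d \<in> - {0..<n}} =
     (if 0 \<le> d then {max 0 (n - d)..<n} else {0..<min n (-d)})" using assms by auto
  then show ?thesis using assms by (auto simp: min_def max_def)
qed

lemma emeasure_enter_interval:
  fixes d n :: real assumes "0 \<le> n"
  shows "emeasure lborel {x. x \<in> - {0..<n} \<and> x + d \<in> {0..<n}} = ennreal (min \<bar>d\<bar> n)"
proof -
  have "{x. x \<in> - {0..<n} \<and> x + d \<in> {0..<n}} =
     (if 0 \<le> d then {-d..<min 0 (n - d)} else {max n (-d)..<n - d})" using assms by auto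
  then show ?thesis using assms by (auto simp: min_def max_def)
qed

context stationary_flow
begin

lemma expected_flux:
  assumes S: "invariant_transport_map M \<theta> S" and [measurable]: "A \<in> sets borel" "B \<in> sets borel"
  shows "(\<integral>\<^sup>+\<omega>. emeasure lborel {x. x \<in> A \<and> S \<omega> x \<in> B} \<partial>M) =
    (\<integral>\<^sup>+\<omega>. emeasure lborel {x. x \<in> A \<and> x + S \<omega> 0 \<in> B} \<partial>M)"
proof -
  note [measurable] = transport_map_measurable_pair[OF S]
  let ?g = "\<lambda>x y. indicator A x * indicator B y :: ennreal"
  have em: "emeasure lborel {x. x \<in> A \<and> f x \<in> B} = (\<integral>\<^sup>+x. ?g x (f x) \<partial>lborel)"
    if [measurable]: "f \<in> borel_measurable borel" for f
  proof -
    have "emeasure lborel {x. x \<in> A \<and> f x \<in> B} = (\<integral>\<^sup>+x. indicator {x. x \<in> A \<and> f x \<in> B} x \<partial>lborel)"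
      by (rule nn_integral_indicator[symmetric]) measurable
    also have "\<dots> = (\<integral>\<^sup>+x. ?g x (f x) \<partial>lborel)"
      by (intro nn_integral_cong) (auto split: split_indicator)
    finally show ?thesis .
  qed
  have "(\<integral>\<^sup>+\<omega>. emeasure lborel {x. x \<in> A \<and> S \<omega> x \<in> B} \<partial>M) = (\<integral>\<^sup>+\<omega>. \<integral>\<^sup>+x. ?g x (S \<omega> x) \<partial>lborel \<partial>M)"
    by (intro nn_integral_cong em) measurable
  also have "\<dots> = (\<integral>\<^sup>+\<omega>. \<integral>\<^sup>+x. ?g x (x + S \<omega> 0) \<partial>lborel \<partial>M)"
    by (rule expectation_along_map[OF S]) measurable
  also have "\<dots> = (\<integral>\<^sup>+\<omega>. emeasure lborel {x. x \<in> A \<and> x + S \<omega> 0 \<in> B} \<partial>M)"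
    by (intro nn_integral_cong em[symmetric]) measurable
  finally show ?thesis .
qed

end

section \<open>The central limit theorem forces infinite cost\<close>

locale unit_invariant_measure = stationary_flow +
  fixes \<mu> :: "'a \<Rightarrow> real measure"
  assumes random: "random_measure M \<mu>"
    and invariant: "invariant_measure M \<theta> \<mu>"
    and unit: "unit_intensity M \<mu>"
begin

lemma sets_mu: "\<omega> \<in> space M \<Longrightarrow> sets (\<mu> \<omega>) = sets borel"
  and sigma_finite_mu: "\<omega> \<in> space M \<Longrightarrow> sigma_finite_measure (\<mu> \<omega>)"
  using random by (auto simp: random_measure_def)

lemma emeasure_mu_measurable [measurable]:
  "A \<in> sets borel \<Longrightarrow> (\<lambda>\<omega>. emeasure (\<mu> \<omega>) A) \<in> borel_measurable M"
  using random by (auto simp: random_measure_def)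

lemma emeasure_mu_shift:
  assumes "\<omega> \<in> space M"
  shows "emeasure (\<mu> \<omega>) {a + t..<b + t} = emeasure (\<mu> (\<theta> t \<omega>)) {a..<b}"
proof -
  have "(\<lambda>x. x - t) ` {a + t..<b + t} = {a..<b}"
    by (auto simp: image_iff Bex_def algebra_simps intro: exI[of _ "x + t" for x])
  moreover have "emeasure (\<mu> (\<theta> t \<omega>)) ((\<lambda>x. x - t) ` {a + t..<b + t}) = emeasure (\<mu> \<omega>) {a + t..<b + t}"
    using invariant assms by (simp add: invariant_measure_def)
  ultimately show ?thesis by simp
qed

lemma expectation_mu_shift:
  "(\<integral>\<^sup>+\<omega>. emeasure (\<mu> \<omega>) {a + t..<b + t} \<partial>M) = (\<integral>\<^sup>+\<omega>. emeasure (\<mu> \<omega>) {a..<b} \<partial>M)"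
proof -
  have "(\<integral>\<^sup>+\<omega>. emeasure (\<mu> \<omega>) {a + t..<b + t} \<partial>M) = (\<integral>\<^sup>+\<omega>. emeasure (\<mu> (\<theta> t \<omega>)) {a..<b} \<partial>M)"
    by (intro nn_integral_cong emeasure_mu_shift)
  also have "\<dots> = (\<integral>\<^sup>+\<omega>. emeasure (\<mu> \<omega>) {a..<b} \<partial>M)"
    by (rule nn_integral_flow) simp
  finally show ?thesis .
qed

lemma expected_mass_unit: "(\<integral>\<^sup>+\<omega>. emeasure (\<mu> \<omega>) {a..<a + 1} \<partial>M) = 1"
  using expectation_mu_shift[of 0 a 1] unit by (simp add: unit_intensity_def add.commute)

lemma expected_mass: "(\<integral>\<^sup>+\<omega>. emeasure (\<mu> \<omega>) {a..<a + real n} \<partial>M) = of_nat n"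
proof (induction n)
  case (Suc n)
  have "(\<integral>\<^sup>+\<omega>. emeasure (\<mu> \<omega>) {a..<a + real (Suc n)} \<partial>M) =
     (\<integral>\<^sup>+\<omega>. emeasure (\<mu> \<omega>) {a..<a + real n} + emeasure (\<mu> \<omega>) {a + real n..<a + real n + 1} \<partial>M)"
  proof (intro nn_integral_cong)
    fix \<omega> assume "\<omega> \<in> space M"
    then have [simp]: "sets (\<mu> \<omega>) = sets borel" by (rule sets_mu)
    show "emeasure (\<mu> \<omega>) {a..<a + real (Suc n)} =
       emeasure (\<mu> \<omega>) {a..<a + real n} + emeasure (\<mu> \<omega>) {a + real n..<a + real n + 1}"
      by (subst plus_emeasure) (auto intro!: arg_cong[where f="emeasure (\<mu> \<omega>)"])
  qed
  also have "\<dots> = of_nat n + 1"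
    by (subst nn_integral_add) (simp_all add: Suc.IH expected_mass_unit)
  finally show ?case by (simp add: add.commute)
qed simp

lemma AE_finite_mass: "AE \<omega> in M. emeasure (\<mu> \<omega>) {a..<a + real n} < \<infinity>"
proof -
  have "AE \<omega> in M. emeasure (\<mu> \<omega>) {a..<a + real n} \<noteq> \<infinity>"
    by (rule nn_integral_PInf_AE) (simp_all add: expected_mass)
  then show ?thesis by (simp add: top.not_eq_extremum)
qed

lemma measure_mu_measurable [measurable]:
  "A \<in> sets borel \<Longrightarrow> (\<lambda>\<omega>. measure (\<mu> \<omega>) A) \<in> borel_measurable M"
  using measurable_compose[OF emeasure_mu_measurable borel_measurable_enn2real] by (simp add: measure_def)

lemma mass_mean_eq: "mass_mean M \<mu> (real n) = real n"
proof -
  have "mass_mean M \<mu> (real n) = enn2real (\<integral>\<^sup>+\<omega>. ennreal (measure (\<mu> \<omega>) {0..<real n}) \<partial>M)"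
    unfolding mass_mean_def by (rule integral_eq_nn_integral) simp_all
  also have "(\<integral>\<^sup>+\<omega>. ennreal (measure (\<mu> \<omega>) {0..<real n}) \<partial>M) = (\<integral>\<^sup>+\<omega>. emeasure (\<mu> \<omega>) {0..<real n} \<partial>M)"
    using AE_finite_mass[of 0 n] by (intro nn_integral_cong_AE) (auto simp: measure_def)
  also have "\<dots> = of_nat n" using expected_mass[of 0 n] by simp
  finally show ?thesis by (simp add: ennreal_of_nat_eq_real_of_nat)
qed

lemma expected_discrepancy_le:
  assumes S: "invariant_transport_map M \<theta> S" and T: "transports_lebesgue_to M S \<mu>"
  shows "(\<integral>\<^sup>+\<omega>. ennreal \<bar>measure (\<mu> \<omega>) {0..<real n} - real n\<bar> \<partial>M)
    \<le> 2 * (\<integral>\<^sup>+\<omega>. ennreal (min \<bar>S \<omega> 0\<bar> (real n)) \<partial>M)"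
proof -
  note [measurable] = transport_map_measurable_pair[OF S]
  let ?I = "{0..<real n}"
  have "(\<integral>\<^sup>+\<omega>. ennreal \<bar>measure (\<mu> \<omega>) ?I - real n\<bar> \<partial>M) \<le>
    (\<integral>\<^sup>+\<omega>. emeasure lborel {x. x \<in> ?I \<and> S \<omega> x \<in> - ?I} + emeasure lborel {x. x \<in> - ?I \<and> S \<omega> x \<in> ?I} \<partial>M)"
  proof (rule nn_integral_mono_AE)
    show "AE \<omega> in M. ennreal \<bar>measure (\<mu> \<omega>) ?I - real n\<bar> \<le>
      emeasure lborel {x. x \<in> ?I \<and> S \<omega> x \<in> - ?I} + emeasure lborel {x. x \<in> - ?I \<and> S \<omega> x \<in> ?I}"
      using T[unfolded transports_lebesgue_to_def] AE_finite_mass[of 0 n] AE_space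
    proof eventually_elim
      case (elim \<omega>)
      have [measurable]: "S \<omega> \<in> borel_measurable borel" using elim by measurable
      let ?in = "{x. x \<in> - ?I \<and> S \<omega> x \<in> ?I}" and ?out = "{x. x \<in> ?I \<and> S \<omega> x \<in> - ?I}"
      let ?st = "{x\<in>?I. S \<omega> x \<in> ?I}"
      have "emeasure (\<mu> \<omega>) ?I = emeasure lborel {x. S \<omega> x \<in> ?I}"
        unfolding elim(1)[symmetric] by (subst emeasure_distr) (auto simp: vimage_def)
      also have "{x. S \<omega> x \<in> ?I} = ?st \<union> ?in" by auto
      also have "emeasure lborel \<dots> = emeasure lborel ?st + emeasure lborel ?in"
        by (subst plus_emeasure) auto
      finally have 1: "emeasure (\<mu> \<omega>) ?I = emeasure lborel ?st + emeasure lborel ?in" .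
      have "ennreal (real n) = emeasure lborel ?I" by simp
      also have "?I = ?st \<union> ?out" by auto
      also have "emeasure lborel \<dots> = emeasure lborel ?st + emeasure lborel ?out"
        by (subst plus_emeasure) auto
      finally have 2: "ennreal (real n) = emeasure lborel ?st + emeasure lborel ?out" .
      have "emeasure (\<mu> \<omega>) ?I < \<infinity>" using elim by simp
      then obtain a b c where abc: "emeasure lborel ?st = ennreal a" "emeasure lborel ?in = ennreal b"
        "emeasure lborel ?out = ennreal c" "0 \<le> a" "0 \<le> b" "0 \<le> c"
        using 1 2 by (cases "emeasure lborel ?st"; cases "emeasure lborel ?in"; cases "emeasure lborel ?out") auto
      have "measure (\<mu> \<omega>) ?I = a + b" "real n = a + c"
        using 1 2 abc by (simp_all add: measure_def ennreal_plus[symmetric] del: ennreal_plus)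
      then show ?case unfolding abc using abc
        by (simp add: ennreal_plus[symmetric] del: ennreal_plus)
    qed
  qed
  also have "\<dots> = (\<integral>\<^sup>+\<omega>. emeasure lborel {x. x \<in> ?I \<and> S \<omega> x \<in> - ?I} \<partial>M)
      + (\<integral>\<^sup>+\<omega>. emeasure lborel {x. x \<in> - ?I \<and> S \<omega> x \<in> ?I} \<partial>M)"
    by (rule nn_integral_add) (measurable)
  finally show ?thesis
    by (subst (asm) (1 2) expected_flux[OF S])
      (simp_all add: emeasure_exit_interval emeasure_enter_interval mult_2 del: atLeastLessThan_iff Compl_iff)
qed

end

text \<open>This makes \<open>|S(0)|\<^sup>p\<close> a dominating function, uniformly in \<open>n\<close>, for the normalised truncations.\<close>

lemma truncation_le_powr:
  fixes s n p :: real assumes "0 \<le> s" "0 < n" "0 < p" "p < 1"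
  shows "min s n * n powr (p - 1) \<le> s powr p"
proof (cases "s \<le> n")
  case True
  show ?thesis
  proof (cases "s = 0")
    case False
    with assms have "0 < s" by simp
    have "s * n powr (p - 1) \<le> s * s powr (p - 1)"
      using True \<open>0 < s\<close> assms by (intro mult_left_mono powr_mono2') auto
    also have "\<dots> = s powr p" using \<open>0 < s\<close> by (simp add: powr_mult_base)
    finally show ?thesis using True by (simp add: min_def)
  qed (use assms in auto)
next
  case False
  then show ?thesis using assms by (simp add: powr_mult_base powr_mono2)
qed

lemma std_normal_truncated_first_moment_pos:
  "0 < (\<integral>x. min \<bar>x\<bar> 1 \<partial>std_normal_distribution)"
proof -
  interpret real_distribution std_normal_distribution by (rule real_dist_normal_dist)
  have int: "integrable std_normal_distribution (\<lambda>x. min \<bar>x\<bar> 1)"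
    by (rule integrable_const_bound[of _ 1]) auto
  have "(\<integral>x. min \<bar>x\<bar> 1 \<partial>std_normal_distribution) \<noteq> 0"
  proof
    assume "(\<integral>x. min \<bar>x\<bar> 1 \<partial>std_normal_distribution) = 0"
    then have "AE x in std_normal_distribution. min \<bar>x\<bar> 1 = 0"
      using int by (subst (asm) integral_nonneg_eq_0_iff_AE) auto
    then have "AE x in std_normal_distribution. x = 0" by eventually_elim (auto simp: min_def split: if_splits)
    then have "AE x in lborel. x = (0::real)"
      by (subst (asm) AE_density) (auto simp: normal_density_pos elim!: eventually_mono)
    moreover have "AE x in lborel. x \<noteq> (0::real)" by (rule AE_lborel_singleton)
    ultimately have "AE x in (lborel::real measure). False" by eventually_elim simp
    then show False by (simp add: AE_iff_null null_sets_def)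
  qed
  moreover have "0 \<le> (\<integral>x. min \<bar>x\<bar> 1 \<partial>std_normal_distribution)" by (rule integral_nonneg_AE) simp
  ultimately show ?thesis by linarith
qed

context unit_invariant_measure
begin

lemma normalised_truncation_tendsto_0:
  assumes S: "invariant_transport_map M \<theta> S" and fin: "displacement_cost S p < \<infinity>"
    and p: "0 < p" "p < 1"
  shows "(\<lambda>n. (\<integral>\<omega>. min \<bar>S \<omega> 0\<bar> (real n) \<partial>M) * real n powr (p - 1)) \<longlonglongrightarrow> 0"
proof -
  note [measurable] = transport_map_measurable_pair[OF S]
  have int: "integrable M (\<lambda>\<omega>. \<bar>S \<omega> 0\<bar> powr p)"
    using fin unfolding displacement_cost_def by (intro integrableI_nonneg) auto
  have "(\<lambda>n. \<integral>\<omega>. min \<bar>S \<omega> 0\<bar> (real n) * real n powr (p - 1) \<partial>M) \<longlonglongrightarrow> (\<integral>\<omega>. 0 \<partial>M)"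
  proof (rule integral_dominated_convergence[OF _ _ int])
    show "AE \<omega> in M. (\<lambda>n. min \<bar>S \<omega> 0\<bar> (real n) * real n powr (p - 1)) \<longlonglongrightarrow> 0"
    proof (rule AE_I2)
      fix \<omega>
      have "(\<lambda>n. \<bar>S \<omega> 0\<bar> * real n powr (p - 1)) \<longlonglongrightarrow> \<bar>S \<omega> 0\<bar> * 0"
        using p by (intro tendsto_mult tendsto_const tendsto_neg_powr filterlim_real_sequentially) auto
      then have lim: "(\<lambda>n. \<bar>S \<omega> 0\<bar> * real n powr (p - 1)) \<longlonglongrightarrow> 0" by simp
      show "(\<lambda>n. min \<bar>S \<omega> 0\<bar> (real n) * real n powr (p - 1)) \<longlonglongrightarrow> 0"
        by (rule Lim_null_comparison[OF _ lim])
          (auto simp: abs_mult intro!: mult_right_mono always_eventually)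
    qed
    show "AE \<omega> in M. norm (min \<bar>S \<omega> 0\<bar> (real n) * real n powr (p - 1)) \<le> \<bar>S \<omega> 0\<bar> powr p" for n
      using truncation_le_powr[of "\<bar>S \<omega> 0\<bar>" "real n" p for \<omega>] p
      by (cases "n = 0") (auto simp: abs_mult)
  qed measurable
  then show ?thesis by simp
qed

text \<open>Weak convergence does not give convergence of first moments, so the normalised masses \<open>X n\<close> are
  tested against the bounded function \<open>h(x) = min(|x|, 1)\<close>: the limit \<open>\<kappa>\<close> is positive, and
  \<open>E[h(X n)] \<le> E[|X n|]\<close> is controlled by the flux.\<close>

lemma limsup_std_dev_eq_0_of_finite_cost:
  assumes S: "invariant_transport_map M \<theta> S" and T: "transports_lebesgue_to M S \<mu>"
    and fin: "displacement_cost S p < \<infinity>" and p: "0 < p" "p < 1"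
    and clt: "satisfies_CLT M \<mu>"
  shows "limsup (\<lambda>n. mass_std_dev M \<mu> (real n) * ennreal (real n powr (p - 1))) = 0"
proof -
  note [measurable] = transport_map_measurable_pair[OF S]
  define s where "s n = enn2real (mass_std_dev M \<mu> (real n))" for n :: nat
  define b where "b n = (\<integral>\<omega>. min \<bar>S \<omega> 0\<bar> (real n) \<partial>M)" for n :: nat
  define X where "X n \<omega> = (measure (\<mu> \<omega>) {0..<real n} - mass_mean M \<mu> (real n)) / s n" for n \<omega>
  define h where "h x = min \<bar>x\<bar> 1" for x :: real
  define \<kappa> where "\<kappa> = (\<integral>x. h x \<partial>std_normal_distribution)"
  have [measurable]: "X n \<in> borel_measurable M" for n unfolding X_def by measurable
  have [measurable]: "h \<in> borel_measurable borel" unfolding h_def by measurable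
  have \<kappa>: "0 < \<kappa>" using std_normal_truncated_first_moment_pos by (simp add: \<kappa>_def h_def)
  have "(\<lambda>n. \<integral>x. h x \<partial>(distr M borel (X n))) \<longlonglongrightarrow> \<kappa>"
    unfolding \<kappa>_def
  proof (rule weak_conv_imp_integral_bdd_continuous_conv)
    show "weak_conv_m (\<lambda>n. distr M borel (X n)) std_normal_distribution"
      using clt unfolding satisfies_CLT_def X_def s_def .
    show "real_distribution (distr M borel (X n))" for n by simp
    show "isCont h x" for x unfolding h_def by (intro continuous_intros)
    show "norm (h x) \<le> 1" for x by (simp add: h_def)
  qed (rule real_dist_normal_dist)
  then have "(\<lambda>n. \<integral>\<omega>. h (X n \<omega>) \<partial>M) \<longlonglongrightarrow> \<kappa>" by (simp add: integral_distr)
  then have ev: "\<forall>\<^sub>F n in sequentially. \<kappa> / 2 < (\<integral>\<omega>. h (X n \<omega>) \<partial>M)"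
    using \<kappa> by (intro order_tendstoD(1)) auto
  have bound: "mass_std_dev M \<mu> (real n) = ennreal (s n) \<and> s n \<le> 4 / \<kappa> * b n"
    if n: "\<kappa> / 2 < (\<integral>\<omega>. h (X n \<omega>) \<partial>M)" for n
  proof -
    have "s n \<noteq> 0"
    proof
      assume "s n = 0"
      then have "X n \<omega> = 0" for \<omega> by (simp add: X_def)
      then show False using n \<kappa> by (simp add: h_def)
    qed
    moreover have "0 \<le> s n" by (simp add: s_def)
    ultimately have s: "0 < s n" by simp
    then have eq: "mass_std_dev M \<mu> (real n) = ennreal (s n)"
      unfolding s_def by (subst ennreal_enn2real) (auto simp: enn2real_positive_iff)
    have int: "integrable M (\<lambda>\<omega>. min \<bar>S \<omega> 0\<bar> (real n))"
      by (rule integrable_const_bound[of _ "real n"]) auto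
    have "ennreal (\<kappa> / 2) \<le> ennreal (\<integral>\<omega>. h (X n \<omega>) \<partial>M)"
      using n by (intro ennreal_leI) simp
    also have "\<dots> = (\<integral>\<^sup>+\<omega>. ennreal (h (X n \<omega>)) \<partial>M)"
      by (intro nn_integral_eq_integral[symmetric] integrable_const_bound[of _ "1"]) (auto simp: h_def)
    also have "\<dots> \<le> (\<integral>\<^sup>+\<omega>. ennreal (1 / s n) * ennreal \<bar>measure (\<mu> \<omega>) {0..<real n} - real n\<bar> \<partial>M)"
      using s by (intro nn_integral_mono)
        (auto simp: h_def X_def mass_mean_eq ennreal_mult'[symmetric] intro!: ennreal_leI)
    also have "\<dots> = ennreal (1 / s n) * (\<integral>\<^sup>+\<omega>. ennreal \<bar>measure (\<mu> \<omega>) {0..<real n} - real n\<bar> \<partial>M)"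
      by (rule nn_integral_cmult) measurable
    also have "\<dots> \<le> ennreal (1 / s n) * (2 * (\<integral>\<^sup>+\<omega>. ennreal (min \<bar>S \<omega> 0\<bar> (real n)) \<partial>M))"
      by (intro mult_left_mono expected_discrepancy_le S T) simp
    also have "(\<integral>\<^sup>+\<omega>. ennreal (min \<bar>S \<omega> 0\<bar> (real n)) \<partial>M) = ennreal (b n)"
      unfolding b_def by (rule nn_integral_eq_integral[OF int]) simp
    also have "ennreal (1 / s n) * (2 * ennreal (b n)) = ennreal (1 / s n * (2 * b n))"
      using s by (subst ennreal_mult') (auto simp: ennreal_mult')
    finally have "\<kappa> / 2 \<le> 1 / s n * (2 * b n)"
      using s by (subst (asm) ennreal_le_iff) (auto simp: b_def intro!: integral_nonneg_AE)
    then show ?thesis using eq s \<kappa> by (simp add: field_simps)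
  qed
  have "(\<lambda>n. ennreal (4 / \<kappa> * (b n * real n powr (p - 1)))) \<longlonglongrightarrow> ennreal (4 / \<kappa> * 0)"
    unfolding b_def
    by (intro tendsto_ennrealI tendsto_mult tendsto_const normalised_truncation_tendsto_0 S fin p)
  then have lim: "(\<lambda>n. ennreal (4 / \<kappa> * (b n * real n powr (p - 1)))) \<longlonglongrightarrow> 0" by simp
  have "(\<lambda>n. mass_std_dev M \<mu> (real n) * ennreal (real n powr (p - 1))) \<longlonglongrightarrow> 0"
  proof (rule tendsto_sandwich[OF _ _ tendsto_const lim])
    show "\<forall>\<^sub>F n in sequentially. mass_std_dev M \<mu> (real n) * ennreal (real n powr (p - 1))
        \<le> ennreal (4 / \<kappa> * (b n * real n powr (p - 1)))"
      using ev
    proof eventually_elim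
      case (elim n)
      from bound[OF elim] have "mass_std_dev M \<mu> (real n) * ennreal (real n powr (p - 1)) =
        ennreal (s n * real n powr (p - 1))" by (simp add: ennreal_mult'')
      also have "\<dots> \<le> ennreal (4 / \<kappa> * b n * real n powr (p - 1))"
        using bound[OF elim] by (intro ennreal_leI mult_right_mono) auto
      finally show ?case by (simp add: mult.assoc)
    qed
  qed simp
  then show ?thesis by (rule lim_imp_Limsup[OF sequentially_bot])
qed

lemma infinite_cost_of_CLT:
  assumes p: "0 < p" "p < 1" and clt: "satisfies_CLT M \<mu>"
    and pos: "limsup (\<lambda>n. mass_std_dev M \<mu> (real n) * ennreal (real n powr (p - 1))) > 0"
  shows "transport_cost M \<theta> \<mu> p = \<infinity>"
proof -
  have "displacement_cost S p = \<infinity>"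
    if "invariant_transport_map M \<theta> S" "transports_lebesgue_to M S \<mu>" for S
    using limsup_std_dev_eq_0_of_finite_cost[OF that _ p clt] pos
    by (metis infinity_ennreal_def less_irrefl top.not_eq_extremum)
  then show ?thesis
    unfolding transport_cost_def displacement_cost_def by (auto intro!: INF_eqI)
qed

end

section \<open>Matching inside nested dyadic blocks\<close>

text \<open>Bookkeeping for one of the two measures to be matched, described by the amount \<open>e j a\<close> left over in
  the block \<open>[a, a+2^j)\<close> once level \<open>j\<close> is processed and the mass \<open>n a\<close> of \<open>[a, a+1)\<close>. The mass that is available in the block
  when level \<open>j\<close> begins is \<open>leftover_mass\<close>; after the first level it consists of the leftovers of the two
  halves. Its density \<open>leftover_density\<close> with respect to the original measure
  is reduced by the same factor throughout a block whenever that block is processed.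
  A block is named by its left end point \<open>a\<close>, which ranges over all reals.\<close>

primrec leftover_mass :: "(nat \<Rightarrow> real \<Rightarrow> real) \<Rightarrow> (real \<Rightarrow> real) \<Rightarrow> nat \<Rightarrow> real \<Rightarrow> real" where
  "leftover_mass e n 0 a = n a"
| "leftover_mass e n (Suc j) a = e j a + e j (a + 2 ^ j)"

primrec leftover_density :: "(nat \<Rightarrow> real \<Rightarrow> real) \<Rightarrow> (real \<Rightarrow> real) \<Rightarrow> nat \<Rightarrow> real \<Rightarrow> real \<Rightarrow> real" where
  "leftover_density e n 0 a x = 1"
| "leftover_density e n (Suc j) a x =
    (let c = (if x < a + 2 ^ j then a else a + 2 ^ j)
     in leftover_density e n j c x * (e j c / leftover_mass e n j c))"

definition block :: "nat \<Rightarrow> real \<Rightarrow> real \<Rightarrow> ennreal" where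
  "block j a x = indicator {a..<a + 2 ^ j} x"

text \<open>The average of \<open>leftover_density\<close> at \<open>x\<close> over all positions of the block containing \<open>x\<close>, which is the same
  as the average over the offset of the grid.\<close>

definition mean_leftover :: "(nat \<Rightarrow> real \<Rightarrow> real) \<Rightarrow> (real \<Rightarrow> real) \<Rightarrow> nat \<Rightarrow> real \<Rightarrow> ennreal" where
  "mean_leftover e n j x =
     ennreal (1 / 2 ^ j) * (\<integral>\<^sup>+a. block j a x * ennreal (leftover_density e n j a x) \<partial>lborel)"

lemma block_measurable [measurable (raw)]:
  assumes [measurable]: "f \<in> borel_measurable N" "g \<in> borel_measurable N"
  shows "(\<lambda>w. block j (f w) (g w)) \<in> borel_measurable N"
  unfolding block_def indicator_def atLeastLessThan_iff by measurable

text \<open>Here and below \<open>w\<close> carries the randomness, so that joint measurability in the realisation, the block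
  and the point is obtained.\<close>

lemma leftover_mass_measurable:
  assumes e: "\<And>j f. f \<in> borel_measurable N \<Longrightarrow> (\<lambda>w. e w j (f w)) \<in> borel_measurable N"
    and n: "\<And>f. f \<in> borel_measurable N \<Longrightarrow> (\<lambda>w. n w (f w)) \<in> borel_measurable N"
    and f: "f \<in> borel_measurable N"
  shows "(\<lambda>w. leftover_mass (e w) (n w) j (f w)) \<in> borel_measurable N"
  by (cases j) (auto intro!: borel_measurable_add e n f)

lemma leftover_density_measurable:
  assumes e: "\<And>j f. f \<in> borel_measurable N \<Longrightarrow> (\<lambda>w. e w j (f w)) \<in> borel_measurable N"
    and n: "\<And>f. f \<in> borel_measurable N \<Longrightarrow> (\<lambda>w. n w (f w)) \<in> borel_measurable N"
    and f: "f \<in> borel_measurable N" and g: "g \<in> borel_measurable N"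
  shows "(\<lambda>w. leftover_density (e w) (n w) j (f w) (g w)) \<in> borel_measurable N"
  using f
proof (induction j arbitrary: f)
  case (Suc j)
  note [measurable] = Suc.prems g
  have c: "(\<lambda>w. if g w < f w + 2 ^ j then f w else f w + 2 ^ j) \<in> borel_measurable N" by measurable
  note [measurable] = Suc.IH[OF c] e[OF c] leftover_mass_measurable[OF e n c]
  show ?case unfolding leftover_density.simps Let_def by measurable
qed simp

locale leftover =
  fixes \<nu> :: "real measure" and e :: "nat \<Rightarrow> real \<Rightarrow> real" and n :: "real \<Rightarrow> real"
  assumes sets_nu [measurable_cong, simp]: "sets \<nu> = sets borel"
    and nu_unit: "emeasure \<nu> {a..<a + 1} = ennreal (n a)"
    and e_nonneg: "0 \<le> e j a" and e_le: "e j a \<le> leftover_mass e n j a"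
    and e_measurable [measurable]: "e j \<in> borel_measurable borel"
    and n_measurable [measurable]: "n \<in> borel_measurable borel"
begin

abbreviation "m \<equiv> leftover_mass e n"
abbreviation "d \<equiv> leftover_density e n"

lemma leftover_mass_nonneg: "0 \<le> m j a"
  using e_nonneg e_le order_trans by blast

lemma leftover_density_measurable' [measurable (raw)]:
  assumes "f \<in> borel_measurable N" "g \<in> borel_measurable N"
  shows "(\<lambda>w. d j (f w) (g w)) \<in> borel_measurable N"
  by (rule leftover_density_measurable[where e="\<lambda>_. e" and n="\<lambda>_. n"])
    (auto intro: assms measurable_compose[OF _ e_measurable] measurable_compose[OF _ n_measurable])

lemma leftover_mass_measurable' [measurable (raw)]:
  assumes "f \<in> borel_measurable N"
  shows "(\<lambda>w. m j (f w)) \<in> borel_measurable N"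
  by (rule leftover_mass_measurable[where e="\<lambda>_. e" and n="\<lambda>_. n"])
    (auto intro: assms measurable_compose[OF _ e_measurable] measurable_compose[OF _ n_measurable])

lemma retained_fraction: "0 \<le> e j a / m j a" "e j a / m j a \<le> 1"
  using e_nonneg[of j a] e_le[of j a] by (auto simp: divide_le_eq_1)

lemma leftover_density_bounds: "0 \<le> d j a x \<and> d j a x \<le> 1"
proof (induction j arbitrary: a)
  case (Suc j)
  have "0 \<le> d j c x * (e j c / m j c) \<and> d j c x * (e j c / m j c) \<le> 1" for c
    using Suc[of c] retained_fraction[of j c] by (metis mult_le_one mult_nonneg_nonneg)
  then show ?case by (simp only: leftover_density.simps Let_def)
qed simp

lemma leftover_density_eq_0: "m (Suc j) a = 0 \<Longrightarrow> d (Suc j) a x = 0"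
  using e_nonneg[of j a] e_nonneg[of j "a + 2 ^ j"] by (auto simp: Let_def add_nonneg_eq_0_iff)

lemma leftover_density_Suc:
  "block (Suc j) a x * ennreal (d (Suc j) a x) =
    block j a x * ennreal (d j a x * (e j a / m j a)) +
    block j (a + 2 ^ j) x * ennreal (d j (a + 2 ^ j) x * (e j (a + 2 ^ j) / m j (a + 2 ^ j)))"
proof -
  have "(0::real) < 2 ^ j" by simp
  then show ?thesis unfolding block_def by (auto simp: Let_def split: split_indicator)
qed

text \<open>By induction: processing a block scales its available mass \<open>m j c\<close> down to \<open>e j c\<close>, and the two halves
  of a block add up.\<close>

lemma nn_integral_leftover_density: "(\<integral>\<^sup>+x. block j a x * ennreal (d j a x) \<partial>\<nu>) = ennreal (m j a)"
proof (induction j arbitrary: a)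
  case 0
  show ?case by (simp add: block_def nu_unit)
next
  case (Suc j)
  have *: "(\<integral>\<^sup>+x. block j c x * ennreal (d j c x * (e j c / m j c)) \<partial>\<nu>) = ennreal (e j c)" for c
  proof -
    have "(\<integral>\<^sup>+x. block j c x * ennreal (d j c x * (e j c / m j c)) \<partial>\<nu>) =
        (\<integral>\<^sup>+x. (block j c x * ennreal (d j c x)) * ennreal (e j c / m j c) \<partial>\<nu>)"
      using leftover_density_bounds retained_fraction by (simp add: ennreal_mult mult.assoc del: times_divide_eq_right)
    also have "\<dots> = ennreal (m j c) * ennreal (e j c / m j c)"
      by (subst nn_integral_multc) (simp_all add: Suc.IH)
    also have "\<dots> = ennreal (e j c)"
      using e_nonneg[of j c] e_le[of j c] leftover_mass_nonneg[of j c]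
      by (cases "m j c = 0") (auto simp: ennreal_mult[symmetric])
    finally show ?thesis .
  qed
  show ?case
    unfolding leftover_density_Suc
    by (subst nn_integral_add) (simp_all add: * e_nonneg del: times_divide_eq_right)
qed

lemma mean_leftover_0: "mean_leftover e n 0 x = 1"
proof -
  have "mean_leftover e n 0 x = (\<integral>\<^sup>+a. indicator {x - 1<..x} a \<partial>lborel)"
    by (auto simp: mean_leftover_def block_def intro!: nn_integral_cong split: split_indicator
      simp del: nn_integral_indicator)
  then show ?thesis by simp
qed

text \<open>The point \<open>x\<close> lies in the left or in the right half of its block of level \<open>j+1\<close>. Both
  contributions to the average over the block position are equal after a translation, which compensates the halved
  normalisation.\<close>

lemma mean_leftover_Suc:
  "mean_leftover e n (Suc j) x =
    ennreal (1 / 2 ^ j) * (\<integral>\<^sup>+a. block j a x * ennreal (d j a x * (e j a / m j a)) \<partial>lborel)"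
proof -
  let ?g = "\<lambda>a. block j a x * ennreal (d j a x * (e j a / m j a))"
  have "(\<integral>\<^sup>+a. ?g (a + 2 ^ j) \<partial>lborel) = (\<integral>\<^sup>+a. ?g a \<partial>lborel)"
    using nn_integral_real_affine[of ?g 1 "2 ^ j"] by (simp add: add.commute)
  moreover have "(\<integral>\<^sup>+a. block (Suc j) a x * ennreal (d (Suc j) a x) \<partial>lborel) =
      (\<integral>\<^sup>+a. ?g a \<partial>lborel) + (\<integral>\<^sup>+a. ?g (a + 2 ^ j) \<partial>lborel)"
    unfolding leftover_density_Suc by (rule nn_integral_add) measurable
  ultimately have "mean_leftover e n (Suc j) x = ennreal (1 / 2 ^ Suc j) * (2 * (\<integral>\<^sup>+a. ?g a \<partial>lborel))"
    unfolding mean_leftover_def mult_2 by (simp only:)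
  also have "\<dots> = ennreal (1 / 2 ^ Suc j * 2) * (\<integral>\<^sup>+a. ?g a \<partial>lborel)"
    by (subst ennreal_mult) (simp_all only: mult.assoc ennreal_numeral, simp_all)
  finally show ?thesis by simp
qed

text \<open>What is matched at level \<open>j\<close> plus what remains for level \<open>j+1\<close> is what was available: averaging over
  the grid preserves the telescoping sum.\<close>

lemma mean_leftover_decomp:
  assumes w: "\<And>a. r a = d j a x - d j a x * (e j a / m j a)"
  shows "ennreal (1 / 2 ^ j) * (\<integral>\<^sup>+a. block j a x * ennreal (r a) \<partial>lborel) + mean_leftover e n (Suc j) x
    = mean_leftover e n j x"
proof -
  have [measurable]: "r \<in> borel_measurable borel"
    unfolding w[abs_def] by measurable
  have nn: "0 \<le> r a" for a
    using leftover_density_bounds[of j a x] retained_fraction[of j a] unfolding w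
    by (simp add: mult_left_le del: times_divide_eq_right)
  have "(\<integral>\<^sup>+a. block j a x * ennreal (r a) \<partial>lborel) + (\<integral>\<^sup>+a. block j a x * ennreal (d j a x * (e j a / m j a)) \<partial>lborel)
    = (\<integral>\<^sup>+a. block j a x * ennreal (d j a x) \<partial>lborel)"
    using nn leftover_density_bounds retained_fraction
    by (subst nn_integral_add[symmetric])
      (auto simp: distrib_left[symmetric] ennreal_plus[symmetric] w simp del: ennreal_plus times_divide_eq_right intro!: nn_integral_cong)
  then show ?thesis
    unfolding mean_leftover_Suc unfolding mean_leftover_def by (simp add: distrib_left[symmetric])
qed

end

lemma suminf_telescope_ennreal:
  fixes P R :: "nat \<Rightarrow> ennreal"
  assumes step: "\<And>j. R j + P (Suc j) = P j" and P0: "P 0 = 1"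
  shows "(\<Sum>j. R j) \<le> 1" and "P \<longlonglongrightarrow> 0 \<Longrightarrow> (\<Sum>j. R j) = 1"
proof -
  have part: "(\<Sum>j<J. R j) + P J = 1" for J
    by (induction J) (auto simp: P0 add.assoc step)
  then have "(\<Sum>j<J. R j) \<le> 1" for J by (metis le_iff_add)
  then show "(\<Sum>j. R j) \<le> 1" by (intro suminf_le_const) auto
  assume "P \<longlonglongrightarrow> 0"
  moreover have "(\<lambda>J. \<Sum>j<J. R j) \<longlonglongrightarrow> (\<Sum>j. R j)" by (intro summable_LIMSEQ) auto
  ultimately have "(\<lambda>J. (\<Sum>j<J. R j) + P J) \<longlonglongrightarrow> (\<Sum>j. R j) + 0" by (intro tendsto_add)
  then show "(\<Sum>j. R j) = 1" unfolding part by (simp add: LIMSEQ_const_iff)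
qed

text \<open>With masses \<open>m\<close> and \<open>m'\<close> available on the two sides, the product coupling of intensity
  \<open>1 / max m m'\<close> uses up the smaller side and leaves \<open>max 0 (m - m')\<close> of the first. The convention
  \<open>x / 0 = 0\<close> is harmless exactly if the density \<open>r\<close> vanishes when both sides are empty.\<close>

lemma matched_fraction:
  fixes m m' r :: real
  assumes "0 \<le> m" "0 \<le> m'" "max m m' = 0 \<Longrightarrow> r = 0"
  shows "r * (m' / max m m') = r - r * (max 0 (m - m') / m)"
proof (cases "m = 0")
  case True
  then show ?thesis using assms by (cases "m' = 0") auto
next
  case False
  then show ?thesis using assms by (auto simp: max_def field_simps)
qed

text \<open>The matching depends on the measure only through the excesses \<open>D j a\<close> of the blocks \<open>[a, a+2^j)\<close>. Lebesgue
  mass provides the sources, the given measure the sinks; \<open>1 - D 0 a\<close> is its mass on a unit block.\<close>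

definition sources :: "(nat \<Rightarrow> real \<Rightarrow> real) \<Rightarrow> nat \<Rightarrow> real \<Rightarrow> real" where
  "sources D j a = max 0 (D j a)"
definition sinks :: "(nat \<Rightarrow> real \<Rightarrow> real) \<Rightarrow> nat \<Rightarrow> real \<Rightarrow> real" where
  "sinks D j a = max 0 (- D j a)"

abbreviation "src_mass D \<equiv> leftover_mass (sources D) (\<lambda>_. 1)"
abbreviation "src_dens D \<equiv> leftover_density (sources D) (\<lambda>_. 1)"
abbreviation "snk_mass D \<equiv> leftover_mass (sinks D) (\<lambda>a. 1 - D 0 a)"
abbreviation "snk_dens D \<equiv> leftover_density (sinks D) (\<lambda>a. 1 - D 0 a)"
abbreviation "src_mean D \<equiv> mean_leftover (sources D) (\<lambda>_. 1)"
abbreviation "snk_mean D \<equiv> mean_leftover (sinks D) (\<lambda>a. 1 - D 0 a)"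

text \<open>The density of the pairs matched at level \<open>j\<close>, averaged over the position of the block.\<close>

definition level_kernel :: "(nat \<Rightarrow> real \<Rightarrow> real) \<Rightarrow> nat \<Rightarrow> real \<Rightarrow> real \<Rightarrow> ennreal" where
  "level_kernel D j x y = ennreal (1 / 2 ^ j) *
     (\<integral>\<^sup>+a. block j a x * block j a y *
       ennreal (src_dens D j a x * snk_dens D j a y / max (src_mass D j a) (snk_mass D j a)) \<partial>lborel)"

definition match_kernel :: "(nat \<Rightarrow> real \<Rightarrow> real) \<Rightarrow> real \<Rightarrow> real \<Rightarrow> ennreal" where
  "match_kernel D x y = (\<Sum>j. level_kernel D j x y)"

text \<open>The assumption quantifies over \<open>h\<close> so that it can be used on the product with the line, over which the
  block position is integrated.\<close>

lemma level_kernel_measurable: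
  fixes N :: "'b measure"
  assumes D: "\<And>j f. \<And>N'::('b \<times> real) measure. \<And>h. f \<in> borel_measurable N' \<Longrightarrow> h \<in> N' \<rightarrow>\<^sub>M N \<Longrightarrow> (\<lambda>w. D (h w) j (f w)) \<in> borel_measurable N'"
    and f: "f \<in> borel_measurable N" and g: "g \<in> borel_measurable N"
  shows "(\<lambda>w. level_kernel (D w) j (f w) (g w)) \<in> borel_measurable N"
proof -
  let ?N = "N \<Otimes>\<^sub>M lborel"
  note [measurable] = f g
  have [measurable]: "(\<lambda>w. src_dens (D (fst w)) j (snd w) (f (fst w))) \<in> borel_measurable ?N"
    "(\<lambda>w. snk_dens (D (fst w)) j (snd w) (g (fst w))) \<in> borel_measurable ?N"
    "(\<lambda>w. src_mass (D (fst w)) j (snd w)) \<in> borel_measurable ?N"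
    "(\<lambda>w. snk_mass (D (fst w)) j (snd w)) \<in> borel_measurable ?N"
    by (auto intro!: leftover_density_measurable[where N="?N" and e="\<lambda>w. sources (D (fst w))"]
      leftover_density_measurable[where N="?N" and e="\<lambda>w. sinks (D (fst w))" and n="\<lambda>w a. 1 - D (fst w) 0 a"]
      leftover_mass_measurable[where N="?N" and e="\<lambda>w. sources (D (fst w))"]
      leftover_mass_measurable[where N="?N" and e="\<lambda>w. sinks (D (fst w))" and n="\<lambda>w a. 1 - D (fst w) 0 a"]
      borel_measurable_max borel_measurable_uminus borel_measurable_diff D simp: sources_def sinks_def)
  show ?thesis unfolding level_kernel_def by measurable
qed

text \<open>Both marginals of the matching in a block are product couplings integrated over one factor, which replaces
  the density \<open>t\<close> of that factor by its total mass \<open>m\<close>.\<close>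

lemma nn_integral_block_product:
  assumes \<nu>: "sigma_finite_measure \<nu>" and [measurable_cong]: "sets \<nu> = sets borel"
    and [measurable]: "s \<in> borel_measurable borel" "M \<in> borel_measurable borel"
      "(\<lambda>(a, y). t a y) \<in> borel_measurable (borel \<Otimes>\<^sub>M borel)"
    and nn: "\<And>a. 0 \<le> s a" "\<And>a y. 0 \<le> t a y" "\<And>a. 0 \<le> M a"
    and t: "\<And>a. (\<integral>\<^sup>+y. block j a y * ennreal (t a y) \<partial>\<nu>) = ennreal (m a)"
  shows "(\<integral>\<^sup>+y. c * (\<integral>\<^sup>+a. block j a x * block j a y * ennreal (s a * t a y / M a) \<partial>lborel) \<partial>\<nu>) =
    c * (\<integral>\<^sup>+a. block j a x * ennreal (s a * (m a / M a)) \<partial>lborel)"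
proof -
  interpret \<nu>: sigma_finite_measure \<nu> by (rule \<nu>)
  interpret pair_sigma_finite lborel \<nu> ..
  let ?f = "\<lambda>a y. block j a x * block j a y * ennreal (s a * t a y / M a)"
  note [measurable (raw)] = measurable_uncurried[OF assms(5)]
  have "(\<integral>\<^sup>+y. c * (\<integral>\<^sup>+a. ?f a y \<partial>lborel) \<partial>\<nu>) = c * (\<integral>\<^sup>+y. \<integral>\<^sup>+a. ?f a y \<partial>lborel \<partial>\<nu>)"
    by (rule nn_integral_cmult) measurable
  also have "(\<integral>\<^sup>+y. \<integral>\<^sup>+a. ?f a y \<partial>lborel \<partial>\<nu>) = (\<integral>\<^sup>+a. \<integral>\<^sup>+y. ?f a y \<partial>\<nu> \<partial>lborel)"
    by (rule Fubini') measurable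
  also have "\<dots> = (\<integral>\<^sup>+a. block j a x * ennreal (s a * (m a / M a)) \<partial>lborel)"
  proof (rule nn_integral_cong)
    fix a
    have nn': "0 \<le> s a / M a" using nn by simp
    have "(\<integral>\<^sup>+y. ?f a y \<partial>\<nu>) = (\<integral>\<^sup>+y. (block j a x * ennreal (s a / M a)) * (block j a y * ennreal (t a y)) \<partial>\<nu>)"
    proof (rule nn_integral_cong)
      fix y
      have "ennreal (s a * t a y / M a) = ennreal (s a / M a) * ennreal (t a y)"
        using nn' nn(2)[of a y] by (simp add: ennreal_mult[symmetric])
      then show "?f a y = (block j a x * ennreal (s a / M a)) * (block j a y * ennreal (t a y))"
        by (simp only: ac_simps)
    qed
    also have "\<dots> = (block j a x * ennreal (s a / M a)) * ennreal (m a)"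
      by (subst nn_integral_cmult) (simp_all add: t)
    also have "\<dots> = block j a x * ennreal (s a * (m a / M a))"
      using nn' by (simp add: mult.assoc ennreal_mult'[symmetric])
    finally show "(\<integral>\<^sup>+y. ?f a y \<partial>\<nu>) = block j a x * ennreal (s a * (m a / M a))" .
  qed
  finally show ?thesis .
qed

locale excess =
  fixes N :: "real measure" and D :: "nat \<Rightarrow> real \<Rightarrow> real"
  assumes sets_N [measurable_cong, simp]: "sets N = sets borel"
    and finite_N: "emeasure N {a..<a + 1} < \<infinity>"
    and D_0: "D 0 a = 1 - measure N {a..<a + 1}"
    and D_Suc: "D (Suc j) a = D j a + D j (a + 2 ^ j)"
    and D_measurable [measurable]: "D j \<in> borel_measurable borel"
begin

text \<open>Matching removes equal amounts from both sides, so the difference of the available masses stays equal to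
  the excess. This is what makes the leftovers computable without following the recursion.\<close>

lemma mass_balance: "src_mass D j a - snk_mass D j a = D j a"
  by (cases j) (auto simp: sources_def sinks_def D_0 D_Suc)

lemma src_mass_nonneg: "0 \<le> src_mass D j a"
  by (cases j) (auto simp: sources_def)

lemma snk_mass_nonneg: "0 \<le> snk_mass D j a"
  by (cases j) (auto simp: sinks_def D_0)

sublocale src: leftover lborel "sources D" "\<lambda>_. 1"
proof
  show "sources D j a \<le> src_mass D j a" for j a
    using mass_balance[of j a] snk_mass_nonneg[of j a] src_mass_nonneg[of j a]
    by (auto simp: sources_def)
qed (auto simp: sources_def[abs_def])

sublocale snk: leftover N "sinks D" "\<lambda>a. 1 - D 0 a"
proof
  show "sinks D j a \<le> snk_mass D j a" for j a
    using mass_balance[of j a] snk_mass_nonneg[of j a] src_mass_nonneg[of j a]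
    by (auto simp: sinks_def)
  show "emeasure N {a..<a + 1} = ennreal (1 - D 0 a)" for a
    using finite_N[of a] by (simp add: D_0 emeasure_eq_ennreal_measure)
qed (auto simp: sinks_def[abs_def])

sublocale N: sigma_finite_measure N
proof
  let ?A = "range (\<lambda>n::int. {real_of_int n..<of_int n + 1})"
  have "x \<in> \<Union>?A" for x :: real
    by (rule UnionI[OF rangeI[of _ "\<lfloor>x\<rfloor>"]]) (simp add: real_of_int_floor_add_one_gt)
  moreover have "space N = UNIV" using sets_eq_imp_space_eq[OF sets_N] by simp
  ultimately have "\<Union>?A = space N" by blast
  moreover have "\<forall>a\<in>?A. emeasure N a \<noteq> \<infinity>" using finite_N by (simp add: less_top)
  moreover have "countable ?A" "?A \<subseteq> sets N" by auto
  ultimately show "\<exists>A. countable A \<and> A \<subseteq> sets N \<and> \<Union>A = space N \<and> (\<forall>a\<in>A. emeasure N a \<noteq> \<infinity>)"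
    by meson
qed

lemma src_dens_eq_0: "max (src_mass D j a) (snk_mass D j a) = 0 \<Longrightarrow> src_dens D j a x = 0"
proof (cases j)
  case (Suc i)
  assume "max (src_mass D j a) (snk_mass D j a) = 0"
  then have "src_mass D j a = 0"
    using src_mass_nonneg[of j a] snk_mass_nonneg[of j a]
      max.cobounded1[of "src_mass D j a" "snk_mass D j a"] max.cobounded2[of "snk_mass D j a" "src_mass D j a"]
    by linarith
  then show "src_dens D j a x = 0" unfolding Suc by (rule src.leftover_density_eq_0)
qed (auto simp: max_def split: if_splits)

lemma snk_dens_eq_0: "max (src_mass D j a) (snk_mass D j a) = 0 \<Longrightarrow> snk_dens D j a x = 0"
proof (cases j)
  case (Suc i)
  assume "max (src_mass D j a) (snk_mass D j a) = 0"
  then have "snk_mass D j a = 0"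
    using src_mass_nonneg[of j a] snk_mass_nonneg[of j a]
      max.cobounded1[of "src_mass D j a" "snk_mass D j a"] max.cobounded2[of "snk_mass D j a" "src_mass D j a"]
    by linarith
  then show "snk_dens D j a x = 0" unfolding Suc by (rule snk.leftover_density_eq_0)
qed (auto simp: max_def split: if_splits)

lemma row_fraction:
  "src_dens D j a x * (snk_mass D j a / max (src_mass D j a) (snk_mass D j a))
    = src_dens D j a x - src_dens D j a x * (sources D j a / src_mass D j a)"
  using matched_fraction[OF src_mass_nonneg[of j a] snk_mass_nonneg[of j a] src_dens_eq_0[of j a x]]
  by (simp add: mass_balance sources_def)

lemma column_fraction:
  "snk_dens D j a y * (src_mass D j a / max (src_mass D j a) (snk_mass D j a))
    = snk_dens D j a y - snk_dens D j a y * (sinks D j a / snk_mass D j a)"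
proof -
  have "snk_mass D j a - src_mass D j a = - D j a" using mass_balance[of j a] by simp
  then show ?thesis
  using matched_fraction[OF snk_mass_nonneg[of j a] src_mass_nonneg[of j a] snk_dens_eq_0[of j a y, unfolded max.commute[of "src_mass D j a"]]]
  by (simp add: sinks_def max.commute)
qed

lemma level_kernel_measurable' [measurable (raw)]:
  assumes "f \<in> borel_measurable K" "g \<in> borel_measurable K"
  shows "(\<lambda>w. level_kernel D j (f w) (g w)) \<in> borel_measurable K"
  by (rule level_kernel_measurable[where D="\<lambda>_. D"])
    (auto intro: assms measurable_compose[OF _ D_measurable])

lemma match_kernel_measurable' [measurable (raw)]:
  assumes [measurable]: "f \<in> borel_measurable K" "g \<in> borel_measurable K"
  shows "(\<lambda>w. match_kernel D (f w) (g w)) \<in> borel_measurable K"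
  unfolding match_kernel_def by measurable

lemma level_kernel_row:
  "(\<integral>\<^sup>+y. level_kernel D j x y \<partial>N) + src_mean D (Suc j) x = src_mean D j x"
  unfolding level_kernel_def
  by (subst nn_integral_block_product[where m="snk_mass D j"])
    (auto simp: snk.nn_integral_leftover_density src.leftover_density_bounds snk.leftover_density_bounds
      le_max_iff_disj src_mass_nonneg N.sigma_finite_measure_axioms
      intro!: src.mean_leftover_decomp row_fraction simp del: times_divide_eq_right)

lemma level_kernel_column:
  "(\<integral>\<^sup>+x. level_kernel D j x y \<partial>lborel) + snk_mean D (Suc j) y = snk_mean D j y"
  unfolding level_kernel_def mult.commute[of "block _ _ _" "block _ _ y"] mult.commute[of "src_dens _ _ _ _"]
  by (subst nn_integral_block_product[where m="src_mass D j"])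
    (auto simp: src.nn_integral_leftover_density src.leftover_density_bounds snk.leftover_density_bounds
      le_max_iff_disj src_mass_nonneg lborel.sigma_finite_measure_axioms
      intro!: snk.mean_leftover_decomp column_fraction simp del: times_divide_eq_right)

lemma match_kernel_column_le: "(\<integral>\<^sup>+x. match_kernel D x y \<partial>lborel) \<le> 1"
proof -
  have "(\<integral>\<^sup>+x. match_kernel D x y \<partial>lborel) = (\<Sum>j. \<integral>\<^sup>+x. level_kernel D j x y \<partial>lborel)"
    unfolding match_kernel_def by (rule nn_integral_suminf) measurable
  also have "\<dots> \<le> 1"
    by (rule suminf_telescope_ennreal(1)[OF level_kernel_column snk.mean_leftover_0])
  finally show ?thesis .
qed

lemma match_kernel_row_eq_1:
  assumes "(\<lambda>j. src_mean D j x) \<longlonglongrightarrow> 0"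
  shows "(\<integral>\<^sup>+y. match_kernel D x y \<partial>N) = 1"
proof -
  have "(\<integral>\<^sup>+y. match_kernel D x y \<partial>N) = (\<Sum>j. \<integral>\<^sup>+y. level_kernel D j x y \<partial>N)"
    unfolding match_kernel_def by (rule nn_integral_suminf) measurable
  also have "\<dots> = 1"
    by (rule suminf_telescope_ennreal(2)[OF level_kernel_row src.mean_leftover_0 assms])
  finally show ?thesis .
qed

lemma level_kernel_eq_0: "2 ^ j \<le> \<bar>y - x\<bar> \<Longrightarrow> level_kernel D j x y = 0"
proof -
  assume "2 ^ j \<le> \<bar>y - x\<bar>"
  then have "block j a x * block j a y = 0" for a by (auto simp: block_def split: split_indicator)
  then show ?thesis by (simp only: level_kernel_def mult_zero_left nn_integral_0_iff_AE nn_integral_const mult_zero_right)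
qed

text \<open>Points matched at level \<open>j\<close> share a block, hence are at distance less than \<open>2^j\<close>.\<close>

lemma match_kernel_cost:
  assumes "0 \<le> q"
  shows "(\<integral>\<^sup>+y. ennreal (\<bar>y - x\<bar> powr q) * match_kernel D x y \<partial>N)
    \<le> (\<Sum>j. ennreal ((2 ^ j) powr q) * src_mean D j x)"
proof -
  have "(\<integral>\<^sup>+y. ennreal (\<bar>y - x\<bar> powr q) * match_kernel D x y \<partial>N)
    = (\<integral>\<^sup>+y. (\<Sum>j. ennreal (\<bar>y - x\<bar> powr q) * level_kernel D j x y) \<partial>N)"
    unfolding match_kernel_def by simp
  also have "\<dots> = (\<Sum>j. \<integral>\<^sup>+y. ennreal (\<bar>y - x\<bar> powr q) * level_kernel D j x y \<partial>N)"
    by (rule nn_integral_suminf) measurable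
  also have "\<dots> \<le> (\<Sum>j. ennreal ((2 ^ j) powr q) * src_mean D j x)"
  proof (rule suminf_le)
    fix j
    have "(\<integral>\<^sup>+y. ennreal (\<bar>y - x\<bar> powr q) * level_kernel D j x y \<partial>N)
      \<le> (\<integral>\<^sup>+y. ennreal ((2 ^ j) powr q) * level_kernel D j x y \<partial>N)"
    proof (rule nn_integral_mono)
      fix y
      show "ennreal (\<bar>y - x\<bar> powr q) * level_kernel D j x y \<le> ennreal ((2 ^ j) powr q) * level_kernel D j x y"
        using assms by (cases "2 ^ j \<le> \<bar>y - x\<bar>")
          (auto simp: level_kernel_eq_0 intro!: mult_right_mono ennreal_leI powr_mono2)
    qed
    also have "\<dots> = ennreal ((2 ^ j) powr q) * (\<integral>\<^sup>+y. level_kernel D j x y \<partial>N)"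
      by (rule nn_integral_cmult) measurable
    also have "\<dots> \<le> ennreal ((2 ^ j) powr q) * src_mean D j x"
      using level_kernel_row[of j x] by (intro mult_left_mono) (metis le_iff_add, simp)
    finally show "(\<integral>\<^sup>+y. ennreal (\<bar>y - x\<bar> powr q) * level_kernel D j x y \<partial>N)
      \<le> ennreal ((2 ^ j) powr q) * src_mean D j x" .
  qed auto
  finally show ?thesis .
qed

end

text \<open>A translation merely renames the blocks. Once their positions are averaged out, the matching
  therefore commutes with translations.\<close>

lemma leftover_mass_shift:
  assumes "\<And>j a. e' j a = e j (a + t)" "\<And>a. n' a = n (a + t)"
  shows "leftover_mass e' n' j a = leftover_mass e n j (a + t)"
  by (cases j) (simp_all add: assms algebra_simps)

lemma leftover_density_shift:
  assumes "\<And>j a. e' j a = e j (a + t)" "\<And>a. n' a = n (a + t)"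
  shows "leftover_density e' n' j a x = leftover_density e n j (a + t) (x + t)"
proof (induction j arbitrary: a)
  case (Suc j)
  have "(if x + t < a + t + 2 ^ j then a + t else a + t + 2 ^ j) = (if x < a + 2 ^ j then a else a + 2 ^ j) + t"
    by auto
  then show ?case
    by (simp only: leftover_density.simps Let_def Suc.IH leftover_mass_shift[where e'=e' and n'=n', OF assms])
      (simp only: assms(1))
qed simp

lemma block_shift: "block j (a + t) (x + t) = block j a x"
  by (auto simp: block_def split: split_indicator)

lemma nn_integral_lborel_shift:
  fixes f :: "real \<Rightarrow> ennreal"
  assumes "f \<in> borel_measurable borel"
  shows "(\<integral>\<^sup>+x. f (x + t) \<partial>lborel) = (\<integral>\<^sup>+x. f x \<partial>lborel)"
  using nn_integral_real_affine[of f 1 t] assms by (simp add: add.commute)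

lemma sources_shift: "(\<And>j a. D' j a = D j (a + t)) \<Longrightarrow> sources D' j a = sources D j (a + t)"
  and sinks_shift: "(\<And>j a. D' j a = D j (a + t)) \<Longrightarrow> sinks D' j a = sinks D j (a + t)"
  by (simp_all add: sources_def sinks_def)

lemma src_mean_shift:
  assumes D': "\<And>j a. D' j a = D j (a + t)" and [measurable]: "\<And>j. D j \<in> borel_measurable borel"
  shows "src_mean D' j x = src_mean D j (x + t)"
proof -
  have [measurable]: "(\<lambda>a. src_dens D j a (x + t)) \<in> borel_measurable borel"
    by (intro leftover_density_measurable[where e="\<lambda>_. sources D" and n="\<lambda>_ _. 1"])
      (auto simp: sources_def)
  have "src_dens D' j a x = src_dens D j (a + t) (x + t)" for a
    by (rule leftover_density_shift) (auto simp: sources_shift[where D'=D', OF D'])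
  then show ?thesis
    unfolding mean_leftover_def
    using nn_integral_lborel_shift[of "\<lambda>a. block j a (x + t) * ennreal (src_dens D j a (x + t))" t]
    by (simp add: block_shift)
qed

lemma match_kernel_shift:
  assumes D': "\<And>j a. D' j a = D j (a + t)" and [measurable]: "\<And>j. D j \<in> borel_measurable borel"
  shows "match_kernel D' x y = match_kernel D (x + t) (y + t)"
proof -
  have [measurable]: "(\<lambda>a. src_dens D j a (x + t)) \<in> borel_measurable borel"
      "(\<lambda>a. src_mass D j a) \<in> borel_measurable borel" for j
    by (intro leftover_density_measurable[where e="\<lambda>_. sources D" and n="\<lambda>_ _. 1"]
      leftover_mass_measurable[where e="\<lambda>_. sources D" and n="\<lambda>_ _. 1"]; simp add: sources_def)+
  have [measurable]: "(\<lambda>a. snk_dens D j a (y + t)) \<in> borel_measurable borel"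
      "(\<lambda>a. snk_mass D j a) \<in> borel_measurable borel" for j
    by (intro leftover_density_measurable[where e="\<lambda>_. sinks D" and n="\<lambda>_ a. 1 - D 0 a"]
      leftover_mass_measurable[where e="\<lambda>_. sinks D" and n="\<lambda>_ a. 1 - D 0 a"]; simp add: sinks_def)+
  have *: "src_dens D' j a x = src_dens D j (a + t) (x + t)"
    "snk_dens D' j a y = snk_dens D j (a + t) (y + t)"
    "src_mass D' j a = src_mass D j (a + t)" "snk_mass D' j a = snk_mass D j (a + t)" for j a
    by (intro leftover_density_shift leftover_mass_shift
      sources_shift[where D'=D', OF D'] sinks_shift[where D'=D', OF D']; simp add: D')+
  have "level_kernel D' j x y = level_kernel D j (x + t) (y + t)" for j
    unfolding level_kernel_def *
    using nn_integral_lborel_shift[of "\<lambda>a. block j a (x + t) * block j a (y + t) *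
       ennreal (src_dens D j a (x + t) * snk_dens D j a (y + t) / max (src_mass D j a) (snk_mass D j a))" t]
    by (simp add: block_shift)
  then show ?thesis by (simp add: match_kernel_def)
qed

lemma src_mean_measurable:
  fixes N :: "'b measure"
  assumes D: "\<And>j f. \<And>N'::('b \<times> real) measure. \<And>h. f \<in> borel_measurable N' \<Longrightarrow> h \<in> N' \<rightarrow>\<^sub>M N \<Longrightarrow> (\<lambda>w. D (h w) j (f w)) \<in> borel_measurable N'"
    and [measurable]: "f \<in> borel_measurable N"
  shows "(\<lambda>w. src_mean (D w) j (f w)) \<in> borel_measurable N"
proof -
  let ?N = "N \<Otimes>\<^sub>M lborel"
  have [measurable]: "(\<lambda>w. src_dens (D (fst w)) j (snd w) (f (fst w))) \<in> borel_measurable ?N"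
    by (auto intro!: leftover_density_measurable[where N="?N" and e="\<lambda>w. sources (D (fst w))"]
      borel_measurable_max D simp: sources_def)
  show ?thesis unfolding mean_leftover_def by measurable
qed

section \<open>Integrals against the random measure\<close>

locale locally_finite_invariant_measure = unit_invariant_measure +
  assumes sets_mu' [measurable_cong, simp]: "sets (\<mu> \<omega>) = sets borel"
    and locally_finite: "emeasure (\<mu> \<omega>) {a..<b} < \<infinity>"
begin

lemma space_mu [simp]: "space (\<mu> \<omega>) = UNIV"
  using sets_eq_imp_space_eq[OF sets_mu'] by simp

text \<open>The restriction of \<open>\<mu>\<close> to \<open>[-n, n)\<close>, divided by one plus its mass, is a subprobability kernel. Integrals
  against it are measurable, and the one against \<open>\<mu>\<close> is a supremum over \<open>n\<close>.\<close>

lemma nn_integral_mu_measurable [measurable (raw)]: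
  assumes f [measurable]: "(\<lambda>(w, y). f w y) \<in> borel_measurable (N \<Otimes>\<^sub>M borel)" and h [measurable]: "h \<in> N \<rightarrow>\<^sub>M M"
  shows "(\<lambda>w. \<integral>\<^sup>+y. f w y \<partial>\<mu> (h w)) \<in> borel_measurable N"
proof -
  let ?I = "\<lambda>n::nat. {- real n..<real n}"
  define c where "c n \<omega> = 1 + emeasure (\<mu> \<omega>) (?I n)" for n \<omega>
  define L where "L n \<omega> = density (\<mu> \<omega>) (\<lambda>y. inverse (c n \<omega>) * indicator (?I n) y)" for n \<omega>
  have c: "c n \<omega> \<noteq> \<infinity>" "c n \<omega> \<noteq> 0" for n \<omega>
    using locally_finite[of \<omega> "- real n" "real n"] by (auto simp: c_def add_eq_0_iff_both_eq_0)
  have [measurable]: "c n \<in> borel_measurable M" for n unfolding c_def by measurable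
  have L_int: "(\<integral>\<^sup>+y. g y \<partial>L n \<omega>) = inverse (c n \<omega>) * (\<integral>\<^sup>+y. g y * indicator (?I n) y \<partial>\<mu> \<omega>)"
    if [measurable]: "g \<in> borel_measurable borel" for g n \<omega>
    unfolding L_def by (subst nn_integral_density) (auto simp: nn_integral_cmult[symmetric] ac_simps)
  have L: "L n \<in> M \<rightarrow>\<^sub>M subprob_algebra borel" for n
  proof (rule measurable_subprob_algebra)
    fix \<omega> assume \<omega>: "\<omega> \<in> space M"
    show "sets (L n \<omega>) = sets borel" by (simp add: L_def)
    show "subprob_space (L n \<omega>)"
    proof
      have "emeasure (L n \<omega>) (space (L n \<omega>)) = inverse (c n \<omega>) * emeasure (\<mu> \<omega>) (?I n)"
        by (simp add: L_def emeasure_density nn_integral_cmult_indicator)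
      also have "\<dots> \<le> inverse (c n \<omega>) * c n \<omega>" by (intro mult_left_mono) (auto simp: c_def)
      also have "\<dots> = 1" using c by (simp add: ennreal_inverse_mult less_top[symmetric] mult.commute ennreal_divide_self flip: divide_ennreal_def)
      finally show "emeasure (L n \<omega>) (space (L n \<omega>)) \<le> 1" .
      show "space (L n \<omega>) \<noteq> {}" by (simp add: L_def)
    qed
  next
    fix A :: "real set" assume [measurable]: "A \<in> sets borel"
    have "emeasure (L n \<omega>) A = inverse (c n \<omega>) * emeasure (\<mu> \<omega>) (A \<inter> ?I n)" for \<omega>
    proof -
      have "emeasure (L n \<omega>) A = (\<integral>\<^sup>+y. inverse (c n \<omega>) * indicator (A \<inter> ?I n) y \<partial>\<mu> \<omega>)"
        unfolding L_def
        by (subst emeasure_density) (auto intro!: nn_integral_cong split: split_indicator)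
      then show ?thesis by (simp add: nn_integral_cmult_indicator)
    qed
    then show "(\<lambda>\<omega>. emeasure (L n \<omega>) A) \<in> borel_measurable M" by simp
  qed
  have "(\<integral>\<^sup>+y. f w y \<partial>\<mu> (h w)) = (SUP n. c n (h w) * (\<integral>\<^sup>+y. f w y \<partial>L n (h w)))"
    if w: "w \<in> space N" for w
  proof -
    have fw [measurable]: "f w \<in> borel_measurable borel"
      using measurable_compose[OF measurable_Pair1'[OF w, of borel] f] by simp
    have "(\<integral>\<^sup>+y. f w y \<partial>\<mu> (h w)) = (\<integral>\<^sup>+y. (SUP n. f w y * indicator (?I n) y) \<partial>\<mu> (h w))"
    proof (rule nn_integral_cong)
      fix y :: real
      obtain n where n: "\<bar>y\<bar> < real n" using reals_Archimedean2 by blast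
      have "(SUP n. f w y * indicator (?I n) y) = f w y"
        by (rule antisym[OF SUP_least SUP_upper2[of n]]) (use n in \<open>auto split: split_indicator\<close>)
      then show "f w y = (SUP n. f w y * indicator (?I n) y)" by simp
    qed
    also have "\<dots> = (SUP n. \<integral>\<^sup>+y. f w y * indicator (?I n) y \<partial>\<mu> (h w))"
      by (rule nn_integral_monotone_convergence_SUP)
        (auto simp: incseq_def le_fun_def split: split_indicator)
    also have "\<dots> = (SUP n. c n (h w) * (\<integral>\<^sup>+y. f w y \<partial>L n (h w)))"
    proof (rule SUP_cong)
      fix n
      have "c n (h w) * inverse (c n (h w)) = 1" using c
        by (simp add: ennreal_divide_self less_top[symmetric] flip: divide_ennreal_def)
      then show "(\<integral>\<^sup>+y. f w y * indicator (?I n) y \<partial>\<mu> (h w)) = c n (h w) * (\<integral>\<^sup>+y. f w y \<partial>L n (h w))"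
        by (simp add: L_int mult.assoc[symmetric])
    qed simp
    finally show ?thesis .
  qed
  moreover have "(\<lambda>w. SUP n. c n (h w) * (\<integral>\<^sup>+y. f w y \<partial>L n (h w))) \<in> borel_measurable N"
    using nn_integral_measurable_subprob_algebra2[OF f measurable_compose[OF h L]] by measurable
  ultimately show ?thesis by (simp cong: measurable_cong)
qed

lemma emeasure_interval_measurable [measurable (raw)]:
  assumes [measurable]: "f \<in> borel_measurable N" "g \<in> borel_measurable N" "h \<in> N \<rightarrow>\<^sub>M M"
  shows "(\<lambda>w. emeasure (\<mu> (h w)) {f w..<g w}) \<in> borel_measurable N"
    and "(\<lambda>w. measure (\<mu> (h w)) {f w..<g w}) \<in> borel_measurable N"
    and "(\<lambda>w. measure (\<mu> (h w)) {f w<..g w}) \<in> borel_measurable N"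
proof -
  have "(\<lambda>w. \<integral>\<^sup>+y. indicator {f w..<g w} y \<partial>\<mu> (h w)) \<in> borel_measurable N"
    unfolding indicator_def atLeastLessThan_iff by measurable
  then show *: "(\<lambda>w. emeasure (\<mu> (h w)) {f w..<g w}) \<in> borel_measurable N" by simp
  then show "(\<lambda>w. measure (\<mu> (h w)) {f w..<g w}) \<in> borel_measurable N"
    unfolding measure_def by measurable
  have "(\<lambda>w. enn2real (\<integral>\<^sup>+y. indicator {f w<..g w} y \<partial>\<mu> (h w))) \<in> borel_measurable N"
    unfolding indicator_def greaterThanAtMost_iff by measurable
  then show "(\<lambda>w. measure (\<mu> (h w)) {f w<..g w}) \<in> borel_measurable N"
    unfolding measure_def by simp
qed

lemma mu_shift:
  assumes \<omega>: "\<omega> \<in> space M"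
  shows "\<mu> (\<theta> t \<omega>) = distr (\<mu> \<omega>) borel (\<lambda>y. y - t)"
proof (rule measure_eqI)
  fix A assume "A \<in> sets (\<mu> (\<theta> t \<omega>))"
  then have A [measurable]: "A \<in> sets borel" by simp
  let ?B = "(\<lambda>y. y - t) -` A"
  have [measurable]: "?B \<in> sets borel"
    using measurable_sets[of "\<lambda>y. y - t" borel borel A] by simp
  have "(\<lambda>x. x - t) ` ?B = A" by (auto simp: image_iff intro!: bexI[of _ "y + t" for y])
  then have "emeasure (\<mu> (\<theta> t \<omega>)) A = emeasure (\<mu> \<omega>) ?B"
    using invariant \<omega> unfolding invariant_measure_def by (metis \<open>?B \<in> sets borel\<close>)
  then show "emeasure (\<mu> (\<theta> t \<omega>)) A = emeasure (distr (\<mu> \<omega>) borel (\<lambda>y. y - t)) A"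
    by (simp add: emeasure_distr)
qed simp

section \<open>The random coupling\<close>

definition excess_mass :: "'a \<Rightarrow> nat \<Rightarrow> real \<Rightarrow> real" where
  "excess_mass \<omega> j a = 2 ^ j - measure (\<mu> \<omega>) {a..<a + 2 ^ j}"

lemma excess_mass_measurable [measurable (raw)]:
  assumes [measurable]: "f \<in> borel_measurable N" "h \<in> N \<rightarrow>\<^sub>M M"
  shows "(\<lambda>w. excess_mass (h w) j (f w)) \<in> borel_measurable N"
  unfolding excess_mass_def by measurable

lemma excess_mass_measurable' [measurable]: "\<omega> \<in> space M \<Longrightarrow> excess_mass \<omega> j \<in> borel_measurable borel"
  using excess_mass_measurable[of "\<lambda>x. x" borel "\<lambda>_. \<omega>" j] by simp

lemma measure_mu_shift:
  "\<omega> \<in> space M \<Longrightarrow> measure (\<mu> (\<theta> t \<omega>)) {a..<b} = measure (\<mu> \<omega>) {a + t..<b + t}"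
  by (simp add: measure_def emeasure_mu_shift)

lemma excess_mass_shift: "\<omega> \<in> space M \<Longrightarrow> excess_mass (\<theta> t \<omega>) j a = excess_mass \<omega> j (a + t)"
  by (simp add: excess_mass_def measure_mu_shift algebra_simps)

lemma excess_mu:
  assumes "\<omega> \<in> space M" shows "excess (\<mu> \<omega>) (excess_mass \<omega>)"
proof
  show "excess_mass \<omega> (Suc j) a = excess_mass \<omega> j a + excess_mass \<omega> j (a + 2 ^ j)" for j a
  proof -
    have "{a..<a + 2 ^ Suc j} = {a..<a + 2 ^ j} \<union> {a + 2 ^ j..<a + 2 ^ j + 2 ^ j}"
      by (auto simp: ivl_disj_un)
    then have "measure (\<mu> \<omega>) {a..<a + 2 ^ Suc j} = measure (\<mu> \<omega>) {a..<a + 2 ^ j} + measure (\<mu> \<omega>) {a + 2 ^ j..<a + 2 ^ j + 2 ^ j}"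
      using locally_finite[of \<omega>] by (simp add: measure_Union less_top[symmetric] ivl_disj_int)
    then show ?thesis by (simp add: excess_mass_def)
  qed
qed (use assms locally_finite in \<open>auto simp: excess_mass_def\<close>)

abbreviation "K \<omega> \<equiv> match_kernel (excess_mass \<omega>)"
abbreviation "unmatched \<omega> \<equiv> src_mean (excess_mass \<omega>)"

lemma K_shift: "\<omega> \<in> space M \<Longrightarrow> K (\<theta> t \<omega>) x y = K \<omega> (x + t) (y + t)"
  by (rule match_kernel_shift) (auto simp: excess_mass_shift)

lemma unmatched_shift: "\<omega> \<in> space M \<Longrightarrow> unmatched (\<theta> t \<omega>) j x = unmatched \<omega> j (x + t)"
  by (rule src_mean_shift) (auto simp: excess_mass_shift)

lemma K_measurable [measurable (raw)]:
  assumes [measurable]: "h \<in> N \<rightarrow>\<^sub>M M" "f \<in> borel_measurable N" "g \<in> borel_measurable N"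
  shows "(\<lambda>w. K (h w) (f w) (g w)) \<in> borel_measurable N"
proof -
  have [measurable]: "(\<lambda>w. level_kernel (excess_mass (h w)) j (f w) (g w)) \<in> borel_measurable N" for j
    by (rule level_kernel_measurable[where D="\<lambda>w. excess_mass (h w)"])
      (auto intro: assms excess_mass_measurable measurable_compose[OF _ assms(1)])
  show ?thesis unfolding match_kernel_def by measurable
qed

lemma K_measurable_at:
  assumes "\<omega> \<in> space M" "f \<in> borel_measurable N" "g \<in> borel_measurable N"
  shows "(\<lambda>w. K \<omega> (f w) (g w)) \<in> borel_measurable N"
  using K_measurable[of "\<lambda>_. \<omega>" N f g] assms by simp

lemma unmatched_measurable [measurable (raw)]:
  assumes [measurable]: "h \<in> N \<rightarrow>\<^sub>M M" "f \<in> borel_measurable N"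
  shows "(\<lambda>w. unmatched (h w) j (f w)) \<in> borel_measurable N"
  by (rule src_mean_measurable[where D="\<lambda>w. excess_mass (h w)"])
    (auto intro: assms excess_mass_measurable measurable_compose[OF _ assms(1)])

lemma src_dens_shift: "\<omega> \<in> space M \<Longrightarrow>
    src_dens (excess_mass (\<theta> t \<omega>)) j a x = src_dens (excess_mass \<omega>) j (a + t) (x + t)"
  by (rule leftover_density_shift) (auto intro!: sources_shift excess_mass_shift)

lemma src_dens_excess_measurable [measurable (raw)]:
  assumes [measurable]: "h \<in> N \<rightarrow>\<^sub>M M" "f \<in> borel_measurable N" "g \<in> borel_measurable N"
  shows "(\<lambda>w. src_dens (excess_mass (h w)) j (f w) (g w)) \<in> borel_measurable N"
  by (rule leftover_density_measurable[where e="\<lambda>w. sources (excess_mass (h w))"])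
    (auto simp: sources_def)

lemma expected_unmatched_eq:
  "(\<integral>\<^sup>+\<omega>. unmatched \<omega> j x \<partial>M) = (\<integral>\<^sup>+\<omega>. unmatched \<omega> j 0 \<partial>M)"
proof -
  have "(\<integral>\<^sup>+\<omega>. unmatched \<omega> j x \<partial>M) = (\<integral>\<^sup>+\<omega>. unmatched (\<theta> x \<omega>) j 0 \<partial>M)"
    by (intro nn_integral_cong) (simp add: unmatched_shift)
  then show ?thesis by (subst (asm) nn_integral_flow) simp_all
qed

lemma expected_sources_shift:
  "(\<integral>\<^sup>+\<omega>. ennreal (sources (excess_mass \<omega>) j a) \<partial>M) = (\<integral>\<^sup>+\<omega>. ennreal (sources (excess_mass \<omega>) j 0) \<partial>M)"
proof -
  have [measurable]: "(\<lambda>\<omega>. sources (excess_mass \<omega>) j 0) \<in> borel_measurable M"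
    unfolding sources_def by measurable
  have "(\<integral>\<^sup>+\<omega>. ennreal (sources (excess_mass \<omega>) j a) \<partial>M) = (\<integral>\<^sup>+\<omega>. ennreal (sources (excess_mass (\<theta> a \<omega>)) j 0) \<partial>M)"
    by (intro nn_integral_cong) (simp add: sources_def excess_mass_shift)
  then show ?thesis by (subst (asm) nn_integral_flow[where f="\<lambda>\<omega>. ennreal (sources (excess_mass \<omega>) j 0)"]) simp_all
qed

text \<open>By stationarity the probability that \<open>0\<close> is unmatched in the block starting at \<open>a\<close> is the one that \<open>-a\<close> is
  unmatched in the block starting at \<open>0\<close>. The average over \<open>a\<close> therefore becomes the expected
  total of the leftovers in one fixed block, which are those of its two halves.\<close>

lemma expected_unmatched_Suc:
  "(\<integral>\<^sup>+\<omega>. unmatched \<omega> (Suc j) 0 \<partial>M) = ennreal (1 / 2 ^ j) * (\<integral>\<^sup>+\<omega>. ennreal (sources (excess_mass \<omega>) j 0) \<partial>M)"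
proof -
  interpret P: pair_sigma_finite lborel M ..
  let ?s = "\<lambda>\<omega>. src_dens (excess_mass \<omega>) (Suc j)"
  have [measurable]: "(\<lambda>\<omega>. sources (excess_mass \<omega>) j a) \<in> borel_measurable M" for a
    unfolding sources_def by measurable
  have "(\<integral>\<^sup>+\<omega>. unmatched \<omega> (Suc j) 0 \<partial>M) =
      ennreal (1 / 2 ^ Suc j) * (\<integral>\<^sup>+\<omega>. \<integral>\<^sup>+a. block (Suc j) a 0 * ennreal (?s \<omega> a 0) \<partial>lborel \<partial>M)"
    unfolding mean_leftover_def by (rule nn_integral_cmult) measurable
  also have "(\<integral>\<^sup>+\<omega>. \<integral>\<^sup>+a. block (Suc j) a 0 * ennreal (?s \<omega> a 0) \<partial>lborel \<partial>M) =
     (\<integral>\<^sup>+a. \<integral>\<^sup>+\<omega>. block (Suc j) a 0 * ennreal (?s \<omega> a 0) \<partial>M \<partial>lborel)"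
    by (rule P.Fubini') measurable
  also have "\<dots> = (\<integral>\<^sup>+a. \<integral>\<^sup>+\<omega>. block (Suc j) 0 (- a) * ennreal (?s (\<theta> a \<omega>) 0 (- a)) \<partial>M \<partial>lborel)"
  proof (intro nn_integral_cong)
    fix a \<omega> assume "\<omega> \<in> space M"
    then show "block (Suc j) a 0 * ennreal (?s \<omega> a 0) = block (Suc j) 0 (- a) * ennreal (?s (\<theta> a \<omega>) 0 (- a))"
      using block_shift[of "Suc j" 0 a "- a"] by (simp add: src_dens_shift del: leftover_density.simps)
  qed
  also have "\<dots> = (\<integral>\<^sup>+a. \<integral>\<^sup>+\<omega>. block (Suc j) 0 (- a) * ennreal (?s \<omega> 0 (- a)) \<partial>M \<partial>lborel)"
    by (intro nn_integral_cong nn_integral_flow[where f="\<lambda>\<omega>. block (Suc j) 0 (- a) * ennreal (?s \<omega> 0 (- a))" for a]) measurable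
  also have "\<dots> = (\<integral>\<^sup>+a. \<integral>\<^sup>+\<omega>. block (Suc j) 0 a * ennreal (?s \<omega> 0 a) \<partial>M \<partial>lborel)"
    using nn_integral_real_affine[of "\<lambda>a. \<integral>\<^sup>+\<omega>. block (Suc j) 0 a * ennreal (?s \<omega> 0 a) \<partial>M" "-1" 0]
    by (simp del: leftover_density.simps)
  also have "\<dots> = (\<integral>\<^sup>+\<omega>. \<integral>\<^sup>+a. block (Suc j) 0 a * ennreal (?s \<omega> 0 a) \<partial>lborel \<partial>M)"
    by (rule P.Fubini'[symmetric]) measurable
  also have "\<dots> = (\<integral>\<^sup>+\<omega>. ennreal (sources (excess_mass \<omega>) j 0) + ennreal (sources (excess_mass \<omega>) j (2 ^ j)) \<partial>M)"
  proof (intro nn_integral_cong)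
    fix \<omega> assume "\<omega> \<in> space M"
    then interpret excess "\<mu> \<omega>" "excess_mass \<omega>" by (rule excess_mu)
    show "(\<integral>\<^sup>+a. block (Suc j) 0 a * ennreal (?s \<omega> 0 a) \<partial>lborel) =
       ennreal (sources (excess_mass \<omega>) j 0) + ennreal (sources (excess_mass \<omega>) j (2 ^ j))"
      unfolding src.nn_integral_leftover_density by (simp add: src.e_nonneg)
  qed
  also have "\<dots> = 2 * (\<integral>\<^sup>+\<omega>. ennreal (sources (excess_mass \<omega>) j 0) \<partial>M)"
    by (subst nn_integral_add) (simp_all add: expected_sources_shift[of j "2 ^ j"] mult_2)
  also have "ennreal (1 / 2 ^ Suc j) * (2 * (\<integral>\<^sup>+\<omega>. ennreal (sources (excess_mass \<omega>) j 0) \<partial>M)) =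
     ennreal (1 / 2 ^ Suc j * 2) * (\<integral>\<^sup>+\<omega>. ennreal (sources (excess_mass \<omega>) j 0) \<partial>M)"
    by (subst ennreal_mult) (simp_all only: mult.assoc ennreal_numeral, simp_all)
  finally show ?thesis by simp
qed

lemma unmatched_le_1: "\<omega> \<in> space M \<Longrightarrow> unmatched \<omega> j x \<le> 1"
proof (induction j)
  case 0
  interpret excess "\<mu> \<omega>" "excess_mass \<omega>" by (rule excess_mu[OF 0])
  show ?case by (simp add: src.mean_leftover_0)
next
  case (Suc j)
  interpret excess "\<mu> \<omega>" "excess_mass \<omega>" by (rule excess_mu[OF Suc.prems])
  have "unmatched \<omega> (Suc j) x \<le> unmatched \<omega> j x"
    using level_kernel_row[of j x] by (metis add.commute le_iff_add)
  with Suc show ?case by (meson order_trans)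
qed

text \<open>The first moment is bounded by the second through \<open>2 B |x| \<le> x\<^sup>2 + B\<^sup>2\<close>, which avoids a separate
  treatment of vanishing variance.\<close>

lemma expected_sources_le:
  assumes B: "0 < B" and sd: "mass_std_dev M \<mu> (2 ^ j) \<le> ennreal B"
  shows "(\<integral>\<^sup>+\<omega>. ennreal (sources (excess_mass \<omega>) j 0) \<partial>M) \<le> ennreal B"
proof -
  let ?X = "\<lambda>\<omega>. measure (\<mu> \<omega>) {0..<2 ^ j} - 2 ^ j :: real"
  have "mass_mean M \<mu> (2 ^ j) = 2 ^ j" using mass_mean_eq[of "2 ^ j"] by simp
  then have V: "mass_variance M \<mu> (2 ^ j) = (\<integral>\<^sup>+\<omega>. ennreal ((?X \<omega>)\<^sup>2) \<partial>M)" by (simp add: mass_variance_def)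
  have fin: "mass_variance M \<mu> (2 ^ j) < \<infinity>"
    using sd by (auto simp: mass_std_dev_def top.not_eq_extremum[symmetric] top_unique split: if_splits)
  then obtain v where v: "mass_variance M \<mu> (2 ^ j) = ennreal v" "0 \<le> v"
    by (cases "mass_variance M \<mu> (2 ^ j)") auto
  have "sqrt v \<le> B" using sd v B by (simp add: mass_std_dev_def)
  then have "v \<le> B\<^sup>2" by (metis B less_imp_le real_sqrt_le_iff real_sqrt_unique)
  have "(\<integral>\<^sup>+\<omega>. ennreal (sources (excess_mass \<omega>) j 0) \<partial>M) \<le>
     (\<integral>\<^sup>+\<omega>. ennreal (1 / (2 * B)) * ennreal ((?X \<omega>)\<^sup>2) + ennreal (B / 2) \<partial>M)"
  proof (rule nn_integral_mono)
    fix \<omega>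
    have "2 * B * \<bar>?X \<omega>\<bar> \<le> (?X \<omega>)\<^sup>2 + B\<^sup>2"
      using sum_squares_bound[of B "\<bar>?X \<omega>\<bar>"] by (simp only: power2_abs add.commute)
    then have "\<bar>?X \<omega>\<bar> \<le> 1 / (2 * B) * (?X \<omega>)\<^sup>2 + B / 2" using B by (simp add: field_simps power2_eq_square)
    moreover have "sources (excess_mass \<omega>) j 0 \<le> \<bar>?X \<omega>\<bar>" by (simp add: sources_def excess_mass_def)
    ultimately have "ennreal (sources (excess_mass \<omega>) j 0) \<le> ennreal (1 / (2 * B) * (?X \<omega>)\<^sup>2 + B / 2)"
      by (intro ennreal_leI) simp
    then show "ennreal (sources (excess_mass \<omega>) j 0) \<le> ennreal (1 / (2 * B)) * ennreal ((?X \<omega>)\<^sup>2) + ennreal (B / 2)"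
      using B by (simp add: ennreal_plus ennreal_mult'[symmetric] del: times_divide_eq_left)
  qed
  also have "\<dots> = ennreal (1 / (2 * B)) * ennreal v + ennreal (B / 2)"
    by (subst nn_integral_add) (simp_all add: nn_integral_cmult V[symmetric] v emeasure_space_1)
  also have "\<dots> = ennreal (v / (2 * B) + B / 2)"
    using v B by (simp add: ennreal_mult'[symmetric])
  also have "\<dots> \<le> ennreal B"
    using \<open>v \<le> B\<^sup>2\<close> B by (intro ennreal_leI) (simp add: field_simps power2_eq_square)
  finally show ?thesis .
qed

definition match_cost :: "real \<Rightarrow> 'a \<Rightarrow> real \<Rightarrow> ennreal" where
  "match_cost q \<omega> x = (\<Sum>j. ennreal ((2 ^ j) powr q) * unmatched \<omega> j x)"

lemma match_cost_measurable [measurable (raw)]: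
  assumes [measurable]: "h \<in> N \<rightarrow>\<^sub>M M" "f \<in> borel_measurable N"
  shows "(\<lambda>w. match_cost q (h w) (f w)) \<in> borel_measurable N"
  unfolding match_cost_def by measurable

lemma expected_match_cost_eq: "(\<integral>\<^sup>+\<omega>. match_cost q \<omega> x \<partial>M) = (\<Sum>j. ennreal ((2 ^ j) powr q) * (\<integral>\<^sup>+\<omega>. unmatched \<omega> j 0 \<partial>M))"
  unfolding match_cost_def
  by (subst nn_integral_suminf) (simp_all add: nn_integral_cmult expected_unmatched_eq[where x=x])

end

lemma power_powr_swap: "(2 ^ j) powr s = (2 powr s :: real) ^ j"
  by (induction j) (simp_all add: powr_mult)

lemma suminf_finite_of_eventually_geometric:
  fixes f :: "nat \<Rightarrow> ennreal"
  assumes fin: "\<And>j. f j < \<infinity>" and r: "0 \<le> r" "r < 1" and C: "0 \<le> C"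
    and ev: "\<forall>\<^sub>F j in sequentially. f j \<le> ennreal (C * r ^ j)"
  shows "(\<Sum>j. f j) < \<infinity>"
proof -
  obtain n where n: "\<And>j. n \<le> j \<Longrightarrow> f j \<le> ennreal (C * r ^ j)"
    using ev unfolding eventually_sequentially by blast
  have "(\<Sum>j. f (j + n)) \<le> (\<Sum>j. ennreal (C * r ^ (j + n)))"
    by (intro suminf_le n) auto
  also have "\<dots> = ennreal (\<Sum>j. C * r ^ (j + n))"
    using r C by (intro suminf_ennreal2 summable_mult summable_ignore_initial_segment summable_geometric) auto
  finally have "(\<Sum>j. f (j + n)) < \<infinity>" by (rule le_less_trans) simp
  moreover have "(\<Sum>j<n. f j) < \<infinity>" using fin by (simp add: less_top[symmetric])
  moreover have "(\<Sum>j. f j) = (\<Sum>j. f (j + n)) + (\<Sum>j<n. f j)"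
    by (rule suminf_offset) simp
  ultimately show ?thesis by (simp add: less_top[symmetric])
qed

context locally_finite_invariant_measure
begin

lemma expected_unmatched_le:
  assumes p: "p < 1"
    and ls: "limsup (\<lambda>n. mass_std_dev M \<mu> (real n) * ennreal (real n powr (p - 1))) = 0"
  shows "\<forall>\<^sub>F j in sequentially. (\<integral>\<^sup>+\<omega>. unmatched \<omega> (Suc j) 0 \<partial>M) \<le> ennreal ((2 powr (- p)) ^ j)"
proof -
  have "\<forall>\<^sub>F n in sequentially. mass_std_dev M \<mu> (real n) * ennreal (real n powr (p - 1)) < 1"
    by (rule Limsup_lessD) (simp add: ls)
  then have "\<forall>\<^sub>F j in sequentially. mass_std_dev M \<mu> (real (2 ^ j)) * ennreal (real (2 ^ j) powr (p - 1)) < 1"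
    by (rule eventually_compose_filterlim) (rule filterlim_subseq, simp add: strict_mono_def)
  then show ?thesis
  proof eventually_elim
    case (elim j)
    let ?B = "(2 ^ j) powr (1 - p) :: real"
    have B: "0 < ?B" by simp
    have "mass_std_dev M \<mu> (2 ^ j) = mass_std_dev M \<mu> (2 ^ j) * ennreal ((2 ^ j) powr (p - 1)) * ennreal ?B"
      by (simp add: mult.assoc ennreal_mult'[symmetric] powr_add[symmetric])
    also have "\<dots> \<le> 1 * ennreal ?B" using elim by (intro mult_right_mono) auto
    finally have "mass_std_dev M \<mu> (2 ^ j) \<le> ennreal ?B" by simp
    then have "(\<integral>\<^sup>+\<omega>. unmatched \<omega> (Suc j) 0 \<partial>M) \<le> ennreal (1 / 2 ^ j) * ennreal ?B"
      unfolding expected_unmatched_Suc by (intro mult_left_mono expected_sources_le B) auto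
    also have "\<dots> = ennreal (1 / 2 ^ j * ?B)" by (rule ennreal_mult[symmetric]) simp_all
    also have "1 / 2 ^ j * ?B = (2 powr (- p)) ^ j"
    proof -
      have "2 powr (1 - p) = 2 * 2 powr (- p)" using powr_add[of 2 1 "- p"] by simp
      then show ?thesis by (simp add: power_powr_swap power_mult_distrib)
    qed
    finally show ?case .
  qed
qed

lemma expected_match_cost_finite:
  assumes p: "0 < q" "q < p" "p < 1"
    and ls: "limsup (\<lambda>n. mass_std_dev M \<mu> (real n) * ennreal (real n powr (p - 1))) = 0"
  shows "(\<integral>\<^sup>+\<omega>. match_cost q \<omega> x \<partial>M) < \<infinity>"
proof -
  let ?f = "\<lambda>j. ennreal ((2 ^ j) powr q) * (\<integral>\<^sup>+\<omega>. unmatched \<omega> j 0 \<partial>M)"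
  have fin: "?f j < \<infinity>" for j
  proof -
    have "(\<integral>\<^sup>+\<omega>. unmatched \<omega> j 0 \<partial>M) \<le> (\<integral>\<^sup>+\<omega>. 1 \<partial>M)" by (intro nn_integral_mono unmatched_le_1)
    then have "(\<integral>\<^sup>+\<omega>. unmatched \<omega> j 0 \<partial>M) < \<infinity>" by (simp add: emeasure_space_1 le_less_trans[of _ 1])
    then show ?thesis by (simp add: ennreal_mult_less_top)
  qed
  have "(\<Sum>j. ?f (Suc j)) < \<infinity>"
  proof (rule suminf_finite_of_eventually_geometric[where C="2 powr q" and r="2 powr (q - p)"])
    show "\<forall>\<^sub>F j in sequentially. ?f (Suc j) \<le> ennreal (2 powr q * (2 powr (q - p)) ^ j)"
      using expected_unmatched_le[OF p(3) ls]
    proof eventually_elim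
      case (elim j)
      have "?f (Suc j) \<le> ennreal ((2 ^ Suc j) powr q) * ennreal ((2 powr (- p)) ^ j)"
        using elim by (intro mult_left_mono) auto
      also have "\<dots> = ennreal ((2 ^ Suc j) powr q * (2 powr (- p)) ^ j)" by (rule ennreal_mult[symmetric]) simp_all
      also have "(2 ^ Suc j) powr q * (2 powr (- p)) ^ j = 2 powr q * (2 powr (q - p)) ^ j"
        using powr_add[of 2 q "- p"] by (simp only: power_powr_swap) (simp add: power_mult_distrib)
      finally show ?case .
    qed
    show "2 powr (q - p) < (1::real)" using p powr_less_mono[of "q - p" 0 2] by simp
    show "?f (Suc j) < \<infinity>" for j by (rule fin)
  qed auto
  moreover have "(\<Sum>j. ?f j) = (\<Sum>j. ?f (Suc j)) + ?f 0"
    using suminf_offset[of ?f 1] by simp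
  ultimately show ?thesis unfolding expected_match_cost_eq using fin[of 0] by (simp add: less_top[symmetric])
qed

text \<open>Finite expected cost makes the unmatched proportions summable, hence convergent to \<open>0\<close>. This holds
  almost surely for each \<open>x\<close>, and Fubini's theorem exchanges the quantifiers.\<close>

lemma AE_row_eq_1:
  assumes q: "0 < q" and fin: "(\<integral>\<^sup>+\<omega>. match_cost q \<omega> 0 \<partial>M) < \<infinity>"
  shows "AE \<omega> in M. AE x in lborel. (\<integral>\<^sup>+y. K \<omega> x y \<partial>\<mu> \<omega>) = 1"
proof -
  interpret P: pair_sigma_finite lborel M ..
  have "AE x in lborel. AE \<omega> in M. match_cost q \<omega> x \<noteq> \<infinity>"
  proof (rule AE_I2)
    fix x
    have "(\<integral>\<^sup>+\<omega>. match_cost q \<omega> x \<partial>M) \<noteq> \<infinity>"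
      using fin unfolding expected_match_cost_eq by simp
    then show "AE \<omega> in M. match_cost q \<omega> x \<noteq> \<infinity>" by (intro nn_integral_PInf_AE) simp_all
  qed
  then have "AE \<omega> in M. AE x in lborel. match_cost q \<omega> x \<noteq> \<infinity>"
    by (subst P.AE_commute[symmetric]) measurable
  then show ?thesis using AE_space
  proof eventually_elim
    case (elim \<omega>)
    interpret excess "\<mu> \<omega>" "excess_mass \<omega>" by (rule excess_mu) fact
    show ?case using elim(1)
    proof eventually_elim
      case (elim x)
      have "(\<Sum>j. unmatched \<omega> j x) \<le> match_cost q \<omega> x"
        unfolding match_cost_def
      proof (rule suminf_le)
        fix j
        have "ennreal 1 \<le> ennreal ((2 ^ j) powr q)" using q by (intro ennreal_leI ge_one_powr_ge_zero) auto
        then have "1 * unmatched \<omega> j x \<le> ennreal ((2 ^ j) powr q) * unmatched \<omega> j x" by (intro mult_right_mono) auto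
        then show "unmatched \<omega> j x \<le> ennreal ((2 ^ j) powr q) * unmatched \<omega> j x" by simp
      qed auto
      then have "(\<Sum>j. unmatched \<omega> j x) \<noteq> \<infinity>" using elim by (auto simp: top_unique)
      then have "unmatched \<omega> j x \<noteq> \<infinity>" and "summable (\<lambda>j. enn2real (unmatched \<omega> j x))" for j
      proof -
        have fin: "unmatched \<omega> j x \<noteq> \<infinity>" for j
          using unmatched_le_1[OF \<open>\<omega> \<in> space M\<close>, of j x] by (auto simp: top_unique)
        then show "unmatched \<omega> j x \<noteq> \<infinity>" .
        show "summable (\<lambda>j. enn2real (unmatched \<omega> j x))"
          using \<open>(\<Sum>j. unmatched \<omega> j x) \<noteq> \<infinity>\<close> fin
          by (intro summable_suminf_not_top) (simp_all add: less_top)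
      qed
      then have "(\<lambda>j. ennreal (enn2real (unmatched \<omega> j x))) \<longlonglongrightarrow> ennreal 0"
        by (intro tendsto_ennrealI summable_LIMSEQ_zero)
      then have "(\<lambda>j. unmatched \<omega> j x) \<longlonglongrightarrow> 0"
        using \<open>\<And>j. unmatched \<omega> j x \<noteq> \<infinity>\<close> by (simp add: less_top)
      then show ?case by (rule match_kernel_row_eq_1)
    qed
  qed
qed

lemma K_cost:
  assumes "\<omega> \<in> space M" "0 \<le> q"
  shows "(\<integral>\<^sup>+y. ennreal (\<bar>y - x\<bar> powr q) * K \<omega> x y \<partial>\<mu> \<omega>) \<le> match_cost q \<omega> x"
  unfolding match_cost_def by (rule excess.match_kernel_cost[OF excess_mu]) (use assms in auto)

lemma K_column: "\<omega> \<in> space M \<Longrightarrow> (\<integral>\<^sup>+x. K \<omega> x y \<partial>lborel) \<le> 1"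
  by (rule excess.match_kernel_column_le[OF excess_mu])

end

section \<open>From a coupling to a map\<close>

text \<open>The rank \<open>x \<mapsto> \<lambda>(C \<inter> (-\<infinity>, x])\<close> maps \<open>\<lambda>\<close> on \<open>C\<close> to Lebesgue measure on \<open>[0, \<lambda>(C)]\<close>. It is continuous, so a
  level \<open>v\<close> below \<open>\<lambda>(C)\<close> is attained at a last point \<open>z\<close>, and then \<open>C \<inter> (-\<infinity>, z]\<close> has measure \<open>v\<close>.\<close>

lemma emeasure_rank_le:
  fixes C :: "real set"
  assumes C [measurable]: "C \<in> sets borel" and sub: "C \<subseteq> {lo..hi}" and v: "0 \<le> v" "v \<le> measure lborel C"
  shows "emeasure lborel {x\<in>C. measure lborel (C \<inter> {..x}) \<le> v} = ennreal v"
proof (cases "C = {}")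
  case False
  define c where "c x = measure lborel (C \<inter> {..x})" for x
  have "lo \<le> hi" using False sub by auto
  have finA: "emeasure lborel A < \<infinity>" if "A \<subseteq> C" for A
  proof -
    have "emeasure lborel A \<le> emeasure lborel {lo..hi}" using that sub by (intro emeasure_mono) auto
    also have "\<dots> < \<infinity>" by (simp add: emeasure_lborel_Icc_eq)
    finally show ?thesis .
  qed
  have fin: "emeasure lborel (C \<inter> A) \<noteq> \<infinity>" for A using finA[of "C \<inter> A"] by auto
  have mono: "c x \<le> c y" if "x \<le> y" for x y
    unfolding c_def using that fin[of "{..y}"] by (intro measure_mono_fmeasurable) (auto simp: fmeasurable_def less_top)
  have lip: "c y - c x \<le> y - x" if "x \<le> y" for x y
  proof -
    have "C \<inter> {..y} \<subseteq> (C \<inter> {..x}) \<union> {x..y}" by auto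
    then have "c y \<le> measure lborel ((C \<inter> {..x}) \<union> {x..y})"
      unfolding c_def using fin[of "{..x}"]
      by (intro measure_mono_fmeasurable fmeasurable.Un) (auto simp: fmeasurable_def less_top emeasure_lborel_Icc_eq)
    also have "\<dots> \<le> c x + measure lborel {x..y}"
      unfolding c_def using fin[of "{..x}"] by (intro measure_Un_le) auto
    finally show ?thesis using that by simp
  qed
  have dist: "\<bar>c x - c y\<bar> \<le> \<bar>x - y\<bar>" for x y
    using mono[of x y] lip[of x y] mono[of y x] lip[of y x] by (cases "x \<le> y") auto
  have cont: "continuous_on A c" for A
    by (rule lipschitz_on_continuous_on[of 1]) (auto intro!: lipschitz_onI simp: dist_real_def dist)
  have chi: "c hi = measure lborel C"
    unfolding c_def using sub by (intro arg_cong[where f="measure lborel"]) auto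
  have "emeasure lborel (C \<inter> {..lo}) \<le> emeasure lborel {lo}" using sub by (intro emeasure_mono) auto
  then have clo: "c lo = 0" by (simp add: c_def measure_def)
  have emc: "emeasure lborel (C \<inter> {..x}) = ennreal (c x)" for x
    unfolding c_def using fin[of "{..x}"] by (simp add: emeasure_eq_ennreal_measure)
  show ?thesis
  proof (cases "v = measure lborel C")
    case True
    have "c x \<le> v" if "x \<in> C" for x using mono[of x hi] chi True that sub by auto
    then have "{x\<in>C. c x \<le> v} = C" by auto
    then show ?thesis using fin[of UNIV] True by (simp add: c_def[symmetric] emeasure_eq_ennreal_measure)
  next
    case False
    with v have "v < measure lborel C" by simp
    define Z where "Z = {x\<in>{lo..hi}. c x \<le> v}"
    have "Z = {lo..hi} \<inter> {x. c x \<le> v}" by (auto simp: Z_def)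
    then have "compact Z" by (simp add: compact_Int_closed closed_Collect_le cont)
    moreover have "lo \<in> Z" using clo v \<open>lo \<le> hi\<close> by (simp add: Z_def)
    ultimately obtain z where z: "z \<in> Z" "\<And>x. x \<in> Z \<Longrightarrow> x \<le> z"
      using compact_attains_sup[of Z] by blast
    have cz: "c z = v"
    proof (rule ccontr)
      assume "c z \<noteq> v"
      with z have "c z \<le> v" "z \<le> hi" "lo \<le> z" by (auto simp: Z_def)
      then obtain w where "z \<le> w" "w \<le> hi" "c w = v"
        using IVT'[of c z v hi] cont chi \<open>v < measure lborel C\<close> by auto
      then have "w \<in> Z" using \<open>lo \<le> z\<close> by (simp add: Z_def)
      then show False using z(2)[of w] \<open>z \<le> w\<close> \<open>c w = v\<close> \<open>c z \<noteq> v\<close> by auto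
    qed
    have "{x\<in>C. c x \<le> v} = C \<inter> {..z}"
    proof safe
      fix x assume "x \<in> C" "c x \<le> v"
      then show "x \<le> z" using sub by (intro z(2)) (auto simp: Z_def)
    next
      fix x assume "x \<le> z" then show "c x \<le> v" using mono[of x z] cz by simp
    qed
    then show ?thesis by (simp add: c_def[symmetric] emc cz)
  qed
qed (use v in simp)

lemma rank_measurable:
  fixes C :: "real set"
  assumes [measurable]: "C \<in> sets borel"
  shows "(\<lambda>x. measure lborel (C \<inter> {..x})) \<in> borel_measurable borel"
proof -
  have "(\<lambda>x. measure lborel (C \<inter> {..x})) =
      (\<lambda>x. enn2real (\<integral>\<^sup>+z. indicator C z * (if z \<le> x then 1 else 0) \<partial>lborel))"
  proof
    fix x
    have "emeasure lborel (C \<inter> {..x}) = (\<integral>\<^sup>+z. indicator (C \<inter> {..x}) z \<partial>lborel)" by simp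
    also have "\<dots> = (\<integral>\<^sup>+z. indicator C z * (if z \<le> x then 1 else 0) \<partial>lborel)"
      by (intro nn_integral_cong) (auto split: split_indicator)
    finally show "measure lborel (C \<inter> {..x}) =
        enn2real (\<integral>\<^sup>+z. indicator C z * (if z \<le> x then 1 else 0) \<partial>lborel)" by (simp add: measure_def)
  qed
  also have "\<dots> \<in> borel_measurable borel" by measurable
  finally show ?thesis .
qed

lemma null_rank_extreme:
  fixes C :: "real set"
  assumes C [measurable]: "C \<in> sets borel" and sub: "C \<subseteq> {lo..hi}"
  shows "AE x in lborel. x \<in> C \<longrightarrow> 0 < measure lborel (C \<inter> {..x}) \<and> measure lborel (C \<inter> {..x}) < measure lborel C"
proof -
  define c where "c x = measure lborel (C \<inter> {..x})" for x
  define T where "T = measure lborel C"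
  have [measurable]: "c \<in> borel_measurable borel" unfolding c_def by (rule rank_measurable[OF C])
  note le = emeasure_rank_le[OF C sub, folded c_def T_def]
  have "0 \<le> T" by (simp add: T_def)
  have finC: "emeasure lborel C = ennreal T"
  proof -
    have "emeasure lborel C \<le> emeasure lborel {lo..hi}" using sub by (intro emeasure_mono) auto
    also have "\<dots> < \<infinity>" by (simp add: emeasure_lborel_Icc_eq)
    finally show ?thesis by (simp add: T_def emeasure_eq_ennreal_measure)
  qed
  have "emeasure lborel {x\<in>C. T \<le> c x} \<le> 0 + ennreal e" if e: "0 < e" for e
  proof (cases "e \<le> T")
    case True
    have "emeasure lborel {x\<in>C. T \<le> c x} \<le> emeasure lborel (C - {x\<in>C. c x \<le> T - e})"
      using e by (intro emeasure_mono) auto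
    also have "\<dots> = ennreal T - ennreal (T - e)"
      using le[of "T - e"] True e finC by (subst emeasure_Diff) auto
    also have "\<dots> = ennreal e" using True e by (simp add: ennreal_minus)
    finally show ?thesis by simp
  next
    case False
    have "emeasure lborel {x\<in>C. T \<le> c x} \<le> emeasure lborel C" by (intro emeasure_mono) auto
    also have "\<dots> \<le> ennreal e" using False finC by (simp add: ennreal_leI)
    finally show ?thesis by simp
  qed
  then have "emeasure lborel {x\<in>C. T \<le> c x} \<le> 0" by (rule ennreal_le_epsilon) auto
  then have N1: "{x\<in>C. T \<le> c x} \<in> null_sets lborel" by (auto simp: null_sets_def)
  have N2: "{x\<in>C. c x \<le> 0} \<in> null_sets lborel"
    using le[of 0] \<open>0 \<le> T\<close> by (auto simp: null_sets_def)
  show ?thesis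
    unfolding c_def[symmetric] T_def[symmetric]
    using AE_not_in[OF N1] AE_not_in[OF N2] by eventually_elim auto
qed

text \<open>A labelling \<open>L\<close> partitions the line into its fibres. The image of the class of label \<open>l\<close> under the
  coupling with density \<open>k\<close> is \<open>class_image\<close>, and \<open>class_cdf\<close> is its distribution function, kept in \<open>[0,\<infinity>]\<close>
  so that it is monotone even when \<open>k\<close> is not a coupling. The map \<open>class_map\<close> sends a point to the quantile of the image
  of its class given by its rank within the class; the guard ensures that the infimum is finite
  and thereby commutes with translations.\<close>

definition class_rank :: "(real \<Rightarrow> real) \<Rightarrow> real \<Rightarrow> real" where
  "class_rank L x = measure lborel {z. L z = L x \<and> z \<le> x}"

definition class_image :: "real measure \<Rightarrow> (real \<Rightarrow> real \<Rightarrow> ennreal) \<Rightarrow> (real \<Rightarrow> real) \<Rightarrow> real \<Rightarrow> real measure" where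
  "class_image N k L l = density N (\<lambda>w. \<integral>\<^sup>+z. indicator {l} (L z) * k z w \<partial>lborel)"

definition class_cdf :: "real measure \<Rightarrow> (real \<Rightarrow> real \<Rightarrow> ennreal) \<Rightarrow> (real \<Rightarrow> real) \<Rightarrow> real \<Rightarrow> real \<Rightarrow> ennreal" where
  "class_cdf N k L l y = (\<integral>\<^sup>+w. indicator {..y} w * (\<integral>\<^sup>+z. indicator {l} (L z) * k z w \<partial>lborel) \<partial>N)"

definition class_map :: "real measure \<Rightarrow> (real \<Rightarrow> real \<Rightarrow> ennreal) \<Rightarrow> (real \<Rightarrow> real) \<Rightarrow> real \<Rightarrow> real" where
  "class_map N k L x =
    (if (\<exists>y. ennreal (class_rank L x) \<le> class_cdf N k L (L x) y) \<and> (\<exists>y. class_cdf N k L (L x) y < ennreal (class_rank L x))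
     then Inf {y. ennreal (class_rank L x) \<le> class_cdf N k L (L x) y} else x)"

lemma class_cdf_mono: "y \<le> y' \<Longrightarrow> class_cdf N k L l y \<le> class_cdf N k L l y'"
  unfolding class_cdf_def by (intro nn_integral_mono mult_right_mono) (auto split: split_indicator)

locale labelled_kernel =
  fixes N :: "real measure" and k :: "real \<Rightarrow> real \<Rightarrow> ennreal" and L :: "real \<Rightarrow> real"
  assumes sets_N [measurable_cong, simp]: "sets N = sets borel"
    and sigma_finite_N: "sigma_finite_measure N"
    and k_measurable [measurable]: "(\<lambda>(x, y). k x y) \<in> borel_measurable (borel \<Otimes>\<^sub>M borel)"
    and row: "AE x in lborel. (\<integral>\<^sup>+y. k x y \<partial>N) = 1"
    and L_measurable [measurable]: "L \<in> borel_measurable borel"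
    and L_near: "\<And>x. \<bar>L x - x\<bar> \<le> 1"
    and L_countable: "countable (range L)"
begin

lemmas k_measurable_pair [measurable (raw)] = measurable_uncurried[OF k_measurable]

definition "cls l = {z. L z = l}"

lemma cls_measurable [measurable]: "cls l \<in> sets borel"
  unfolding cls_def by measurable

lemma cls_subset: "cls l \<subseteq> {l - 1..l + 1}"
  using L_near by (auto simp: cls_def abs_le_iff) (smt (verit))+

lemma class_rank_eq: "L x = l \<Longrightarrow> class_rank L x = measure lborel (cls l \<inter> {..x})"
  by (auto simp: class_rank_def cls_def intro!: arg_cong[where f="measure lborel"])

lemma indicator_cls: "indicator {l} (L z) = (indicator (cls l) z :: ennreal)"
  by (auto simp: cls_def split: split_indicator)

lemma emeasure_cls: "emeasure lborel (cls l) = ennreal (measure lborel (cls l))"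
proof -
  have "emeasure lborel (cls l) \<le> emeasure lborel {l - 1..l + 1}" using cls_subset by (intro emeasure_mono) auto
  also have "\<dots> < \<infinity>" by (simp add: emeasure_lborel_Icc_eq)
  finally show ?thesis by (simp add: emeasure_eq_ennreal_measure)
qed

lemma nn_integral_class_image:
  assumes [measurable]: "g \<in> borel_measurable borel"
  shows "(\<integral>\<^sup>+y. g y \<partial>class_image N k L l) = (\<integral>\<^sup>+x. indicator {l} (L x) * (\<integral>\<^sup>+y. g y * k x y \<partial>N) \<partial>lborel)"
proof -
  interpret N: sigma_finite_measure N by (rule sigma_finite_N)
  interpret pair_sigma_finite lborel N ..
  have "(\<integral>\<^sup>+y. g y \<partial>class_image N k L l) = (\<integral>\<^sup>+y. (\<integral>\<^sup>+x. indicator {l} (L x) * k x y \<partial>lborel) * g y \<partial>N)"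
    unfolding class_image_def by (rule nn_integral_density) measurable
  also have "\<dots> = (\<integral>\<^sup>+y. \<integral>\<^sup>+x. indicator {l} (L x) * (g y * k x y) \<partial>lborel \<partial>N)"
    by (intro nn_integral_cong, subst nn_integral_multc[symmetric]) (auto intro!: nn_integral_cong simp: ac_simps)
  also have "\<dots> = (\<integral>\<^sup>+x. \<integral>\<^sup>+y. indicator {l} (L x) * (g y * k x y) \<partial>N \<partial>lborel)"
    by (rule Fubini') measurable
  also have "\<dots> = (\<integral>\<^sup>+x. indicator {l} (L x) * (\<integral>\<^sup>+y. g y * k x y \<partial>N) \<partial>lborel)"
    by (intro nn_integral_cong nn_integral_cmult) measurable
  finally show ?thesis .
qed

lemma emeasure_class_image_UNIV: "emeasure (class_image N k L l) UNIV = ennreal (measure lborel (cls l))"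
proof -
  have "emeasure (class_image N k L l) UNIV = (\<integral>\<^sup>+y. 1 \<partial>class_image N k L l)"
    using sets_eq_imp_space_eq[OF sets_N] by (simp add: class_image_def)
  also have "\<dots> = (\<integral>\<^sup>+x. indicator {l} (L x) * (\<integral>\<^sup>+y. 1 * k x y \<partial>N) \<partial>lborel)"
    by (rule nn_integral_class_image) simp
  also have "\<dots> = (\<integral>\<^sup>+x. indicator (cls l) x \<partial>lborel)"
    using row by (intro nn_integral_cong_AE) (auto simp: indicator_cls elim!: eventually_mono)
  finally show ?thesis by (simp add: emeasure_cls)
qed

lemma finite_borel_class_image: "finite_borel_measure (class_image N k L l)"
proof (intro finite_borel_measure.intro finite_measureI finite_borel_measure_axioms.intro)
  show "emeasure (class_image N k L l) (space (class_image N k L l)) \<noteq> \<infinity>"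
    using emeasure_class_image_UNIV[of l] sets_eq_imp_space_eq[OF sets_N] by (simp add: class_image_def)
  show "sets (class_image N k L l) = sets borel" by (simp add: class_image_def)
qed

lemma class_cdf_eq: "class_cdf N k L l y = ennreal (cdf (class_image N k L l) y)"
proof -
  have "emeasure (class_image N k L l) {..y} =
    (\<integral>\<^sup>+w. (\<integral>\<^sup>+z. indicator {l} (L z) * k z w \<partial>lborel) * indicator {..y} w \<partial>N)"
    unfolding class_image_def by (rule emeasure_density) measurable
  moreover have "emeasure (class_image N k L l) {..y} = ennreal (cdf (class_image N k L l) y)"
    unfolding cdf_def
    by (rule finite_measure.emeasure_eq_measure[OF finite_borel_measure.axioms(1)[OF finite_borel_class_image]])
  ultimately show ?thesis by (simp add: class_cdf_def mult.commute)
qed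

lemma class_map_le_iff:
  assumes x: "L x = l" and r: "0 < class_rank L x" "class_rank L x < measure lborel (cls l)"
  shows "class_map N k L x \<le> y \<longleftrightarrow> class_rank L x \<le> cdf (class_image N k L l) y"
proof -
  interpret F: finite_borel_measure "class_image N k L l" by (rule finite_borel_class_image)
  let ?F = "cdf (class_image N k L l)"
  have le: "ennreal (class_rank L x) \<le> class_cdf N k L l y \<longleftrightarrow> class_rank L x \<le> ?F y" for y
    using F.cdf_nonneg[of y] by (simp add: class_cdf_eq)
  have "space (class_image N k L l) = UNIV"
    using sets_eq_imp_space_eq[OF sets_N] by (simp add: class_image_def)
  then have T: "measure (class_image N k L l) (space (class_image N k L l)) = measure lborel (cls l)"
    using emeasure_class_image_UNIV by (simp add: measure_def)
  interpret R: right_continuous_mono ?F 0 "measure lborel (cls l)"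
  proof
    show "continuous (at_right x) ?F" for x by (rule F.cdf_is_right_cont)
    show "mono ?F" by (rule monoI) (rule F.cdf_nondecreasing)
    show "(?F \<longlongrightarrow> 0) at_bot" by (rule F.cdf_lim_at_bot)
    show "(?F \<longlongrightarrow> measure lborel (cls l)) at_top" using F.cdf_lim_at_top unfolding T .
  qed
  have "\<exists>y. ?F y < class_rank L x"
    using order_tendstoD(2)[OF R.bot r(1)] by (auto dest!: eventually_happens'[OF trivial_limit_at_bot_linorder])
  then have "\<exists>y. class_cdf N k L l y < ennreal (class_rank L x)"
    using le by (auto simp: not_le[symmetric])
  moreover have "\<exists>y. class_rank L x \<le> ?F y"
    using order_tendstoD(1)[OF R.top r(2)]
    by (auto dest!: eventually_happens'[OF trivial_limit_at_top_linorder] intro: less_imp_le)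
  ultimately have "class_map N k L x = Inf {y. class_rank L x \<le> ?F y}"
    by (auto simp: class_map_def x le)
  then show ?thesis using R.pseudoinverse[OF r, of y] by simp
qed

text \<open>Up to the null set where the rank is extreme, \<open>class_map\<close> is the generalised inverse of the
  distribution function applied to a variable that is uniform by \<open>emeasure_rank_le\<close>.\<close>

lemma distr_class_map:
  assumes [measurable]: "class_map N k L \<in> borel_measurable borel"
  shows "distr (density lborel (\<lambda>x. indicator {l} (L x))) borel (class_map N k L) = class_image N k L l"
proof (rule cdf_unique')
  let ?F = "cdf (class_image N k L l)" and ?S = "class_map N k L" and ?M = "density lborel (\<lambda>x. indicator {l} (L x)) :: real measure"
  have em: "emeasure ?M A = emeasure lborel (cls l \<inter> A)" if [measurable]: "A \<in> sets borel" for A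
    unfolding indicator_cls by (subst emeasure_density) (auto simp: indicator_inter_arith[symmetric])
  show "finite_borel_measure (class_image N k L l)" by (rule finite_borel_class_image)
  show "finite_borel_measure (distr ?M borel ?S)"
  proof (intro finite_borel_measure.intro finite_measureI finite_borel_measure_axioms.intro)
    show "emeasure (distr ?M borel ?S) (space (distr ?M borel ?S)) \<noteq> \<infinity>"
      by (simp add: emeasure_distr em emeasure_cls)
  qed simp
  show "cdf (distr ?M borel ?S) = cdf (class_image N k L l)"
  proof
    fix y
    have le: "?F y \<le> measure lborel (cls l)"
      using finite_borel_measure.cdf_bounded[OF finite_borel_class_image, of l y]
        emeasure_class_image_UNIV[of l] sets_eq_imp_space_eq[OF sets_N]
      by (simp add: class_image_def measure_def)
    have "emeasure (distr ?M borel ?S) {..y} = emeasure lborel {x\<in>cls l. ?S x \<le> y}"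
    proof -
      have "?S -` {..y} \<in> sets borel" using measurable_sets[OF assms, of "{..y}"] by simp
      moreover have "cls l \<inter> ?S -` {..y} = {x\<in>cls l. ?S x \<le> y}" by auto
      ultimately show ?thesis by (simp add: emeasure_distr em)
    qed
    also have "\<dots> = emeasure lborel {x\<in>cls l. measure lborel (cls l \<inter> {..x}) \<le> ?F y}"
    proof (rule emeasure_eq_AE)
      show "AE x in lborel. x \<in> {x\<in>cls l. ?S x \<le> y} \<longleftrightarrow>
         x \<in> {x\<in>cls l. measure lborel (cls l \<inter> {..x}) \<le> ?F y}"
        using null_rank_extreme[OF cls_measurable cls_subset, of l]
      proof eventually_elim
        case (elim x)
        show ?case
        proof (cases "x \<in> cls l")
          case True
          then have "L x = l" by (simp add: cls_def)
          then show ?thesis using class_map_le_iff[of x l y] elim True by (simp add: class_rank_eq)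
        qed simp
      qed
      have "{x\<in>cls l. measure lborel (cls l \<inter> {..x}) \<le> ?F y} \<in> sets borel"
        using rank_measurable[OF cls_measurable, of l] by measurable
      then show "{x\<in>cls l. measure lborel (cls l \<inter> {..x}) \<le> ?F y} \<in> sets lborel" by simp
    qed measurable
    also have "\<dots> = ennreal (?F y)"
      by (rule emeasure_rank_le[OF cls_measurable cls_subset]) (use le in \<open>auto simp: cdf_def\<close>)
    finally show "cdf (distr ?M borel ?S) y = cdf (class_image N k L l) y"
      by (simp add: cdf_def[of "distr _ _ _"] measure_def) (simp add: cdf_def)
  qed
qed

lemma nn_integral_by_labels:
  assumes [measurable]: "f \<in> borel_measurable borel"
  shows "(\<integral>\<^sup>+x. f x \<partial>lborel) = (\<integral>\<^sup>+l. \<integral>\<^sup>+x. indicator {l} (L x) * f x \<partial>lborel \<partial>count_space (range L))"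
proof -
  have "(\<integral>\<^sup>+x. f x \<partial>lborel) = (\<integral>\<^sup>+x. \<integral>\<^sup>+l. indicator {l} (L x) * f x \<partial>count_space (range L) \<partial>lborel)"
  proof (rule nn_integral_cong)
    fix x
    have "(\<integral>\<^sup>+l. indicator {l} (L x) * f x \<partial>count_space (range L)) =
        (\<integral>\<^sup>+l. f x * indicator {L x} l \<partial>count_space (range L))"
      by (intro nn_integral_cong) (auto split: split_indicator)
    also have "\<dots> = f x" by (subst nn_integral_cmult_indicator) auto
    finally show "f x = (\<integral>\<^sup>+l. indicator {l} (L x) * f x \<partial>count_space (range L))" ..
  qed
  also have "\<dots> = (\<integral>\<^sup>+l. \<integral>\<^sup>+x. indicator {l} (L x) * f x \<partial>lborel \<partial>count_space (range L))"
    by (rule nn_integral_count_space_nn_integral[OF L_countable]) measurable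
  finally show ?thesis .
qed

text \<open>For integrands that see the starting point only through its label, the map is as good as the coupling. It
  gives both the image measure (\<open>g\<close> independent of the label) and the cost (\<open>g\<close> the distance to the label).\<close>

lemma nn_integral_class_map:
  assumes S [measurable]: "class_map N k L \<in> borel_measurable borel"
    and g [measurable]: "(\<lambda>(l, y). g l y) \<in> borel_measurable (borel \<Otimes>\<^sub>M borel)"
  shows "(\<integral>\<^sup>+x. g (L x) (class_map N k L x) \<partial>lborel) = (\<integral>\<^sup>+x. \<integral>\<^sup>+y. g (L x) y * k x y \<partial>N \<partial>lborel)"
proof -
  interpret N: sigma_finite_measure N by (rule sigma_finite_N)
  note [measurable (raw)] = measurable_uncurried[OF g]
  have "(\<integral>\<^sup>+x. g (L x) (class_map N k L x) \<partial>lborel) =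
    (\<integral>\<^sup>+l. \<integral>\<^sup>+x. indicator {l} (L x) * g (L x) (class_map N k L x) \<partial>lborel \<partial>count_space (range L))"
    by (rule nn_integral_by_labels) measurable
  also have "\<dots> = (\<integral>\<^sup>+l. \<integral>\<^sup>+x. indicator {l} (L x) * (\<integral>\<^sup>+y. g (L x) y * k x y \<partial>N) \<partial>lborel \<partial>count_space (range L))"
  proof (rule nn_integral_cong)
    fix l
    have [measurable]: "g l \<in> borel_measurable borel" by measurable
    have "(\<integral>\<^sup>+x. indicator {l} (L x) * g (L x) (class_map N k L x) \<partial>lborel) =
      (\<integral>\<^sup>+x. indicator {l} (L x) * g l (class_map N k L x) \<partial>lborel)"
      by (intro nn_integral_cong) (auto split: split_indicator)
    also have "\<dots> = (\<integral>\<^sup>+x. g l (class_map N k L x) \<partial>density lborel (\<lambda>x. indicator {l} (L x)))"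
      by (rule nn_integral_density[symmetric]) measurable
    also have "\<dots> = (\<integral>\<^sup>+y. g l y \<partial>class_image N k L l)"
      unfolding distr_class_map[OF S, symmetric] by (rule nn_integral_distr[symmetric]) measurable
    also have "\<dots> = (\<integral>\<^sup>+x. indicator {l} (L x) * (\<integral>\<^sup>+y. g l y * k x y \<partial>N) \<partial>lborel)"
      by (rule nn_integral_class_image) measurable
    also have "\<dots> = (\<integral>\<^sup>+x. indicator {l} (L x) * (\<integral>\<^sup>+y. g (L x) y * k x y \<partial>N) \<partial>lborel)"
      by (intro nn_integral_cong) (auto split: split_indicator)
    finally show "(\<integral>\<^sup>+x. indicator {l} (L x) * g (L x) (class_map N k L x) \<partial>lborel) = \<dots>" .
  qed
  also have "\<dots> = (\<integral>\<^sup>+x. \<integral>\<^sup>+y. g (L x) y * k x y \<partial>N \<partial>lborel)"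
    by (rule nn_integral_by_labels[symmetric]) measurable
  finally show ?thesis .
qed

end

lemma cInf_diff_const:
  fixes A :: "real set"
  assumes "A \<noteq> {}" "bdd_below A"
  shows "Inf ((\<lambda>y. y - t) ` A) = Inf A - t"
proof (rule antisym)
  obtain b where b: "\<And>x. x \<in> A \<Longrightarrow> b \<le> x" using assms(2) by (auto simp: bdd_below_def)
  have bdd: "bdd_below ((\<lambda>y. y - t) ` A)" by (rule bdd_belowI[of _ "b - t"]) (auto dest: b)
  show "Inf A - t \<le> Inf ((\<lambda>y. y - t) ` A)"
    using assms by (intro cInf_greatest) (auto intro: cInf_lower)
  have "Inf ((\<lambda>y. y - t) ` A) + t \<le> Inf A"
  proof (rule cInf_greatest[OF assms(1)])
    fix x assume "x \<in> A"
    then have "Inf ((\<lambda>y. y - t) ` A) \<le> x - t" by (intro cInf_lower bdd) auto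
    then show "Inf ((\<lambda>y. y - t) ` A) + t \<le> x" by simp
  qed
  then show "Inf ((\<lambda>y. y - t) ` A) \<le> Inf A - t" by simp
qed

lemma class_map_shift:
  assumes [measurable]: "L \<in> borel_measurable borel" "(\<lambda>(x, y). k x y) \<in> borel_measurable (borel \<Otimes>\<^sub>M borel)"
    and [measurable_cong]: "sets N = sets borel" and "sigma_finite_measure N"
    and N': "N' = distr N borel (\<lambda>y. y - t)" and k': "\<And>x y. k' x y = k (x + t) (y + t)"
    and L': "\<And>x. L' x = L (x + t) - t"
  shows "class_map N' k' L' x = class_map N k L (x + t) - t"
proof -
  note [measurable (raw)] = measurable_uncurried[OF assms(2)]
  interpret N: sigma_finite_measure N by fact
  have rank: "class_rank L' x = class_rank L (x + t)"
  proof -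
    let ?A = "{z. L z = L (x + t) \<and> z \<le> x + t}"
    have "emeasure lborel {z. L' z = L' x \<and> z \<le> x} = (\<integral>\<^sup>+z. indicator {z. L' z = L' x \<and> z \<le> x} z \<partial>lborel)"
      by (rule nn_integral_indicator[symmetric]) (simp add: L', measurable)
    also have "\<dots> = (\<integral>\<^sup>+z. indicator ?A (z + t) \<partial>lborel)"
      by (intro nn_integral_cong) (auto simp: L' split: split_indicator)
    also have "\<dots> = (\<integral>\<^sup>+z. indicator ?A z \<partial>lborel)" by (rule nn_integral_lborel_shift) measurable
    also have "\<dots> = emeasure lborel ?A" by (rule nn_integral_indicator) measurable
    finally show ?thesis by (simp add: class_rank_def measure_def)
  qed
  have cdf: "class_cdf N' k' L' l y = class_cdf N k L (l + t) (y + t)" for l y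
  proof -
    have inner: "(\<integral>\<^sup>+z. indicator {l} (L' z) * k' z w \<partial>lborel) = (\<integral>\<^sup>+z. indicator {l + t} (L z) * k z (w + t) \<partial>lborel)" for w
    proof -
      have "(\<integral>\<^sup>+z. indicator {l} (L' z) * k' z w \<partial>lborel) =
          (\<integral>\<^sup>+z. indicator {l + t} (L (z + t)) * k (z + t) (w + t) \<partial>lborel)"
        by (intro nn_integral_cong) (auto simp: L' k' split: split_indicator)
      also have "\<dots> = (\<integral>\<^sup>+z. indicator {l + t} (L z) * k z (w + t) \<partial>lborel)"
        by (rule nn_integral_lborel_shift) measurable
      finally show ?thesis .
    qed
    have "class_cdf N' k' L' l y =
        (\<integral>\<^sup>+w. indicator {..y} (w - t) * (\<integral>\<^sup>+z. indicator {l + t} (L z) * k z (w - t + t) \<partial>lborel) \<partial>N)"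
      unfolding class_cdf_def N' inner by (rule nn_integral_distr) measurable
    also have "\<dots> = class_cdf N k L (l + t) (y + t)"
      unfolding class_cdf_def by (intro nn_integral_cong) (auto split: split_indicator)
    finally show ?thesis .
  qed
  define r F where "r = ennreal (class_rank L (x + t))" and "F = class_cdf N k L (L (x + t))"
  have 1: "class_map N k L (x + t) = (if (\<exists>y. r \<le> F y) \<and> (\<exists>y. F y < r) then Inf {y. r \<le> F y} else x + t)"
    by (simp add: class_map_def r_def F_def)
  have 2: "class_map N' k' L' x = (if (\<exists>y. r \<le> F (y + t)) \<and> (\<exists>y. F (y + t) < r) then Inf {y. r \<le> F (y + t)} else x)"
    unfolding class_map_def rank cdf L' r_def F_def diff_add_cancel by (rule refl)
  have 3: "(\<exists>y. r \<le> F (y + t)) \<longleftrightarrow> (\<exists>y. r \<le> F y)" "(\<exists>y. F (y + t) < r) \<longleftrightarrow> (\<exists>y. F y < r)"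
    by (metis diff_add_cancel)+
  have 4: "{y. r \<le> F (y + t)} = (\<lambda>y. y - t) ` {y. r \<le> F y}"
    by (auto simp: image_iff intro!: exI[of _ "y + t" for y])
  have 5: "bdd_below {y. r \<le> F y}" if "F y0 < r" for y0
  proof (rule bdd_belowI)
    fix y assume "y \<in> {y. r \<le> F y}"
    then show "y0 \<le> y" using that class_cdf_mono[of y y0 N k L "L (x + t)"] unfolding F_def[symmetric]
      by (metis linorder_le_cases mem_Collect_eq not_le order_trans)
  qed
  have "Inf ((\<lambda>y. y - t) ` {y. r \<le> F y}) = Inf {y. r \<le> F y} - t" if "r \<le> F y1" "F y0 < r" for y0 y1
    using that by (intro cInf_diff_const 5) auto
  then show ?thesis unfolding 1 2 3 4 by auto
qed

text \<open>Monotonicity of the distribution function reduces the infimum to rational points. This gives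
  measurability in the realisation.\<close>

lemma class_map_less_iff:
  fixes x c :: real and N k L
  defines "r \<equiv> ennreal (class_rank L x)" and "F \<equiv> class_cdf N k L (L x)"
  shows "class_map N k L x < c \<longleftrightarrow>
    (if (\<exists>q::rat. r \<le> F (of_rat q)) \<and> (\<exists>q::rat. F (of_rat q) < r)
     then (\<exists>q::rat. of_rat q < c \<and> r \<le> F (of_rat q)) else x < c)"
proof -
  have mono: "F y \<le> F y'" if "y \<le> y'" for y y' unfolding F_def using that by (rule class_cdf_mono)
  have e1: "(\<exists>y. r \<le> F y) \<longleftrightarrow> (\<exists>q::rat. r \<le> F (of_rat q))"
  proof
    assume "\<exists>y. r \<le> F y"
    then obtain y where y: "r \<le> F y" ..
    obtain q :: rat where "y < of_rat q" using of_rat_dense[of y "y + 1"] by auto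
    then show "\<exists>q::rat. r \<le> F (of_rat q)" using y mono[of y "of_rat q"] by (auto intro: order_trans less_imp_le)
  qed auto
  have e2: "(\<exists>y. F y < r) \<longleftrightarrow> (\<exists>q::rat. F (of_rat q) < r)"
  proof
    assume "\<exists>y. F y < r"
    then obtain y where y: "F y < r" ..
    obtain q :: rat where "of_rat q < y" using of_rat_dense[of "y - 1" y] by auto
    then show "\<exists>q::rat. F (of_rat q) < r" using y mono[of "of_rat q" y] by (auto intro: le_less_trans less_imp_le)
  qed auto
  have e3: "Inf {y. r \<le> F y} < c \<longleftrightarrow> (\<exists>q::rat. of_rat q < c \<and> r \<le> F (of_rat q))"
    if "r \<le> F y1" "F y0 < r" for y0 y1
  proof -
    have "bdd_below {y. r \<le> F y}"
      using that mono by (intro bdd_belowI[of _ y0]) (metis linorder_le_cases mem_Collect_eq not_le order_trans)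
    then have "Inf {y. r \<le> F y} < c \<longleftrightarrow> (\<exists>y<c. r \<le> F y)"
      using that by (subst cInf_less_iff) auto
    also have "\<dots> \<longleftrightarrow> (\<exists>q::rat. of_rat q < c \<and> r \<le> F (of_rat q))"
    proof
      assume "\<exists>y<c. r \<le> F y"
      then obtain y where y: "y < c" "r \<le> F y" by auto
      then obtain q :: rat where "y < of_rat q" "of_rat q < c" using of_rat_dense[of y c] by auto
      then show "\<exists>q::rat. of_rat q < c \<and> r \<le> F (of_rat q)"
        using y mono[of y "of_rat q"] by (auto intro: order_trans less_imp_le)
    qed auto
    finally show ?thesis .
  qed
  have "class_map N k L x = (if (\<exists>y. r \<le> F y) \<and> (\<exists>y. F y < r) then Inf {y. r \<le> F y} else x)"
    by (simp add: class_map_def r_def F_def)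
  then show ?thesis using e3 unfolding e1 e2 by auto
qed

context locally_finite_invariant_measure
begin

lemma class_map_measurable:
  assumes L [measurable]: "(\<lambda>(\<omega>, x). L \<omega> x) \<in> borel_measurable (M \<Otimes>\<^sub>M borel)"
  shows "(\<lambda>(\<omega>, x). class_map (\<mu> \<omega>) (K \<omega>) (L \<omega>) x) \<in> borel_measurable (M \<Otimes>\<^sub>M borel)"
proof -
  note [measurable (raw)] = measurable_uncurried[OF L]
  let ?N = "M \<Otimes>\<^sub>M (borel :: real measure)"
  have rank [measurable]: "(\<lambda>w. class_rank (L (fst w)) (snd w)) \<in> borel_measurable ?N"
  proof -
    have "class_rank (L (fst w)) (snd w) =
      enn2real (\<integral>\<^sup>+z. (if L (fst w) z = L (fst w) (snd w) \<and> z \<le> snd w then 1 else 0) \<partial>lborel)"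
      if "w \<in> space ?N" for w
    proof -
      have [measurable]: "L (fst w) \<in> borel_measurable borel"
        using that by (intro measurable_uncurried[OF L, of "\<lambda>_. fst w" borel "\<lambda>x. x"]) (auto simp: space_pair_measure)
      have "emeasure lborel {z. L (fst w) z = L (fst w) (snd w) \<and> z \<le> snd w} =
          (\<integral>\<^sup>+z. indicator {z. L (fst w) z = L (fst w) (snd w) \<and> z \<le> snd w} z \<partial>lborel)"
        by (rule nn_integral_indicator[symmetric]) measurable
      also have "\<dots> = (\<integral>\<^sup>+z. (if L (fst w) z = L (fst w) (snd w) \<and> z \<le> snd w then 1 else 0) \<partial>lborel)"
        by (intro nn_integral_cong) (auto split: split_indicator)
      finally show ?thesis by (simp add: class_rank_def measure_def)
    qed
    moreover have "(\<lambda>w. enn2real (\<integral>\<^sup>+z. (if L (fst w) z = L (fst w) (snd w) \<and> z \<le> snd w then 1 else 0) \<partial>lborel))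
        \<in> borel_measurable ?N" by measurable
    ultimately show ?thesis by (simp cong: measurable_cong)
  qed
  have cdf [measurable]: "(\<lambda>w. class_cdf (\<mu> (fst w)) (K (fst w)) (L (fst w)) (L (fst w) (snd w)) y) \<in> borel_measurable ?N" for y
  proof -
    have eq: "class_cdf (\<mu> (fst w)) (K (fst w)) (L (fst w)) (L (fst w) (snd w)) y =
      (\<integral>\<^sup>+v. indicator {..y} v * (\<integral>\<^sup>+z. (if L (fst w) z = L (fst w) (snd w) then 1 else 0) * K (fst w) z v \<partial>lborel) \<partial>\<mu> (fst w))" for w
      unfolding class_cdf_def by (intro nn_integral_cong arg_cong2[where f="(*)"] refl) (auto split: split_indicator)
    show ?thesis unfolding eq by measurable
  qed
  have "(\<lambda>w. class_map (\<mu> (fst w)) (K (fst w)) (L (fst w)) (snd w)) \<in> borel_measurable ?N"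
  proof (rule borel_measurableI_less)
    fix c
    show "{w\<in>space ?N. class_map (\<mu> (fst w)) (K (fst w)) (L (fst w)) (snd w) < c} \<in> sets ?N"
      unfolding class_map_less_iff by measurable
  qed
  then show ?thesis by (simp add: split_beta')
qed

end

section \<open>Invariant labels\<close>

text \<open>If \<open>A\<close> is not visited from \<open>x\<close> on, then all visits precede \<open>x\<close>. The last one, more precisely the supremum,
  is as equivariant as the next one and takes its place.\<close>

definition next_hit :: "real set \<Rightarrow> real \<Rightarrow> real" where
  "next_hit A x = (if \<exists>s\<in>A. x \<le> s then Inf {s\<in>A. x \<le> s} else Sup A)"

text \<open>Sets of this kind are determined by their rational points, although they need not be open. Level sets of
  right-continuous functions given by strict inequalities are of this kind.\<close>

definition right_open :: "real set \<Rightarrow> bool" where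
  "right_open A \<longleftrightarrow> (\<forall>t\<in>A. \<exists>e>0. {t..<t + e} \<subseteq> A)"

lemma right_open_rat:
  assumes "right_open A" "t \<in> A" "t < u"
  obtains q :: rat where "of_rat q \<in> A" "t \<le> of_rat q" "of_rat q < u"
proof -
  obtain e where e: "0 < e" "{t..<t + e} \<subseteq> A" using assms by (auto simp: right_open_def)
  obtain q :: rat where "t < of_rat q" "of_rat q < min u (t + e)"
    using of_rat_dense[of t "min u (t + e)"] e assms by auto
  then show thesis using e that[of q] by (auto simp: subset_iff)
qed

lemma next_hit_shift:
  assumes "A \<noteq> {}" "A' = {s. s + t \<in> A}"
  shows "next_hit A' x = next_hit A (x + t) - t"
proof -
  have A': "A' = (\<lambda>s. s - t) ` A" using assms(2) by (auto simp: image_iff intro!: bexI[of _ "s + t" for s])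
  have ex: "(\<exists>s\<in>A'. x \<le> s) \<longleftrightarrow> (\<exists>s\<in>A. x + t \<le> s)" by (auto simp: A' algebra_simps)
  have im: "{s\<in>A'. x \<le> s} = (\<lambda>s. s - t) ` {s\<in>A. x + t \<le> s}" by (auto simp: A' algebra_simps)
  show ?thesis
  proof (cases "\<exists>s\<in>A. x + t \<le> s")
    case True
    then have "Inf {s\<in>A'. x \<le> s} = Inf {s\<in>A. x + t \<le> s} - t"
      unfolding im by (intro cInf_diff_const) (auto intro!: bdd_belowI[of _ "x + t"])
    then show ?thesis using True ex by (simp add: next_hit_def)
  next
    case False
    have "Sup A' = Sup A - t"
    proof -
      have "Sup A' = - Inf (uminus ` A')" by (simp add: Inf_real_def image_image)
      also have "uminus ` A' = (\<lambda>s. s - (- t)) ` (uminus ` A)" by (auto simp: A' image_image)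
      also have "Inf \<dots> = Inf (uminus ` A) - (- t)"
      proof (intro cInf_diff_const)
        show "bdd_below (uminus ` A)"
          using False by (intro bdd_belowI2[of _ "- (x + t)"]) (auto simp: not_le intro: less_imp_le)
      qed (use assms(1) in simp)
      finally show ?thesis by (simp add: Inf_real_def image_image)
    qed
    then show ?thesis using False ex by (simp add: next_hit_def)
  qed
qed

text \<open>A point of \<open>B\<close> is followed by a rational point of \<open>B\<close> before the next visit to \<open>A\<close>, and the two have the same
  next visit.\<close>

lemma countable_next_hit:
  assumes B: "right_open B" and disj: "A \<inter> B = {}"
  shows "countable (next_hit A ` B)"
proof (rule countable_subset)
  show "countable (insert (Sup A) (next_hit A ` \<rat>))" by (simp add: countable_rat)
  show "next_hit A ` B \<subseteq> insert (Sup A) (next_hit A ` \<rat>)"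
  proof safe
    fix x assume x: "x \<in> B" and no: "next_hit A x \<notin> next_hit A ` \<rat>"
    show "next_hit A x = Sup A"
    proof (rule ccontr)
      assume "next_hit A x \<noteq> Sup A"
      then have ex: "\<exists>s\<in>A. x \<le> s" by (auto simp: next_hit_def split: if_splits)
      obtain e where e: "0 < e" "{x..<x + e} \<subseteq> B" using B x by (auto simp: right_open_def)
      obtain q :: rat where q: "x < of_rat q" "of_rat q < x + e" using of_rat_dense[of x "x + e"] e by auto
      have "s \<ge> x + e" if "s \<in> A" "x \<le> s" for s
        using that e disj by (metis IntI atLeastLessThan_iff empty_iff not_le subsetD)
      then have "{s\<in>A. x \<le> s} = {s\<in>A. of_rat q \<le> s}" using q by force
      moreover from this ex have "\<exists>s\<in>A. of_rat q \<le> s" by blast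
      ultimately have "next_hit A x = next_hit A (of_rat q)" using ex by (simp add: next_hit_def)
      then show False using no by simp
    qed
  qed
qed

text \<open>Only countably many points are inspected, so that the event is measurable when \<open>A\<close> and \<open>x\<close> are random.\<close>

definition hits_before :: "real set \<Rightarrow> real \<Rightarrow> real \<Rightarrow> bool" where
  "hits_before A x c \<longleftrightarrow>
    (if \<exists>q::rat. x \<le> of_rat q \<and> of_rat q \<in> A
     then (\<exists>q::rat. x \<le> of_rat q \<and> of_rat q < c \<and> of_rat q \<in> A)
     else (\<exists>c'::rat. of_rat c' < c \<and> (\<forall>q>c'. (of_rat q::real) \<notin> A)))"

lemma next_hit_less_iff:
  assumes A: "right_open A" "A \<noteq> {}"
  shows "next_hit A x < c \<longleftrightarrow> hits_before A x c"
proof -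
  have e1: "(\<exists>s\<in>A. x \<le> s) \<longleftrightarrow> (\<exists>q::rat. x \<le> of_rat q \<and> of_rat q \<in> A)"
    using right_open_rat[OF A(1)] by (metis less_add_one order_trans)
  have e2: "Inf {s\<in>A. x \<le> s} < c \<longleftrightarrow> (\<exists>q::rat. x \<le> of_rat q \<and> of_rat q < c \<and> of_rat q \<in> A)"
    if "\<exists>s\<in>A. x \<le> s"
  proof -
    have "Inf {s\<in>A. x \<le> s} < c \<longleftrightarrow> (\<exists>s\<in>A. x \<le> s \<and> s < c)"
      using that by (subst cInf_less_iff) (auto intro!: bdd_belowI[of _ x])
    also have "\<dots> \<longleftrightarrow> (\<exists>q::rat. x \<le> of_rat q \<and> of_rat q < c \<and> of_rat q \<in> A)"
      using right_open_rat[OF A(1)] by (metis order_trans)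
    finally show ?thesis .
  qed
  have e3: "Sup A < c \<longleftrightarrow> (\<exists>c'::rat. of_rat c' < c \<and> (\<forall>q>c'. (of_rat q::real) \<notin> A))"
    if "\<not> (\<exists>s\<in>A. x \<le> s)"
  proof
    have bdd: "bdd_above A" using that by (intro bdd_aboveI[of _ x]) auto
    {
      assume "Sup A < c"
      then obtain c' :: rat where c': "Sup A < of_rat c'" "of_rat c' < c" using of_rat_dense by blast
      have "(of_rat q::real) \<notin> A" if "c' < q" for q
        using cSup_upper[OF _ bdd, of "of_rat q"] c' that of_rat_less[of c' q, where ?'a=real] by force
      then show "\<exists>c'::rat. of_rat c' < c \<and> (\<forall>q>c'. (of_rat q::real) \<notin> A)"
        using c' by blast
    next
      assume "\<exists>c'::rat. of_rat c' < c \<and> (\<forall>q>c'. (of_rat q::real) \<notin> A)"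
      then obtain c' :: rat where c': "of_rat c' < c" "\<And>q. c' < q \<Longrightarrow> (of_rat q::real) \<notin> A" by blast
      have "s \<le> of_rat c'" if "s \<in> A" for s
      proof (rule right_open_rat[OF A(1) that, of "s + 1"])
        fix q :: rat assume "of_rat q \<in> A" "s \<le> of_rat q"
        moreover from this have "q \<le> c'" using c'(2) by (metis not_le)
        then have "of_rat q \<le> (of_rat c' :: real)" by (simp add: of_rat_less_eq)
        ultimately show "s \<le> of_rat c'" by simp
      qed simp
      then have "Sup A \<le> of_rat c'" using A(2) by (intro cSup_least) auto
      then show "Sup A < c" using c' by simp
    }
  qed
  show ?thesis
    using e2 e3 unfolding next_hit_def hits_before_def e1 by auto
qed

text \<open>Near \<open>t\<close> the window mass is a difference of two values of the distribution function of a finite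
  restriction of \<open>N\<close>.\<close>

lemma window_right_continuous:
  fixes N :: "real measure"
  assumes [simp, measurable_cong]: "sets N = sets borel" and fin: "\<And>a b. emeasure N {a..<b} < \<infinity>" and r: "0 \<le> r"
  shows "((\<lambda>s. measure N {s<..s + r}) \<longlongrightarrow> measure N {t<..t + r}) (at_right t)"
proof -
  define \<nu> where "\<nu> = density N (indicator {t..<t + r + 2})"
  have em: "emeasure \<nu> A = emeasure N (A \<inter> {t..<t + r + 2})" if "A \<in> sets borel" for A
    unfolding \<nu>_def using that by (subst emeasure_density) (auto simp: indicator_inter_arith[symmetric] Int_commute)
  interpret \<nu>: finite_borel_measure \<nu>
  proof (intro finite_borel_measure.intro finite_measureI finite_borel_measure_axioms.intro)
    have "space N = UNIV" using sets_eq_imp_space_eq[OF assms(1)] by simp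
    then show "emeasure \<nu> (space \<nu>) \<noteq> \<infinity>" using em[of UNIV] fin[of t "t + r + 2"] by (simp add: \<nu>_def)
  qed (simp add: \<nu>_def)
  have eq: "measure N {s<..s + r} = cdf \<nu> (s + r) - cdf \<nu> s" if "t \<le> s" "s < t + 1" for s
  proof -
    have "{s<..s + r} \<inter> {t..<t + r + 2} = {s<..s + r}" using that by auto
    then have "measure N {s<..s + r} = measure \<nu> {s<..s + r}" using em[of "{s<..s + r}"] by (simp add: measure_def)
    also have "\<dots> = cdf \<nu> (s + r) - cdf \<nu> s"
    proof (cases "r = 0")
      case False
      then show ?thesis using \<nu>.cdf_diff_eq[of s "s + r"] r by simp
    qed simp
    finally show ?thesis .
  qed
  have c: "(cdf \<nu> \<longlongrightarrow> cdf \<nu> u) (at_right u)" for u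
    using \<nu>.cdf_is_right_cont[of u] by (simp add: continuous_within)
  have "((\<lambda>s. cdf \<nu> (s + r)) \<longlongrightarrow> cdf \<nu> (t + r)) (at_right t)"
    using c[of "t + r"] by (subst (asm) filterlim_at_right_to_0) (subst filterlim_at_right_to_0, simp add: add.assoc add.commute add.left_commute)
  then have lim: "((\<lambda>s. cdf \<nu> (s + r) - cdf \<nu> s) \<longlongrightarrow> measure N {t<..t + r}) (at_right t)"
    using c[of t] eq[of t] by (auto intro!: tendsto_diff)
  have "\<forall>\<^sub>F s in at_right t. cdf \<nu> (s + r) - cdf \<nu> s = measure N {s<..s + r}"
    using eventually_at_right_less[of t] eventually_at_right[of t "t + 1"]
    by (auto simp: eventually_at_right[of t "t + 1"] eq intro!: exI[of _ "t + 1"])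
  then show ?thesis using lim by (rule Lim_transform_eventually[rotated])
qed

context locally_finite_invariant_measure
begin

definition window :: "real \<Rightarrow> 'a \<Rightarrow> real \<Rightarrow> real" where
  "window r \<omega> t = measure (\<mu> \<omega>) {t<..t + r}"

lemma window_shift:
  assumes "\<omega> \<in> space M" shows "window r (\<theta> t \<omega>) s = window r \<omega> (s + t)"
proof -
  have "(\<lambda>y. y - t) -` {s<..s + r} = {s + t<..s + t + r}" by auto
  then show ?thesis unfolding window_def mu_shift[OF assms] by (simp add: measure_distr)
qed

lemma right_open_window:
  assumes "0 \<le> r" shows "right_open {t. window r \<omega> t < c}" "right_open {t. c < window r \<omega> t}"
proof -
  have lim: "(window r \<omega> \<longlongrightarrow> window r \<omega> t) (at_right t)" for t
    unfolding window_def[abs_def] by (rule window_right_continuous[OF sets_mu' locally_finite assms])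
  have ro: "\<exists>e>0. {t..<t + e} \<subseteq> {t. P t}" if "P t" and ev: "\<forall>\<^sub>F s in at_right t. P s" for P and t :: real
  proof -
    obtain b where b: "t < b" "\<And>y. t < y \<Longrightarrow> y < b \<Longrightarrow> P y"
      using ev unfolding eventually_at_right_field by blast
    have "{t..<t + (b - t)} \<subseteq> {t. P t}" using b \<open>P t\<close> by (auto simp: le_less)
    then show ?thesis using b(1) by (intro exI[of _ "b - t"]) auto
  qed
  show "right_open {t. window r \<omega> t < c}"
    unfolding right_open_def using order_tendstoD(2)[OF lim] by (auto intro!: ro)
  show "right_open {t. c < window r \<omega> t}"
    unfolding right_open_def using order_tendstoD(1)[OF lim] by (auto intro!: ro)
qed

text \<open>Two distinct levels \<open>c < d\<close> are used because they give two sets of the form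
  \<open>right_open\<close>, \<open>{window < d}\<close> and \<open>{window > c}\<close>, that cover the line. From a point of the first the anchor is the next
  point where the window mass exceeds \<open>d\<close>, and from the remaining points the next one where it is below
  \<open>c\<close>. If there is such a point, it lies strictly ahead of \<open>x\<close>, which leaves only countably many anchors.\<close>

definition separated :: "rat \<times> rat \<times> rat \<Rightarrow> 'a \<Rightarrow> bool" where
  "separated i \<omega> = (case i of (r, c, d) \<Rightarrow> 0 < r \<and> c < d \<and>
     (\<exists>t. window (of_rat r) \<omega> t < of_rat c) \<and> (\<exists>t. of_rat d < window (of_rat r) \<omega> t))"

definition anchor :: "rat \<times> rat \<times> rat \<Rightarrow> 'a \<Rightarrow> real \<Rightarrow> real" where
  "anchor i \<omega> x = (case i of (r, c, d) \<Rightarrow>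
     if window (of_rat r) \<omega> x < of_rat d then next_hit {t. of_rat d < window (of_rat r) \<omega> t} x
     else next_hit {t. window (of_rat r) \<omega> t < of_rat c} x)"

definition labelled :: "'a \<Rightarrow> bool" where
  "labelled \<omega> \<longleftrightarrow> (\<exists>n. separated (from_nat n) \<omega>)"

text \<open>The first separating triple in a fixed enumeration is the same along each orbit of the flow.\<close>

definition selected :: "'a \<Rightarrow> rat \<times> rat \<times> rat" where
  "selected \<omega> = from_nat (LEAST n. separated (from_nat n) \<omega>)"

text \<open>Moving the anchor by an integer into \<open>(x - 1, x]\<close> bounds the diameter of the classes and keeps the
  number of labels countable.\<close>

definition label :: "'a \<Rightarrow> real \<Rightarrow> real" where
  "label \<omega> x = (if labelled \<omega>
     then anchor (selected \<omega>) \<omega> x + of_int \<lfloor>x - anchor (selected \<omega>) \<omega> x\<rfloor> else x)"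

lemma window_measurable [measurable (raw)]:
  assumes [measurable]: "f \<in> borel_measurable N" "h \<in> N \<rightarrow>\<^sub>M M"
  shows "(\<lambda>w. window r (h w) (f w)) \<in> borel_measurable N"
  unfolding window_def by measurable

lemma separated_shift: "\<omega> \<in> space M \<Longrightarrow> separated i (\<theta> t \<omega>) = separated i \<omega>"
  unfolding separated_def by (auto simp: window_shift split: prod.splits) (metis diff_add_cancel)+

lemma labelled_shift: "\<omega> \<in> space M \<Longrightarrow> labelled (\<theta> t \<omega>) = labelled \<omega>"
  and selected_shift: "\<omega> \<in> space M \<Longrightarrow> selected (\<theta> t \<omega>) = selected \<omega>"
  by (simp_all add: labelled_def selected_def separated_shift)

lemma separated_selected: "labelled \<omega> \<Longrightarrow> separated (selected \<omega>) \<omega>"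
  unfolding labelled_def selected_def by (rule LeastI_ex)

lemma anchor_shift:
  assumes \<omega>: "\<omega> \<in> space M" and s: "separated i \<omega>"
  shows "anchor i (\<theta> t \<omega>) x = anchor i \<omega> (x + t) - t"
proof -
  obtain r c d where i: "i = (r, c, d)" by (cases i)
  have "next_hit {s. of_rat d < window (of_rat r) (\<theta> t \<omega>) s} x = next_hit {s. of_rat d < window (of_rat r) \<omega> s} (x + t) - t"
    by (rule next_hit_shift) (use s i \<omega> in \<open>auto simp: separated_def window_shift\<close>)
  moreover have "next_hit {s. window (of_rat r) (\<theta> t \<omega>) s < of_rat c} x = next_hit {s. window (of_rat r) \<omega> s < of_rat c} (x + t) - t"
    by (rule next_hit_shift) (use s i \<omega> in \<open>auto simp: separated_def window_shift\<close>)
  ultimately show ?thesis by (simp add: anchor_def i window_shift[OF \<omega>])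
qed

lemma label_shift: "\<omega> \<in> space M \<Longrightarrow> labelled \<omega> \<Longrightarrow> label (\<theta> t \<omega>) x = label \<omega> (x + t) - t"
  using separated_selected[of \<omega>]
  by (simp add: label_def labelled_shift selected_shift anchor_shift algebra_simps)

lemma label_near: "\<bar>label \<omega> x - x\<bar> \<le> 1"
  unfolding label_def by (simp add: abs_le_iff) linarith

lemma label_countable:
  assumes "labelled \<omega>" shows "countable (range (label \<omega>))"
proof -
  obtain r c d where i: "selected \<omega> = (r, c, d)" by (cases "selected \<omega>")
  let ?w = "window (of_rat r) \<omega>"
  have s: "0 < r" "c < d" using separated_selected[OF assms] by (simp_all add: i separated_def)
  then have r: "0 \<le> (of_rat r :: real)" and cd: "of_rat c < (of_rat d :: real)" by (simp_all add: of_rat_less)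
  have sub: "range (anchor (selected \<omega>) \<omega>) \<subseteq>
      next_hit {t. of_rat d < ?w t} ` {t. ?w t < of_rat d} \<union> next_hit {t. ?w t < of_rat c} ` {t. of_rat c < ?w t}"
    using cd by (auto simp: anchor_def i)
  have "countable (range (anchor (selected \<omega>) \<omega>))"
    by (rule countable_subset[OF sub])
      (auto intro!: countable_next_hit right_open_window r)
  moreover have "countable (UNIV :: int set)" by (rule countableI_type)
  ultimately have "countable ((\<lambda>(v, n). v + of_int n) ` (range (anchor (selected \<omega>) \<omega>) \<times> (UNIV :: int set)))"
    by (rule countable_image[OF countable_SIGMA])
  moreover have "range (label \<omega>) \<subseteq> (\<lambda>(v, n). v + of_int n) ` (range (anchor (selected \<omega>) \<omega>) \<times> (UNIV :: int set))"
    using assms by (auto simp: label_def image_iff)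
  ultimately show ?thesis by (rule countable_subset[rotated])
qed

lemma separated_rat:
  "separated (r, c, d) \<omega> \<longleftrightarrow> 0 < r \<and> c < d \<and>
     (\<exists>t::rat. window (of_rat r) \<omega> (of_rat t) < of_rat c) \<and> (\<exists>t::rat. of_rat d < window (of_rat r) \<omega> (of_rat t))"
proof (cases "0 < r")
  case True
  then have r: "0 \<le> (of_rat r :: real)" by simp
  have *: "(\<exists>t. t \<in> A) \<longleftrightarrow> (\<exists>t::rat. (of_rat t :: real) \<in> A)" if "right_open A" for A
    using right_open_rat[OF that] by (metis less_add_one)
  show ?thesis
    using *[OF right_open_window(1)[OF r]] *[OF right_open_window(2)[OF r]] by (simp add: separated_def)
qed (simp add: separated_def)

lemma separated_measurable [measurable]: "Measurable.pred M (separated i)"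
proof -
  obtain r c d where i: "i = (r, c, d)" by (cases i)
  show ?thesis unfolding i separated_rat[abs_def] by measurable
qed

lemma labelled_measurable [measurable]: "Measurable.pred M labelled"
  unfolding labelled_def[abs_def] by measurable

lemma anchor_measurable:
  "(\<lambda>w. if separated i (fst w) then anchor i (fst w) (snd w) else snd w) \<in> borel_measurable (M \<Otimes>\<^sub>M borel)"
proof (rule borel_measurableI_less)
  fix a :: real
  obtain r c d where i: "i = (r, c, d)" by (cases i)
  let ?N = "M \<Otimes>\<^sub>M (borel :: real measure)"
  let ?w = "\<lambda>w. window (of_rat r) (fst w)"
  let ?A = "\<lambda>w. {t. of_rat d < ?w w t}" and ?B = "\<lambda>w. {t. ?w w t < of_rat c}"
  have iff: "next_hit (?A w) (snd w) < a \<longleftrightarrow> hits_before (?A w) (snd w) a"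
    "next_hit (?B w) (snd w) < a \<longleftrightarrow> hits_before (?B w) (snd w) a" if "separated i (fst w)" for w
  proof -
    have "0 \<le> (of_rat r :: real)" "?A w \<noteq> {}" "?B w \<noteq> {}"
      using that by (auto simp: i separated_def)
    then show "next_hit (?A w) (snd w) < a \<longleftrightarrow> hits_before (?A w) (snd w) a"
      "next_hit (?B w) (snd w) < a \<longleftrightarrow> hits_before (?B w) (snd w) a"
      by (auto intro!: next_hit_less_iff right_open_window simp del: Collect_empty_eq)
  qed
  have "((if separated i (fst w) then anchor i (fst w) (snd w) else snd w) < a) \<longleftrightarrow>
     (if separated i (fst w) then
       (if ?w w (snd w) < of_rat d then hits_before (?A w) (snd w) a else hits_before (?B w) (snd w) a)
      else snd w < a)" for w
    using iff[of w] by (simp add: anchor_def i)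
  moreover have "{w\<in>space ?N. if separated i (fst w) then
       (if ?w w (snd w) < of_rat d then hits_before (?A w) (snd w) a else hits_before (?B w) (snd w) a)
      else snd w < a} \<in> sets ?N"
    unfolding hits_before_def mem_Collect_eq by measurable
  ultimately show "{w\<in>space ?N. (if separated i (fst w) then anchor i (fst w) (snd w) else snd w) < a} \<in> sets ?N"
    by simp
qed

lemma label_measurable: "(\<lambda>(\<omega>, x). label \<omega> x) \<in> borel_measurable (M \<Otimes>\<^sub>M borel)"
proof -
  let ?N = "M \<Otimes>\<^sub>M (borel :: real measure)"
  let ?n = "\<lambda>w. LEAST n. separated (from_nat n) (fst w)"
  have n: "?n \<in> ?N \<rightarrow>\<^sub>M count_space UNIV" by measurable
  have [measurable]: "(\<lambda>w. (\<lambda>n w. if separated (from_nat n) (fst w) then anchor (from_nat n) (fst w) (snd w) else snd w) (?n w) w)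
      \<in> borel_measurable ?N"
    by (rule measurable_compose_countable[OF anchor_measurable n])
  have eq: "label (fst w) (snd w) = (if labelled (fst w) then
      (if separated (from_nat (?n w)) (fst w) then anchor (from_nat (?n w)) (fst w) (snd w) else snd w) +
      of_int \<lfloor>snd w - (if separated (from_nat (?n w)) (fst w) then anchor (from_nat (?n w)) (fst w) (snd w) else snd w)\<rfloor>
      else snd w)" for w
    using separated_selected[of "fst w"] by (simp add: label_def selected_def)
  have "(\<lambda>w. label (fst w) (snd w)) \<in> borel_measurable ?N" unfolding eq by measurable
  then show ?thesis by (simp add: split_beta')
qed

lemma locally_finite_Ioc: "emeasure (\<mu> \<omega>) {a<..b} < \<infinity>"
  by (rule le_less_trans[OF emeasure_mono locally_finite[of \<omega> a "b + 1"]]) auto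

lemma window_add: "0 \<le> r \<Longrightarrow> 0 \<le> s \<Longrightarrow> window (r + s) \<omega> t = window r \<omega> t + window s \<omega> (t + r)"
proof -
  assume "0 \<le> r" "0 \<le> s"
  then have "{t<..t + (r + s)} = {t<..t + r} \<union> {t + r<..t + r + s}" by auto
  then show ?thesis
    unfolding window_def using locally_finite_Ioc[of \<omega>] by (simp add: measure_Union less_top[symmetric])
qed

lemma unlabelled_window_const:
  assumes "\<not> labelled \<omega>" and r: "0 < r"
  shows "window (of_rat r) \<omega> t = window (of_rat r) \<omega> s"
proof (rule ccontr)
  have *: False if less: "window (of_rat r) \<omega> t < window (of_rat r) \<omega> s" for t s
  proof -
    obtain d :: rat where d: "window (of_rat r) \<omega> t < of_rat d" "of_rat d < window (of_rat r) \<omega> s"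
      using of_rat_dense[OF less] by blast
    obtain c :: rat where c: "window (of_rat r) \<omega> t < of_rat c" "of_rat c < (of_rat d :: real)"
      using of_rat_dense[OF d(1)] by blast
    have "separated (from_nat (to_nat (r, c, d))) \<omega>"
      using c d r by (auto simp: separated_def of_rat_less)
    then show False using assms(1) unfolding labelled_def by blast
  qed
  assume "window (of_rat r) \<omega> t \<noteq> window (of_rat r) \<omega> s"
  then show False using *[of t s] *[of s t] by linarith
qed

text \<open>Without separating levels all windows of a given rational length have the same mass. Additivity
  makes it proportional to the length, first for rational lengths and then, by monotonicity, for all.\<close>

lemma unlabelled_window:
  assumes unl: "\<not> labelled \<omega>" and r: "0 \<le> r"
  shows "window r \<omega> t = window 1 \<omega> 0 * r"
proof -
  define c where "c = window 1 \<omega> 0"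
  have "0 \<le> c" by (simp add: c_def window_def)
  have mult: "window (real k * of_rat q) \<omega> t = real k * window (of_rat q) \<omega> 0" if "0 < q" for k q t
  proof (induction k arbitrary: t)
    case 0
    show ?case by (simp add: window_def)
  next
    case (Suc k)
    have "window (real (Suc k) * of_rat q) \<omega> t = window (real k * of_rat q + of_rat q) \<omega> t"
      by (simp add: algebra_simps)
    also have "\<dots> = window (real k * of_rat q) \<omega> t + window (of_rat q) \<omega> (t + real k * of_rat q)"
      using that by (intro window_add) auto
    also have "window (of_rat q) \<omega> (t + real k * of_rat q) = window (of_rat q) \<omega> 0"
      by (rule unlabelled_window_const[OF unl that])
    finally show ?case using Suc by (simp add: algebra_simps)
  qed
  have frac: "window (real k / real n) \<omega> t = c * (real k / real n)" if n: "0 < n" for k n t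
  proof -
    let ?q = "1 / of_nat n :: rat"
    have q: "0 < ?q" "of_rat ?q = 1 / real n" using n by (simp_all add: of_rat_divide)
    have "c = real n * window (1 / real n) \<omega> 0"
      using mult[OF q(1), of n 0, unfolded q(2)] n by (simp add: c_def)
    then have "window (1 / real n) \<omega> 0 = c / real n" using n by simp
    then show ?thesis using mult[OF q(1), of k t, unfolded q(2)] by simp
  qed
  have mono: "window r \<omega> t \<le> window s \<omega> t" if "0 \<le> r" "r \<le> s" for r s
    using window_add[of r "s - r" \<omega> t] that by (simp add: window_def)
  have bound: "\<bar>window r \<omega> t - c * r\<bar> \<le> c / real n" if n: "0 < n" for n :: nat
  proof -
    define k where "k = nat \<lfloor>real n * r\<rfloor>"
    have k: "real k \<le> real n * r" "real n * r \<le> real k + 1"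
      using r n by (auto simp: k_def)
    have lo: "real k / real n \<le> r" "r \<le> real (Suc k) / real n" using k n by (auto simp: field_simps)
    have "c * (real k / real n) \<le> window r \<omega> t" "window r \<omega> t \<le> c * (real (Suc k) / real n)"
      using mono[of "real k / real n" r] mono[of r "real (Suc k) / real n"] frac[OF n, of k t] frac[OF n, of "Suc k" t] lo r
      by (simp_all del: of_nat_Suc)
    moreover have "c * (real k / real n) \<le> c * r" "c * r \<le> c * (real (Suc k) / real n)"
      using lo \<open>0 \<le> c\<close> mult_left_mono by blast+
    moreover have "c * (real (Suc k) / real n) = c * (real k / real n) + c / real n"
      using n by (simp add: field_simps)
    ultimately show ?thesis by linarith
  qed
  have "(\<lambda>n. c / real n) \<longlonglongrightarrow> 0" by (rule lim_const_over_n)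
  then have "\<bar>window r \<omega> t - c * r\<bar> \<le> 0"
    by (rule tendsto_lowerbound) (auto intro!: eventually_sequentiallyI[of 1] bound)
  then show ?thesis by (simp add: c_def)
qed

lemma unlabelled_mu:
  assumes "\<not> labelled \<omega>"
  shows "\<mu> \<omega> = density lborel (\<lambda>_. ennreal (window 1 \<omega> 0))" (is "_ = ?D")
proof (rule measure_eqI_generator_eq[where \<Omega>=UNIV])
  let ?E = "range (\<lambda>(a, b). {a<..b::real})"
  have eq: "emeasure (\<mu> \<omega>) {a<..b} = emeasure ?D {a<..b}" for a b
  proof (cases "a \<le> b")
    case True
    have "emeasure (\<mu> \<omega>) {a<..b} = ennreal (window (b - a) \<omega> a)"
      using locally_finite_Ioc[of \<omega> a b] by (simp add: window_def emeasure_eq_ennreal_measure)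
    also have "\<dots> = ennreal (window 1 \<omega> 0) * ennreal (b - a)"
    proof -
      have "window (b - a) \<omega> a = window 1 \<omega> 0 * (b - a)" using True by (intro unlabelled_window[OF assms]) simp
      moreover have "0 \<le> window 1 \<omega> 0" by (simp add: window_def)
      ultimately show ?thesis using True by (simp add: ennreal_mult)
    qed
    finally show ?thesis using True by (simp add: emeasure_density nn_integral_cmult_indicator)
  qed simp
  show "Int_stable ?E" by (auto simp: Int_stable_def)
  show "?E \<subseteq> Pow UNIV" by auto
  show "emeasure (\<mu> \<omega>) X = emeasure ?D X" if "X \<in> ?E" for X using that eq by auto
  show "sets (\<mu> \<omega>) = sigma_sets UNIV ?E" by (simp add: borel_sigma_sets_Ioc)
  show "sets ?D = sigma_sets UNIV ?E" by (simp add: borel_sigma_sets_Ioc)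
  show "range (\<lambda>i::nat. {- real i<..real i}) \<subseteq> ?E" by auto
  show "(\<Union>i. {- real i<..real i}) = UNIV"
    by (rule UN_Ioc_eq_UNIV)
  show "emeasure (\<mu> \<omega>) {- real i<..real i} \<noteq> \<infinity>" for i
    using locally_finite_Ioc[of \<omega> "- real i" "real i"] by simp
qed

text \<open>If \<open>\<mu> = c \<lambda>\<close>, the kernel depends on \<open>x - y\<close> only, so its row and column integrals with respect to
  \<open>\<lambda>\<close> coincide. The former is \<open>1/c\<close> and the latter at most \<open>1\<close>.\<close>

lemma unlabelled_lborel_le:
  assumes \<omega>: "\<omega> \<in> space M" and unl: "\<not> labelled \<omega>" and row: "(\<integral>\<^sup>+y. K \<omega> x y \<partial>\<mu> \<omega>) = 1"
    and A [measurable]: "A \<in> sets borel"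
  shows "emeasure lborel A \<le> emeasure (\<mu> \<omega>) A"
proof -
  define c where "c = ennreal (window 1 \<omega> 0)"
  have mu: "\<mu> \<omega> = density lborel (\<lambda>_. c)" unfolding c_def by (rule unlabelled_mu[OF unl])
  have m: "measure (\<mu> \<omega>) {a..<a + 2 ^ j} = measure (\<mu> \<omega>) {a + t..<a + t + 2 ^ j}" for a t :: real and j :: nat
    unfolding mu measure_def by (simp add: emeasure_density nn_integral_cmult_indicator)
  have shift: "K \<omega> x y = K \<omega> (x + t) (y + t)" for x y t
  proof (rule match_kernel_shift)
    show "excess_mass \<omega> j a = excess_mass \<omega> j (a + t)" for j a
      using m[of a j t] by (simp only: excess_mass_def)
  qed (rule excess_mass_measurable'[OF \<omega>])
  note [measurable (raw)] = K_measurable_at[OF \<omega>]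
  have "1 = c * (\<integral>\<^sup>+y. K \<omega> x y \<partial>lborel)"
    unfolding row[symmetric] mu by (subst nn_integral_density) (simp_all add: nn_integral_cmult)
  also have "(\<integral>\<^sup>+y. K \<omega> x y \<partial>lborel) = (\<integral>\<^sup>+y. K \<omega> (x - y) 0 \<partial>lborel)"
  proof (rule nn_integral_cong)
    fix y show "K \<omega> x y = K \<omega> (x - y) 0" using shift[of x y "- y"] by simp
  qed
  also have "\<dots> = (\<integral>\<^sup>+z. K \<omega> z 0 \<partial>lborel)"
    using nn_integral_real_affine[of "\<lambda>z. K \<omega> z 0" "-1" x] by simp
  also have "c * \<dots> \<le> c * 1" by (intro mult_left_mono K_column \<omega>) simp
  finally have "1 \<le> c" by simp
  then have "1 * emeasure lborel A \<le> c * emeasure lborel A" by (intro mult_right_mono) auto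
  also have "\<dots> = emeasure (\<mu> \<omega>) A" unfolding mu by (simp add: emeasure_density nn_integral_cmult_indicator)
  finally show ?thesis by simp
qed

end

section \<open>The invariant transport map\<close>

lemma powr_add_le_add_powr:
  fixes a b q :: real
  assumes "0 \<le> a" "0 \<le> b" "0 < q" "q \<le> 1"
  shows "(a + b) powr q \<le> a powr q + b powr q"
proof (cases "a + b = 0")
  case False
  then have s: "0 < a + b" using assms by simp
  have *: "c / (a + b) \<le> (c / (a + b)) powr q" if "0 \<le> c" "c \<le> a + b" for c
  proof (cases "c = 0")
    case False
    then have "(c / (a + b)) powr 1 \<le> (c / (a + b)) powr q"
      using that s assms by (intro powr_mono') auto
    then show ?thesis using that s False by simp
  qed simp
  have "1 = a / (a + b) + b / (a + b)" using s by (simp add: add_divide_distrib[symmetric])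
  also have "\<dots> \<le> (a / (a + b)) powr q + (b / (a + b)) powr q"
    using assms by (intro add_mono *) auto
  also have "\<dots> = (a powr q + b powr q) / (a + b) powr q"
    using assms s by (simp add: powr_divide add_divide_distrib)
  finally show ?thesis using s by (simp add: field_simps)
qed (use assms in auto)

text \<open>Equality of total masses on a bounded interval forces equality on its subsets, because the
  inequality also holds for their complements.\<close>

lemma measure_eq_of_le_of_eq_intervals:
  fixes \<nu> N :: "real measure"
  assumes [simp]: "sets \<nu> = sets borel" "sets N = sets borel"
    and le: "\<And>A. A \<in> sets borel \<Longrightarrow> emeasure \<nu> A \<le> emeasure N A"
    and eq: "\<And>n::nat. emeasure \<nu> {- real n..<real n} = emeasure N {- real n..<real n}"
    and fin: "\<And>n::nat. emeasure N {- real n..<real n} < \<infinity>"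
  shows "\<nu> = N"
proof (rule measure_eqI)
  fix A assume "A \<in> sets \<nu>"
  then have A: "A \<in> sets borel" by simp
  let ?J = "\<lambda>n::nat. {- real n..<real n}"
  have J: "emeasure \<nu> (A \<inter> ?J n) = emeasure N (A \<inter> ?J n)" for n
  proof (rule antisym[OF le])
    have split: "emeasure P (?J n) = emeasure P (A \<inter> ?J n) + emeasure P (?J n - A)" if "sets P = sets borel" for P
      using A that by (subst plus_emeasure) (auto intro!: arg_cong[where f="emeasure P"])
    have "emeasure N (A \<inter> ?J n) + emeasure N (?J n - A) = emeasure \<nu> (A \<inter> ?J n) + emeasure \<nu> (?J n - A)"
      using split[of N] split[of \<nu>] eq[of n] by simp
    also have "\<dots> \<le> emeasure \<nu> (A \<inter> ?J n) + emeasure N (?J n - A)"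
      using A by (intro add_left_mono le) auto
    finally have "emeasure N (?J n - A) + emeasure N (A \<inter> ?J n) \<le> emeasure N (?J n - A) + emeasure \<nu> (A \<inter> ?J n)"
      by (simp add: add.commute)
    moreover have "emeasure N (?J n - A) \<noteq> \<infinity>"
      using le_less_trans[OF emeasure_mono[of "?J n - A" "?J n" N] fin[of n]] by auto
    ultimately show "emeasure N (A \<inter> ?J n) \<le> emeasure \<nu> (A \<inter> ?J n)"
      by (simp add: ennreal_add_left_cancel_le)
  qed (use A in auto)
  have U: "(\<Union>n. A \<inter> ?J n) = A"
  proof -
    have "\<exists>n::nat. - real n \<le> x \<and> x < real n" for x :: real
    proof -
      obtain n :: nat where "\<bar>x\<bar> < real n" using reals_Archimedean2 by blast
      then show ?thesis by (intro exI[of _ n]) auto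
    qed
    then show ?thesis by auto
  qed
  have lim: "(SUP n. emeasure P (A \<inter> ?J n)) = emeasure P A" if "sets P = sets borel" for P
  proof -
    have "range (\<lambda>n. A \<inter> ?J n) \<subseteq> sets P" using A that by (intro image_subsetI) simp
    moreover have "incseq (\<lambda>n. A \<inter> ?J n)" unfolding incseq_def by auto
    ultimately show ?thesis using SUP_emeasure_incseq[of "\<lambda>n. A \<inter> ?J n" P] unfolding U by blast
  qed
  show "emeasure \<nu> A = emeasure N A"
    using lim[of \<nu>] lim[of N] J by simp
qed simp

context locally_finite_invariant_measure
begin

definition transport :: "'a \<Rightarrow> real \<Rightarrow> real" where
  "transport \<omega> x = (if labelled \<omega> then class_map (\<mu> \<omega>) (K \<omega>) (label \<omega>) x else x)"

lemmas label_measurable_pair [measurable (raw)] = measurable_uncurried[OF label_measurable]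

lemma label_measurable' [measurable]: "\<omega> \<in> space M \<Longrightarrow> label \<omega> \<in> borel_measurable borel"
  using label_measurable_pair[of "\<lambda>_. \<omega>" borel "\<lambda>x. x"] by simp

lemma K_measurable' [measurable]: "\<omega> \<in> space M \<Longrightarrow> (\<lambda>(x, y). K \<omega> x y) \<in> borel_measurable (borel \<Otimes>\<^sub>M borel)"
  using K_measurable_at[of \<omega> fst "borel \<Otimes>\<^sub>M borel" snd] by (simp add: split_beta')

lemma transport_measurable: "(\<lambda>(\<omega>, x). transport \<omega> x) \<in> borel_measurable (M \<Otimes>\<^sub>M borel)"
proof -
  have [measurable]: "(\<lambda>w. class_map (\<mu> (fst w)) (K (fst w)) (label (fst w)) (snd w)) \<in> borel_measurable (M \<Otimes>\<^sub>M borel)"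
    using class_map_measurable[OF label_measurable] by (simp add: split_beta')
  have "(\<lambda>w. transport (fst w) (snd w)) \<in> borel_measurable (M \<Otimes>\<^sub>M borel)"
    unfolding transport_def by measurable
  then show ?thesis by (simp add: split_beta')
qed

lemma transport_shift:
  assumes \<omega>: "\<omega> \<in> space M"
  shows "transport (\<theta> t \<omega>) (s - t) = transport \<omega> s - t"
proof (cases "labelled \<omega>")
  case True
  have "class_map (\<mu> (\<theta> t \<omega>)) (K (\<theta> t \<omega>)) (label (\<theta> t \<omega>)) (s - t) = class_map (\<mu> \<omega>) (K \<omega>) (label \<omega>) (s - t + t) - t"
    by (rule class_map_shift)
      (auto intro: K_measurable' label_measurable' sigma_finite_mu mu_shift K_shift label_shift \<omega> True)
  then show ?thesis using True by (simp add: transport_def labelled_shift \<omega>)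
qed (simp add: transport_def labelled_shift \<omega>)

lemma transport_invariant: "invariant_transport_map M \<theta> transport"
  unfolding invariant_transport_map_def using transport_measurable transport_shift by blast

lemma transport_measurable' [measurable]: "\<omega> \<in> space M \<Longrightarrow> transport \<omega> \<in> borel_measurable borel"
  using transport_map_measurable_pair[OF transport_invariant, of "\<lambda>_. \<omega>" borel "\<lambda>x. x"] by simp

lemma nn_integral_transport:
  assumes \<omega>: "\<omega> \<in> space M" and lab: "labelled \<omega>" and row: "AE x in lborel. (\<integral>\<^sup>+y. K \<omega> x y \<partial>\<mu> \<omega>) = 1"
    and g: "(\<lambda>(l, y). g l y) \<in> borel_measurable (borel \<Otimes>\<^sub>M borel)"
  shows "(\<integral>\<^sup>+x. g (label \<omega> x) (transport \<omega> x) \<partial>lborel) = (\<integral>\<^sup>+x. \<integral>\<^sup>+y. g (label \<omega> x) y * K \<omega> x y \<partial>\<mu> \<omega> \<partial>lborel)"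
proof -
  interpret labelled_kernel "\<mu> \<omega>" "K \<omega>" "label \<omega>"
    by (intro labelled_kernel.intro sets_mu' sigma_finite_mu[OF \<omega>] K_measurable'[OF \<omega>] row
      label_measurable'[OF \<omega>] label_near label_countable[OF lab])
  have eq: "transport \<omega> = class_map (\<mu> \<omega>) (K \<omega>) (label \<omega>)"
    using lab by (simp add: transport_def fun_eq_iff)
  show ?thesis
    using nn_integral_class_map[OF _ g] transport_measurable'[OF \<omega>] by (simp add: eq)
qed

lemma transport_image_le:
  assumes \<omega>: "\<omega> \<in> space M" and row: "AE x in lborel. (\<integral>\<^sup>+y. K \<omega> x y \<partial>\<mu> \<omega>) = 1"
    and A [measurable]: "A \<in> sets borel"
  shows "emeasure (distr lborel borel (transport \<omega>)) A \<le> emeasure (\<mu> \<omega>) A"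
proof (cases "labelled \<omega>")
  case True
  note [measurable] = transport_measurable'[OF \<omega>] K_measurable'[OF \<omega>]
  note [measurable (raw)] = K_measurable_at[OF \<omega>]
  interpret N: sigma_finite_measure "\<mu> \<omega>" using \<omega> by (rule sigma_finite_mu)
  interpret pair_sigma_finite lborel "\<mu> \<omega>" ..
  have "emeasure (distr lborel borel (transport \<omega>)) A = (\<integral>\<^sup>+x. indicator A (transport \<omega> x) \<partial>lborel)"
    using nn_integral_distr[of "transport \<omega>" lborel borel "indicator A"] by simp
  also have "\<dots> = (\<integral>\<^sup>+x. \<integral>\<^sup>+y. indicator A y * K \<omega> x y \<partial>\<mu> \<omega> \<partial>lborel)"
    by (rule nn_integral_transport[OF \<omega> True row, of "\<lambda>_. indicator A"]) measurable
  also have "\<dots> = (\<integral>\<^sup>+y. \<integral>\<^sup>+x. indicator A y * K \<omega> x y \<partial>lborel \<partial>\<mu> \<omega>)"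
    by (rule Fubini'[symmetric]) measurable
  also have "\<dots> = (\<integral>\<^sup>+y. indicator A y * (\<integral>\<^sup>+x. K \<omega> x y \<partial>lborel) \<partial>\<mu> \<omega>)"
    by (intro nn_integral_cong nn_integral_cmult) measurable
  also have "\<dots> \<le> (\<integral>\<^sup>+y. indicator A y * 1 \<partial>\<mu> \<omega>)"
    by (intro nn_integral_mono mult_left_mono K_column \<omega>) simp
  also have "\<dots> = emeasure (\<mu> \<omega>) A" by simp
  finally show ?thesis .
next
  case False
  have "\<exists>x. (\<integral>\<^sup>+y. K \<omega> x y \<partial>\<mu> \<omega>) = 1"
  proof (rule ccontr)
    assume "\<nexists>x. (\<integral>\<^sup>+y. K \<omega> x y \<partial>\<mu> \<omega>) = 1"
    then have "AE x in (lborel :: real measure). False" using row by simp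
    then show False by (simp add: AE_iff_null null_sets_def)
  qed
  then obtain x where "(\<integral>\<^sup>+y. K \<omega> x y \<partial>\<mu> \<omega>) = 1" ..
  moreover have "transport \<omega> = (\<lambda>x. x)" using False by (simp add: transport_def fun_eq_iff)
  ultimately show ?thesis
    using unlabelled_lborel_le[OF \<omega> False _ A] A by (simp add: emeasure_distr)
qed

text \<open>The image of \<open>\<lambda>\<close> has intensity \<open>1\<close> for every invariant map. Since it is dominated by \<open>\<mu>\<close>, which has the same
  intensity, the two agree.\<close>

lemma transport_pushes_lebesgue_to_mu:
  assumes row: "AE \<omega> in M. AE x in lborel. (\<integral>\<^sup>+y. K \<omega> x y \<partial>\<mu> \<omega>) = 1"
  shows "transports_lebesgue_to M transport \<mu>"
proof -
  note [measurable] = transport_map_measurable_pair[OF transport_invariant]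
  let ?J = "\<lambda>n::nat. {- real n..<real n}"
  let ?\<nu> = "\<lambda>\<omega>. distr lborel borel (transport \<omega>)"
  have eq: "emeasure (?\<nu> \<omega>) (?J n) = (\<integral>\<^sup>+x. indicator (?J n) (transport \<omega> x) \<partial>lborel)" if "\<omega> \<in> space M" for \<omega> n
    using nn_integral_distr[of "transport \<omega>" lborel borel "indicator (?J n)"] transport_measurable'[OF that] by simp
  have meas: "(\<lambda>\<omega>. emeasure (?\<nu> \<omega>) (?J n)) \<in> borel_measurable M" for n
  proof -
    have "(\<lambda>\<omega>. \<integral>\<^sup>+x. indicator (?J n) (transport \<omega> x) \<partial>lborel) \<in> borel_measurable M" by measurable
    then show ?thesis by (simp add: eq cong: measurable_cong)
  qed
  have E: "(\<integral>\<^sup>+\<omega>. emeasure (?\<nu> \<omega>) (?J n) \<partial>M) = ennreal (2 * real n)" for n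
  proof -
    have "(\<integral>\<^sup>+\<omega>. emeasure (?\<nu> \<omega>) (?J n) \<partial>M) = (\<integral>\<^sup>+\<omega>. \<integral>\<^sup>+x. indicator (?J n) (transport \<omega> x) \<partial>lborel \<partial>M)"
      by (intro nn_integral_cong eq)
    also have "\<dots> = (\<integral>\<^sup>+\<omega>. \<integral>\<^sup>+x. indicator (?J n) (x + transport \<omega> 0) \<partial>lborel \<partial>M)"
      by (rule expectation_along_map[OF transport_invariant]) measurable
    also have "\<dots> = (\<integral>\<^sup>+\<omega>. ennreal (2 * real n) \<partial>M)"
    proof (intro nn_integral_cong)
      fix \<omega>
      have "(\<integral>\<^sup>+x. indicator (?J n) (x + transport \<omega> 0) \<partial>lborel) = (\<integral>\<^sup>+x. indicator (?J n) x \<partial>lborel)"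
        by (rule nn_integral_lborel_shift) measurable
      also have "\<dots> = ennreal (2 * real n)" by simp
      finally show "(\<integral>\<^sup>+x. indicator (?J n) (x + transport \<omega> 0) \<partial>lborel) = ennreal (2 * real n)" .
    qed
    finally show ?thesis by (simp add: emeasure_space_1)
  qed
  have mu_E: "(\<integral>\<^sup>+\<omega>. emeasure (\<mu> \<omega>) (?J n) \<partial>M) = ennreal (2 * real n)" for n
    using expected_mass[of "- real n" "2 * n"] by (simp add: ennreal_of_nat_eq_real_of_nat del: of_nat_mult) simp
  have "AE \<omega> in M. emeasure (\<mu> \<omega>) (?J n) \<le> emeasure (?\<nu> \<omega>) (?J n)" for n
  proof -
    have le: "AE \<omega> in M. emeasure (?\<nu> \<omega>) (?J n) \<le> emeasure (\<mu> \<omega>) (?J n)"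
      using row AE_space by eventually_elim (auto intro: transport_image_le)
    have "(\<integral>\<^sup>+\<omega>. (emeasure (\<mu> \<omega>) (?J n) - emeasure (?\<nu> \<omega>) (?J n)) \<partial>M) = 0"
      by (subst nn_integral_diff) (use meas le in \<open>auto simp: E mu_E ennreal_minus\<close>)
    then have "AE \<omega> in M. emeasure (\<mu> \<omega>) (?J n) - emeasure (?\<nu> \<omega>) (?J n) = 0"
      using meas by (subst (asm) nn_integral_0_iff_AE) auto
    then show ?thesis
      by eventually_elim (rule ennreal_minus_eq_0)
  qed
  then have "AE \<omega> in M. \<forall>n. emeasure (\<mu> \<omega>) (?J n) \<le> emeasure (?\<nu> \<omega>) (?J n)"
    by (simp add: AE_all_countable)
  then show ?thesis
    unfolding transports_lebesgue_to_def using row AE_space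
  proof eventually_elim
    case (elim \<omega>)
    show ?case
    proof (rule measure_eq_of_le_of_eq_intervals)
      show le: "emeasure (?\<nu> \<omega>) A \<le> emeasure (\<mu> \<omega>) A" if "A \<in> sets borel" for A
        using elim that by (intro transport_image_le)
      show "emeasure (?\<nu> \<omega>) (?J n) = emeasure (\<mu> \<omega>) (?J n)" for n
        using elim le by (intro antisym) auto
      show "emeasure (\<mu> \<omega>) (?J n) < \<infinity>" for n by (rule locally_finite)
    qed auto
  qed
qed

text \<open>The classes meeting \<open>[0,1)\<close> have labels in \<open>[-1,2]\<close> and lie in \<open>[-2,3]\<close>. Comparing a point with its label costs
  at most \<open>1\<close>, once for the map on \<open>[0,1)\<close> and once for the coupling on \<open>[-2,3]\<close>, whence the constant \<open>1 + 5\<close>.\<close>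

lemma transport_cost_on_unit_interval:
  assumes \<omega>: "\<omega> \<in> space M" and row: "AE x in lborel. (\<integral>\<^sup>+y. K \<omega> x y \<partial>\<mu> \<omega>) = 1"
    and q: "0 < q" "q \<le> 1"
  shows "(\<integral>\<^sup>+x. indicator {0..<1} x * ennreal (\<bar>transport \<omega> x - x\<bar> powr q) \<partial>lborel)
    \<le> (\<integral>\<^sup>+x. indicator {-2..3} x * match_cost q \<omega> x \<partial>lborel) + 6"
proof (cases "labelled \<omega>")
  case True
  note [measurable] = transport_measurable'[OF \<omega>] label_measurable'[OF \<omega>]
  note [measurable (raw)] = K_measurable_at[OF \<omega>]
  have [measurable]: "match_cost q \<omega> \<in> borel_measurable borel"
    using match_cost_measurable[of "\<lambda>_. \<omega>" borel "\<lambda>x. x"] \<omega> by simp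
  have near: "label \<omega> x - x \<le> 1" "x - label \<omega> x \<le> 1" for x using label_near[of \<omega> x] by (simp_all add: abs_le_iff)
  let ?g = "\<lambda>l y. indicator {-1..2} l * ennreal (\<bar>y - l\<bar> powr q)"
  have tri: "ennreal (\<bar>y - x\<bar> powr q) \<le> ennreal (\<bar>y - z\<bar> powr q) + 1" if "\<bar>z - x\<bar> \<le> 1" for x y z :: real
  proof -
    have "\<bar>y - x\<bar> powr q \<le> (\<bar>y - z\<bar> + \<bar>z - x\<bar>) powr q" using q by (intro powr_mono2) auto
    also have "\<dots> \<le> \<bar>y - z\<bar> powr q + \<bar>z - x\<bar> powr q" using q by (intro powr_add_le_add_powr) auto
    also have "\<bar>z - x\<bar> powr q \<le> 1" using that q powr_mono2[of q "\<bar>z - x\<bar>" 1] by simp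
    finally have "\<bar>y - x\<bar> powr q \<le> \<bar>y - z\<bar> powr q + 1" by simp
    then have "ennreal (\<bar>y - x\<bar> powr q) \<le> ennreal (\<bar>y - z\<bar> powr q + 1)" by (rule ennreal_leI)
    then show ?thesis by simp
  qed
  have "(\<integral>\<^sup>+x. indicator {0..<1} x * ennreal (\<bar>transport \<omega> x - x\<bar> powr q) \<partial>lborel) \<le>
      (\<integral>\<^sup>+x. ?g (label \<omega> x) (transport \<omega> x) + indicator {0..<1} x \<partial>lborel)"
  proof (rule nn_integral_mono)
    fix x :: real
    show "indicator {0..<1} x * ennreal (\<bar>transport \<omega> x - x\<bar> powr q) \<le>
      ?g (label \<omega> x) (transport \<omega> x) + indicator {0..<1} x"
      using near[of x] tri[OF label_near[of \<omega> x], of "transport \<omega> x"] by (auto split: split_indicator)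
  qed
  also have "\<dots> = (\<integral>\<^sup>+x. ?g (label \<omega> x) (transport \<omega> x) \<partial>lborel) + 1"
    by (subst nn_integral_add) auto
  also have "(\<integral>\<^sup>+x. ?g (label \<omega> x) (transport \<omega> x) \<partial>lborel) = (\<integral>\<^sup>+x. \<integral>\<^sup>+y. ?g (label \<omega> x) y * K \<omega> x y \<partial>\<mu> \<omega> \<partial>lborel)"
    by (rule nn_integral_transport[OF \<omega> True row, where g="?g"]) measurable
  also have "\<dots> \<le> (\<integral>\<^sup>+x. indicator {-2..3} x * match_cost q \<omega> x + indicator {-2..3} x \<partial>lborel)"
  proof (rule nn_integral_mono_AE)
    show "AE x in lborel. (\<integral>\<^sup>+y. ?g (label \<omega> x) y * K \<omega> x y \<partial>\<mu> \<omega>) \<le> indicator {-2..3} x * match_cost q \<omega> x + indicator {-2..3} x"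
      using row
    proof eventually_elim
      case (elim x)
      have "(\<integral>\<^sup>+y. ?g (label \<omega> x) y * K \<omega> x y \<partial>\<mu> \<omega>) \<le>
        (\<integral>\<^sup>+y. indicator {-2..3} x * (ennreal (\<bar>y - x\<bar> powr q) * K \<omega> x y + K \<omega> x y) \<partial>\<mu> \<omega>)"
      proof (rule nn_integral_mono)
        fix y
        have "ennreal (\<bar>y - label \<omega> x\<bar> powr q) \<le> ennreal (\<bar>y - x\<bar> powr q) + 1"
          using tri[of x "label \<omega> x" y] label_near[of \<omega> x] by (simp add: abs_minus_commute)
        then have "ennreal (\<bar>y - label \<omega> x\<bar> powr q) * K \<omega> x y \<le> (ennreal (\<bar>y - x\<bar> powr q) + 1) * K \<omega> x y"
          by (rule mult_right_mono) simp
        then show "?g (label \<omega> x) y * K \<omega> x y \<le> indicator {-2..3} x * (ennreal (\<bar>y - x\<bar> powr q) * K \<omega> x y + K \<omega> x y)"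
          using near[of x] by (auto simp: distrib_right split: split_indicator)
      qed
      also have "\<dots> = indicator {-2..3} x * ((\<integral>\<^sup>+y. ennreal (\<bar>y - x\<bar> powr q) * K \<omega> x y \<partial>\<mu> \<omega>) + (\<integral>\<^sup>+y. K \<omega> x y \<partial>\<mu> \<omega>))"
        by (subst nn_integral_cmult, measurable, subst nn_integral_add) auto
      also have "\<dots> \<le> indicator {-2..3} x * (match_cost q \<omega> x + 1)"
        unfolding elim using K_cost[OF \<omega>, of q x] q by (intro mult_left_mono add_right_mono) auto
      finally show ?case by (simp add: distrib_left)
    qed
  qed
  also have "\<dots> = (\<integral>\<^sup>+x. indicator {-2..3} x * match_cost q \<omega> x \<partial>lborel) + 5"
    by (subst nn_integral_add) auto
  finally show ?thesis by (simp add: add.assoc)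
qed (simp add: transport_def)

lemma transport_displacement_finite:
  assumes q: "0 < q" "q \<le> 1" and fin: "(\<integral>\<^sup>+\<omega>. match_cost q \<omega> 0 \<partial>M) < \<infinity>"
  shows "displacement_cost transport q < \<infinity>"
proof -
  note [measurable] = transport_map_measurable_pair[OF transport_invariant]
  interpret P: pair_sigma_finite lborel M ..
  have "displacement_cost transport q = (\<integral>\<^sup>+\<omega>. \<integral>\<^sup>+x. indicator {0..<1} x * ennreal (\<bar>x + transport \<omega> 0 - x\<bar> powr q) \<partial>lborel \<partial>M)"
    unfolding displacement_cost_def by (intro nn_integral_cong) (simp add: nn_integral_multc)
  also have "\<dots> = (\<integral>\<^sup>+\<omega>. \<integral>\<^sup>+x. indicator {0..<1} x * ennreal (\<bar>transport \<omega> x - x\<bar> powr q) \<partial>lborel \<partial>M)"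
    by (rule expectation_along_map[OF transport_invariant, symmetric,
      where g="\<lambda>x y. indicator {0..<1} x * ennreal (\<bar>y - x\<bar> powr q)"]) measurable
  also have "\<dots> \<le> (\<integral>\<^sup>+\<omega>. (\<integral>\<^sup>+x. indicator {-2..3} x * match_cost q \<omega> x \<partial>lborel) + 6 \<partial>M)"
  proof (rule nn_integral_mono_AE)
    show "AE \<omega> in M. (\<integral>\<^sup>+x. indicator {0..<1} x * ennreal (\<bar>transport \<omega> x - x\<bar> powr q) \<partial>lborel)
        \<le> (\<integral>\<^sup>+x. indicator {-2..3} x * match_cost q \<omega> x \<partial>lborel) + 6"
      using AE_row_eq_1[OF q(1) fin] AE_space
      by eventually_elim (intro transport_cost_on_unit_interval q)
  qed
  also have "\<dots> = (\<integral>\<^sup>+\<omega>. \<integral>\<^sup>+x. indicator {-2..3} x * match_cost q \<omega> x \<partial>lborel \<partial>M) + 6"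
    by (subst nn_integral_add) (auto simp: emeasure_space_1)
  also have "(\<integral>\<^sup>+\<omega>. \<integral>\<^sup>+x. indicator {-2..3} x * match_cost q \<omega> x \<partial>lborel \<partial>M) =
      (\<integral>\<^sup>+x. \<integral>\<^sup>+\<omega>. indicator {-2..3} x * match_cost q \<omega> x \<partial>M \<partial>lborel)"
    by (rule P.Fubini') measurable
  also have "\<dots> = (\<integral>\<^sup>+x. (\<integral>\<^sup>+\<omega>. match_cost q \<omega> 0 \<partial>M) * indicator {-2..3::real} x \<partial>lborel)"
  proof (rule nn_integral_cong)
    fix x :: real
    have "(\<integral>\<^sup>+\<omega>. indicator {-2..3} x * match_cost q \<omega> x \<partial>M) = indicator {-2..3} x * (\<integral>\<^sup>+\<omega>. match_cost q \<omega> x \<partial>M)"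
      by (rule nn_integral_cmult) measurable
    then show "(\<integral>\<^sup>+\<omega>. indicator {-2..3} x * match_cost q \<omega> x \<partial>M) = (\<integral>\<^sup>+\<omega>. match_cost q \<omega> 0 \<partial>M) * indicator {-2..3} x"
      unfolding expected_match_cost_eq by (simp only: mult.commute)
  qed
  also have "\<dots> = (\<integral>\<^sup>+\<omega>. match_cost q \<omega> 0 \<partial>M) * 5"
    by (simp add: nn_integral_cmult_indicator)
  also have "\<dots> + 6 < \<infinity>" using fin by (simp add: ennreal_mult_less_top)
  finally show ?thesis .
qed

lemma finite_cost:
  assumes p: "0 < q" "q < p" "p < 1"
    and ls: "limsup (\<lambda>n. mass_std_dev M \<mu> (real n) * ennreal (real n powr (p - 1))) = 0"
  shows "transport_cost M \<theta> \<mu> q < \<infinity>"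
proof -
  have fin: "(\<integral>\<^sup>+\<omega>. match_cost q \<omega> 0 \<partial>M) < \<infinity>" by (rule expected_match_cost_finite[OF p ls])
  have "transport_cost M \<theta> \<mu> q \<le> displacement_cost transport q"
    unfolding transport_cost_def displacement_cost_def
    using transport_invariant transport_pushes_lebesgue_to_mu[OF AE_row_eq_1[OF p(1) fin]] by (intro INF_lower) auto
  also have "\<dots> < \<infinity>" using p by (intro transport_displacement_finite fin) auto
  finally show ?thesis .
qed

end

section \<open>Reduction to locally finite measures\<close>

context unit_invariant_measure
begin

text \<open>Unit intensity makes \<open>\<mu>\<close> locally finite almost surely. On the exceptional event, which is invariant
  under the flow, it is replaced by Lebesgue measure, so that invariance continues to hold
  for every \<open>\<omega>\<close>.\<close>

definition locally_finite_at :: "'a \<Rightarrow> bool" where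
  "locally_finite_at \<omega> \<longleftrightarrow> \<omega> \<in> space M \<and> (\<forall>n::nat. emeasure (\<mu> \<omega>) {- real n..<real n} < \<infinity>)"

definition lf_version :: "'a \<Rightarrow> real measure" where
  "lf_version \<omega> = (if locally_finite_at \<omega> then \<mu> \<omega> else lborel)"

lemma locally_finite_at_finite: "locally_finite_at \<omega> \<Longrightarrow> emeasure (\<mu> \<omega>) {a..<b} < \<infinity>"
proof -
  assume t: "locally_finite_at \<omega>"
  obtain n :: nat where n: "max \<bar>a\<bar> \<bar>b\<bar> \<le> real n" using real_arch_simple by blast
  have "emeasure (\<mu> \<omega>) {a..<b} \<le> emeasure (\<mu> \<omega>) {- real n..<real n}"
    using n t by (intro emeasure_mono) (auto simp: locally_finite_at_def sets_mu)
  also have "\<dots> < \<infinity>" using t by (simp add: locally_finite_at_def)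
  finally show ?thesis .
qed

lemma locally_finite_at_shift: "\<omega> \<in> space M \<Longrightarrow> locally_finite_at (\<theta> t \<omega>) = locally_finite_at \<omega>"
proof -
  assume \<omega>: "\<omega> \<in> space M"
  have imp: "locally_finite_at (\<theta> t \<omega>)" if "locally_finite_at \<omega>" "\<omega> \<in> space M" for t \<omega>
    using that flow_in_space locally_finite_at_finite[OF that(1)] by (simp add: locally_finite_at_def emeasure_mu_shift[symmetric])
  show ?thesis
    using imp[of \<omega> t] imp[of "\<theta> t \<omega>" "- t"] \<omega> flow_in_space[OF \<omega>] flow_add[OF \<omega>, of "- t" t] flow_zero[OF \<omega>]
    by auto
qed

lemma AE_locally_finite_at: "AE \<omega> in M. locally_finite_at \<omega>"
proof -
  have "AE \<omega> in M. \<forall>n::nat. emeasure (\<mu> \<omega>) {- real n..<real n} < \<infinity>"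
    unfolding AE_all_countable using AE_finite_mass[of "- real n" "2 * n" for n] by simp
  then show ?thesis using AE_space by eventually_elim (simp add: locally_finite_at_def)
qed

lemma AE_lf_version: "AE \<omega> in M. lf_version \<omega> = \<mu> \<omega>"
  using AE_locally_finite_at by eventually_elim (simp add: lf_version_def)

lemma locally_finite_lf_version: "locally_finite_invariant_measure M \<theta> lf_version"
proof
  have [measurable]: "Measurable.pred M locally_finite_at"
    unfolding locally_finite_at_def[abs_def] by measurable
  show "random_measure M lf_version"
    unfolding random_measure_def
  proof (intro conjI ballI)
    fix A :: "real set" assume [measurable]: "A \<in> sets borel"
    have "(\<lambda>\<omega>. emeasure (lf_version \<omega>) A) = (\<lambda>\<omega>. if locally_finite_at \<omega> then emeasure (\<mu> \<omega>) A else emeasure lborel A)"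
      by (auto simp: lf_version_def)
    then show "(\<lambda>\<omega>. emeasure (lf_version \<omega>) A) \<in> borel_measurable M" by simp
  qed (auto simp: lf_version_def sets_mu sigma_finite_mu lborel.sigma_finite_measure_axioms)
  show "invariant_measure M \<theta> lf_version"
    unfolding invariant_measure_def
  proof (intro ballI allI)
    fix \<omega> t and A :: "real set" assume \<omega>: "\<omega> \<in> space M" and A [measurable]: "A \<in> sets borel"
    show "emeasure (lf_version (\<theta> t \<omega>)) ((\<lambda>x. x - t) ` A) = emeasure (lf_version \<omega>) A"
    proof (cases "locally_finite_at \<omega>")
      case True
      then show ?thesis using invariant \<omega> A by (simp add: lf_version_def locally_finite_at_shift invariant_measure_def)
    next
      case False
      have im: "(\<lambda>x. x - t) ` A = (\<lambda>x. x + t) -` A" by (auto simp: image_iff intro!: bexI[of _ "x + t" for x])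
      have [measurable]: "(\<lambda>x. x + t) -` A \<in> sets borel"
        using measurable_sets[of "\<lambda>x. x + t" borel borel A] by simp
      have "emeasure lborel ((\<lambda>x. x + t) -` A) = (\<integral>\<^sup>+x. indicator ((\<lambda>x. x + t) -` A) x \<partial>lborel)"
        by (rule nn_integral_indicator[symmetric]) simp
      also have "\<dots> = (\<integral>\<^sup>+x. indicator A (x + t) \<partial>lborel)"
        by (intro nn_integral_cong) (auto split: split_indicator)
      also have "\<dots> = emeasure lborel A" by (subst nn_integral_lborel_shift) auto
      finally show ?thesis using False \<omega> by (simp add: lf_version_def locally_finite_at_shift im)
    qed
  qed
  show "unit_intensity M lf_version"
  proof -
    have "(\<integral>\<^sup>+\<omega>. emeasure (lf_version \<omega>) {0..<1} \<partial>M) = (\<integral>\<^sup>+\<omega>. emeasure (\<mu> \<omega>) {0..<1} \<partial>M)"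
      using AE_lf_version by (intro nn_integral_cong_AE) (auto elim!: eventually_mono)
    then show ?thesis using unit by (simp add: unit_intensity_def)
  qed
  show "sets (lf_version \<omega>) = sets borel" for \<omega> by (auto simp: lf_version_def locally_finite_at_def sets_mu)
  show "emeasure (lf_version \<omega>) {a..<b} < \<infinity>" for \<omega> a b
    using locally_finite_at_finite[of \<omega> a b] by (cases "locally_finite_at \<omega>"; cases "a \<le> b") (simp_all add: lf_version_def)
qed

lemma mass_std_dev_lf_version: "mass_std_dev M lf_version (real n) = mass_std_dev M \<mu> (real n)"
proof -
  interpret T: locally_finite_invariant_measure M \<theta> lf_version by (rule locally_finite_lf_version)
  have "mass_variance M lf_version (real n) = mass_variance M \<mu> (real n)"
    unfolding mass_variance_def mass_mean_eq T.mass_mean_eq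
    using AE_lf_version by (intro nn_integral_cong_AE) (auto elim!: eventually_mono)
  then show ?thesis by (simp add: mass_std_dev_def)
qed

lemma transport_cost_lf_version: "transport_cost M \<theta> lf_version q = transport_cost M \<theta> \<mu> q"
proof -
  have "transports_lebesgue_to M S lf_version = transports_lebesgue_to M S \<mu>" for S
    unfolding transports_lebesgue_to_def
    using AE_lf_version by (intro eventually_subst) (auto elim!: eventually_mono)
  then show ?thesis by (simp add: transport_cost_def)
qed

end

theorem theorem1p1:
  fixes M :: "'a measure" and \<theta> :: "real \<Rightarrow> 'a \<Rightarrow> 'a" and \<mu> :: "'a \<Rightarrow> real measure"
    and p :: real
  assumes "stationary_flow M \<theta>"
    and "random_measure M \<mu>"
    and "invariant_measure M \<theta> \<mu>"
    and "unit_intensity M \<mu>"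
    and "0 < p" and "p < 1"
  shows "(limsup (\<lambda>n. mass_std_dev M \<mu> (real n) * ennreal (real n powr (p - 1))) = 0 \<longrightarrow>
            (\<forall>q. 0 < q \<and> q < p \<longrightarrow> transport_cost M \<theta> \<mu> q < \<infinity>)) \<and>
         (regular_variance M \<mu> \<and> satisfies_CLT M \<mu> \<and>
          limsup (\<lambda>n. mass_std_dev M \<mu> (real n) * ennreal (real n powr (p - 1))) > 0 \<longrightarrow>
            transport_cost M \<theta> \<mu> p = \<infinity>)"
proof -
  interpret unit_invariant_measure M \<theta> \<mu>
    using assms by (intro unit_invariant_measure.intro unit_invariant_measure_axioms.intro)
  interpret T: locally_finite_invariant_measure M \<theta> lf_version by (rule locally_finite_lf_version)
  show ?thesis
    using T.finite_cost[of _ p] infinite_cost_of_CLT[of p] assms(5,6)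
    by (simp add: mass_std_dev_lf_version transport_cost_lf_version)
qed

end
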